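(* Let $X,\eta$ be $d$-dimensional random vectors on a sublinear expectation space $(\Omega,\mathcal{H},\mathbb{E})$ such that the pair $(X,\eta)$ satisfies $$(aX+b\bar X,\;a^2\eta+b^2\bar\eta)\overset{d}{=}(\sqrt{a^2+b^2}\,X,\;(a^2+b^2)\eta)\qquad\text{for all }a,b\ge0,$$ where $(\bar X,\bar\eta)$ is an independent copy of $(X,\eta)$. For $\varphi\in C_{l.Lip}(\mathbb{R}^d\times\mathbb{R}^d)$ define $$u(t,x,y):=\mathbb{E}[\varphi(x+\sqrt t\,X,\;y+t\eta)],\qquad(t,x,y)\in[0,\infty)\times\mathbb{R}^d\times\mathbb{R}^d.$$ Then $$u(t+s,x,y)=\mathbb{E}[u(t,x+\sqrt s\,X,y+s\eta)],\qquad s\ge0.$$ Moreover, for each $T>0$ there exist constants $C,k>0$ such that for all $t,s\in[0,T]$ and $x,\bar x,y,\bar y\in\mathbb{R}^d$, $$(1)\quad|u(t,x,y)-u(t,\bar x,\bar y)|\le C(1+|x|^k+|y|^k+|\bar x|^k+|\bar y|^k)(|x-\bar x|+|y-\bar y|),$$ $$(2)\quad|u(t,x,y)-u(t+s,x,y)|\le C(1+|x|^k+|y|^k)(s+|s|^{1/2}).$$ Moreover, $u$ is the unique viscosity solution, continuous in the sense of (1) and (2), of the PDE $$\partial_tu-G(D_yu,D_x^2u)=0\ \text{ on }(0,\infty)\times\mathbb{R}^d\times\mathbb{R}^d,\qquad u|_{t=0}=\varphi,$$ where $G(p,A):=\mathbb{E}[\frac12\langle AX,X\rangle+\langle p,\eta\rangle]$,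 $(p,A)\in\mathbb{R}^d\times\mathbb{S}(d)$.
   Context: $\mathbb{S}(d)$ is the space of symmetric $d\times d$ real matrices. $C_{l.Lip}(\mathbb{R}^n)$ is the space of functions $\varphi:\mathbb{R}^n\to\mathbb{R}$ with $|\varphi(x)-\varphi(y)|\le C(1+|x|^m+|y|^m)|x-y|$ for some $C>0$, $m\in\mathbb{N}$ depending on $\varphi$. Sublinear expectation space $(\Omega,\mathcal{H},\mathbb{E})$: $\Omega$ is a set; $\mathcal{H}$ is a linear space of real functions on $\Omega$ containing the constants, with $|X|\in\mathcal{H}$ if $X\in\mathcal{H}$, and $\varphi(X_1,\dots,X_n)\in\mathcal{H}$ whenever $X_1,\dots,X_n\in\mathcal{H}$ and $\varphi\in C_{l.Lip}(\mathbb{R}^n)$; $\mathbb{E}:\mathcal{H}\to\mathbb{R}$ satisfies: $X\ge Y\Rightarrow\mathbb{E}[X]\ge\mathbb{E}[Y]$; $\mathbb{E}[c]=c$ for $c\in\mathbb{R}$; $\mathbb{E}[X+Y]\le\mathbb{E}[X]+\mathbb{E}[Y]$; $\mathbb{E}[\lambda X]=\lambda\mathbb{E}[X]$ for $\lambda\ge0$. An $n$-dimensional random vector is an element of $\mathcal{H}^n$. $X_1\overset{d}{=}X_2$ (identically distributed) means $\mathbb{E}_1[\varphi(X_1)]=\mathbb{E}_2[\varphi(X_2)]$ for all $\varphi\in C_{l.Lip}(\mathbb{R}^n)$. $Y\in\mathcal{H}^n$ is independent from $X\in\mathcal{H}^m$ if $\mathbb{E}[\varphi(X,Y)]=\mathbb{E}[\mathbb{E}[\varphi(x,Y)]_{x=X}]$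 for all $\varphi\in C_{l.Lip}(\mathbb{R}^{m+n})$. An independent copy of a random vector $Z$ is a random vector $\bar Z\overset{d}{=}Z$ independent from $Z$ (realized, if necessary, on a product space); so the displayed identity in law means $\mathbb{E}[\mathbb{E}[\varphi(ax+bX,a^2y+b^2\eta)]_{(x,y)=(X,\eta)}]=\mathbb{E}[\varphi(\sqrt{a^2+b^2}X,(a^2+b^2)\eta)]$ for all $\varphi\in C_{l.Lip}(\mathbb{R}^{2d})$. Viscosity solutions are in the standard (Crandall--Ishii--Lions) parabolic sense: at a point where a smooth test function touches $u$ from above (below), $\partial_t\psi-G(D_y\psi,D_x^2\psi)\le0$ ($\ge0$). *)

theory Defs
  imports "HOL-Analysis.Analysis"
begin

section \<open>Functions of polynomial growth that are locally Lipschitz\<close>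

definition C_lLip :: "('a::real_normed_vector \<Rightarrow> real) set" where
  "C_lLip = {\<phi>. \<exists>C>0. \<exists>m::nat. \<forall>x y.
     \<bar>\<phi> x - \<phi> y\<bar> \<le> C * (1 + norm x ^ m + norm y ^ m) * norm (x - y)}"

text \<open>The same class on \<open>R^n\<close> for a natural number \<open>n\<close>, needed because the closure property of
  \<open>H\<close> below quantifies over \<open>n\<close>.  A vector is the family of the first \<open>n\<close> values of a sequence;
  the norm is the Euclidean norm of these values, so members of \<open>C_lLip_nat n\<close> automatically
  ignore all values from index \<open>n\<close> on.\<close>

definition C_lLip_nat :: "nat \<Rightarrow> ((nat \<Rightarrow> real) \<Rightarrow> real) set" where
  "C_lLip_nat n = {\<phi>. \<exists>C>0. \<exists>m::nat. \<forall>x y.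
     \<bar>\<phi> x - \<phi> y\<bar> \<le> C * (1 + L2_set x {..<n} ^ m + L2_set y {..<n} ^ m)
                    * L2_set (\<lambda>i. x i - y i) {..<n}}"


section \<open>Sublinear expectation spaces\<close>

text \<open>The sample space is the type \<open>'w\<close>.  \<open>E\<close> is a total function for technical reasons; only
  its values on \<open>H\<close> are constrained.\<close>

locale sublinear_expectation =
  fixes H :: "('w \<Rightarrow> real) set" and E :: "('w \<Rightarrow> real) \<Rightarrow> real"
  assumes const_in: "(\<lambda>_. c) \<in> H"
    and add_in: "X \<in> H \<Longrightarrow> Y \<in> H \<Longrightarrow> (\<lambda>\<omega>. X \<omega> + Y \<omega>) \<in> H"
    and scale_in: "X \<in> H \<Longrightarrow> (\<lambda>\<omega>. c * X \<omega>) \<in> H"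
    and abs_in: "X \<in> H \<Longrightarrow> (\<lambda>\<omega>. \<bar>X \<omega>\<bar>) \<in> H"
    and lLip_in: "\<phi> \<in> C_lLip_nat n \<Longrightarrow> (\<And>i. i < n \<Longrightarrow> Xs i \<in> H)
                    \<Longrightarrow> (\<lambda>\<omega>. \<phi> (\<lambda>i. Xs i \<omega>)) \<in> H"
    and mono: "X \<in> H \<Longrightarrow> Y \<in> H \<Longrightarrow> (\<And>\<omega>. Y \<omega> \<le> X \<omega>) \<Longrightarrow> E Y \<le> E X"
    and const: "E (\<lambda>_. c) = c"
    and subadditive: "X \<in> H \<Longrightarrow> Y \<in> H \<Longrightarrow> E (\<lambda>\<omega>. X \<omega> + Y \<omega>) \<le> E X + E Y"
    and pos_homogeneous: "X \<in> H \<Longrightarrow> 0 \<le> l \<Longrightarrow> E (\<lambda>\<omega>. l * X \<omega>) = l * E X"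

definition random_vector :: "('w \<Rightarrow> real) set \<Rightarrow> ('w \<Rightarrow> real ^ 'd) \<Rightarrow> bool" where
  "random_vector H X \<longleftrightarrow> (\<forall>i. (\<lambda>\<omega>. X \<omega> $ i) \<in> H)"

definition ident_distributed ::
  "(('v \<Rightarrow> real) \<Rightarrow> real) \<Rightarrow> ('v \<Rightarrow> 'a::real_normed_vector)
    \<Rightarrow> (('w \<Rightarrow> real) \<Rightarrow> real) \<Rightarrow> ('w \<Rightarrow> 'a) \<Rightarrow> bool" where
  "ident_distributed E1 X1 E2 X2 \<longleftrightarrow>
     (\<forall>\<phi>\<in>C_lLip. E1 (\<lambda>\<omega>. \<phi> (X1 \<omega>)) = E2 (\<lambda>\<omega>. \<phi> (X2 \<omega>)))"

definition independent_from ::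
  "(('w \<Rightarrow> real) \<Rightarrow> real) \<Rightarrow> ('w \<Rightarrow> 'b::real_normed_vector) \<Rightarrow> ('w \<Rightarrow> 'a::real_normed_vector)
    \<Rightarrow> bool" where
  "independent_from E Y X \<longleftrightarrow>
     (\<forall>\<phi>\<in>C_lLip. E (\<lambda>\<omega>. \<phi> (X \<omega>, Y \<omega>)) = E (\<lambda>\<omega>. E (\<lambda>\<omega>'. \<phi> (X \<omega>, Y \<omega>'))))"

definition independent_copy ::
  "(('w \<Rightarrow> real) \<Rightarrow> real) \<Rightarrow> ('w \<Rightarrow> 'a::real_normed_vector) \<Rightarrow> ('w \<Rightarrow> 'a) \<Rightarrow> bool" where
  "independent_copy E Zbar Z \<longleftrightarrow> ident_distributed E Zbar E Z \<and> independent_from E Zbar Z"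

text \<open>The expectation of the product space, \<open>E[E'[Z(\<omega>, \<sqdot>)]]\<close>: the second factor is averaged
  first, so that the second coordinate is independent from the first one.\<close>

definition prod_expectation ::
  "(('v \<Rightarrow> real) \<Rightarrow> real) \<Rightarrow> (('w \<Rightarrow> real) \<Rightarrow> real) \<Rightarrow> (('v \<times> 'w \<Rightarrow> real) \<Rightarrow> real)" where
  "prod_expectation E E' Z = E (\<lambda>\<omega>. E' (\<lambda>\<omega>'. Z (\<omega>, \<omega>')))"

text \<open>On the product of a sublinear expectation space with itself, the second coordinate realizes
  an independent copy of any random vector.\<close>

lemma (in sublinear_expectation) independent_copy_on_product:
  "ident_distributed (prod_expectation E E) (\<lambda>(\<omega>, \<omega>'). Z \<omega>) E Z"
  "independent_copy (prod_expectation E E) (\<lambda>(\<omega>, \<omega>'). Z \<omega>') (\<lambda>(\<omega>, \<omega>'). Z \<omega>)"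
  by (simp_all add: independent_copy_def ident_distributed_def independent_from_def
      prod_expectation_def const)


section \<open>The function G\<close>

text \<open>\<open>G\<close> is only of interest for symmetric \<open>A\<close>; the formula makes sense for every matrix.\<close>

definition G_fun ::
  "(('w \<Rightarrow> real) \<Rightarrow> real) \<Rightarrow> ('w \<Rightarrow> real ^ 'd) \<Rightarrow> ('w \<Rightarrow> real ^ 'd)
    \<Rightarrow> real ^ 'd \<Rightarrow> real ^ 'd ^ 'd \<Rightarrow> real" where
  "G_fun E X \<eta> p A = E (\<lambda>\<omega>. 1/2 * ((A *v X \<omega>) \<bullet> X \<omega>) + p \<bullet> \<eta> \<omega>)"


section \<open>Regularity\<close>

definition poly_lip_holder ::
  "(real \<Rightarrow> 'a::real_normed_vector \<Rightarrow> 'b::real_normed_vector \<Rightarrow> real) \<Rightarrow> bool" where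
  "poly_lip_holder u \<longleftrightarrow> (\<forall>T>0. \<exists>C>0. \<exists>k::real. k > 0 \<and>
     (\<forall>t\<in>{0..T}. \<forall>s\<in>{0..T}. \<forall>x x' y y'.
        \<bar>u t x y - u t x' y'\<bar>
          \<le> C * (1 + norm x powr k + norm y powr k + norm x' powr k + norm y' powr k)
              * (norm (x - x') + norm (y - y'))
      \<and> \<bar>u t x y - u (t + s) x y\<bar>
          \<le> C * (1 + norm x powr k + norm y powr k) * (s + sqrt \<bar>s\<bar>)))"


section \<open>Viscosity solutions\<close>

text \<open>\<open>\<psi>\<close> is a test function of class \<open>C^{1,2}\<close> on \<open>(0, \<infinity>) \<times> Z\<close>, with time derivative \<open>\<psi>t\<close>, spatial
  gradient \<open>D\<psi>\<close> and spatial Hessian \<open>H\<psi>\<close> (as a bounded linear map).\<close>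

definition C12_test ::
  "(real \<Rightarrow> 'z::euclidean_space \<Rightarrow> real) \<Rightarrow> (real \<Rightarrow> 'z \<Rightarrow> real) \<Rightarrow> (real \<Rightarrow> 'z \<Rightarrow> 'z)
    \<Rightarrow> (real \<Rightarrow> 'z \<Rightarrow> 'z \<Rightarrow>\<^sub>L 'z) \<Rightarrow> bool" where
  "C12_test \<psi> \<psi>t D\<psi> H\<psi> \<longleftrightarrow>
     (\<forall>t>0. \<forall>z. ((\<lambda>s. \<psi> s z) has_real_derivative \<psi>t t z) (at t)
              \<and> GDERIV (\<psi> t) z :> D\<psi> t z
              \<and> (D\<psi> t has_derivative blinfun_apply (H\<psi> t z)) (at z))
   \<and> continuous_on ({0<..} \<times> UNIV) (\<lambda>(t, z). \<psi> t z)
   \<and> continuous_on ({0<..} \<times> UNIV) (\<lambda>(t, z). \<psi>t t z)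
   \<and> continuous_on ({0<..} \<times> UNIV) (\<lambda>(t, z). D\<psi> t z)
   \<and> continuous_on ({0<..} \<times> UNIV) (\<lambda>(t, z). H\<psi> t z)"

text \<open>The \<open>x\<close>-\<open>x\<close> block of a Hessian in the variable \<open>(x, y)\<close>.\<close>

definition xx_block ::
  "(((real ^ 'd) \<times> (real ^ 'd)) \<Rightarrow>\<^sub>L ((real ^ 'd) \<times> (real ^ 'd))) \<Rightarrow> real ^ 'd ^ 'd" where
  "xx_block B = matrix (\<lambda>h. fst (blinfun_apply B (h, 0)))"

text \<open>Viscosity sub- and supersolutions of \<open>\<partial>\<^sub>t u - G(D\<^sub>y u, D\<^sub>x\<^sup>2 u) = 0\<close> on
  \<open>(0, \<infinity>) \<times> R^d \<times> R^d\<close>.  Touching is local; the spatial gradient of a test function is the pair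
  \<open>(D\<^sub>x \<psi>, D\<^sub>y \<psi>)\<close>.\<close>

definition viscosity_subsolution ::
  "(real ^ 'd \<Rightarrow> real ^ 'd ^ 'd \<Rightarrow> real) \<Rightarrow> (real \<Rightarrow> real ^ 'd \<Rightarrow> real ^ 'd \<Rightarrow> real) \<Rightarrow> bool" where
  "viscosity_subsolution G u \<longleftrightarrow>
     (\<forall>\<psi> \<psi>t D\<psi> H\<psi> t x y. C12_test \<psi> \<psi>t D\<psi> H\<psi> \<longrightarrow> t > 0 \<longrightarrow> u t x y = \<psi> t (x, y) \<longrightarrow>
        (\<forall>\<^sub>F (s, x', y') in nhds (t, x, y). u s x' y' \<le> \<psi> s (x', y')) \<longrightarrow>
        \<psi>t t (x, y) - G (snd (D\<psi> t (x, y))) (xx_block (H\<psi> t (x, y))) \<le> 0)"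

definition viscosity_supersolution ::
  "(real ^ 'd \<Rightarrow> real ^ 'd ^ 'd \<Rightarrow> real) \<Rightarrow> (real \<Rightarrow> real ^ 'd \<Rightarrow> real ^ 'd \<Rightarrow> real) \<Rightarrow> bool" where
  "viscosity_supersolution G u \<longleftrightarrow>
     (\<forall>\<psi> \<psi>t D\<psi> H\<psi> t x y. C12_test \<psi> \<psi>t D\<psi> H\<psi> \<longrightarrow> t > 0 \<longrightarrow> u t x y = \<psi> t (x, y) \<longrightarrow>
        (\<forall>\<^sub>F (s, x', y') in nhds (t, x, y). \<psi> s (x', y') \<le> u s x' y') \<longrightarrow>
        \<psi>t t (x, y) - G (snd (D\<psi> t (x, y))) (xx_block (H\<psi> t (x, y))) \<ge> 0)"

definition viscosity_solution ::
  "(real ^ 'd \<Rightarrow> real ^ 'd ^ 'd \<Rightarrow> real) \<Rightarrow> (real \<Rightarrow> real ^ 'd \<Rightarrow> real ^ 'd \<Rightarrow> real) \<Rightarrow> bool" where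
  "viscosity_solution G u \<longleftrightarrow>
     continuous_on ({0<..} \<times> UNIV) (\<lambda>(t, x, y). u t x y)
     \<and> viscosity_subsolution G u \<and> viscosity_supersolution G u"

end

theory Submission
  imports Defs
begin

text \<open>The semigroup property is the hypothesis on the law read with \<open>a = \<surd>s\<close>, \<open>b = \<surd>t\<close>; it also forces
  \<open>E[\<langle>p, X\<rangle>] = 0\<close>, so a second-order Taylor expansion of \<open>u(t, z) = E[u(t - s, z + (\<surd>s X, s \<eta>))]\<close> at a
  touching point gives the viscosity inequalities.

  Uniqueness avoids the theorem on sums by exploiting that the operator is convex.  By Hahn-Banach it is a
  supremum of linear operators \<open>\<langle>q, D\<rangle> + 1/2 \<Sum> \<langle>A c, c\<rangle>\<close>, each of which generates a finite random walk.
  A viscosity supersolution is in particular a supersolution of each linear equation, and for these,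
  comparison with smooth barriers shows that it dominates its own averages along the walk.  In contrast to the
  viscosity inequality, this property is preserved by averaging over translates.  Averaging over small segments
  in all coordinate directions makes the supersolution smooth, and the limit of small time steps returns the
  differential inequality for each linear operator, hence for their supremum.  A subsolution can now be
  compared with this classical supersolution by the elementary maximum principle.\<close>

section \<open>Polynomial weights\<close>

text \<open>Wherever a function is mollified, the averaging length \<delta> is fixed before the
  number of steps of the walk. The constants of the smoothed function may therefore blow up with
  \<delta>: one step of size h misses the generator by order h^(3/2), s / h steps are taken, and the
  total error is of order sqrt h. What must be uniform in \<delta> is only the distance to the
  original function; in the final comparison it is of order sqrt \<delta>, because the average in
  time is controlled by (2) alone. The space is unbounded and the functions grow polynomially, so
  errors are measured against (1 + |z|^2)^m. The square makes this weight smooth at the origin and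
  hence usable in barriers, and one step of a walk multiplies it by at most exp(l h) on average,
  which after time s is still bounded. The walk has finitely many jumps because its transition
  operator is then a finite average of translates, which commutes exactly with averaging over
  segments and with the generator.\<close>

definition wt :: "nat \<Rightarrow> 'z::real_normed_vector \<Rightarrow> real" where
  "wt m z = (1 + (norm z)\<^sup>2) ^ m"

lemma wt_ge_1: "1 \<le> wt m z"
  by (simp add: wt_def)

lemma wt_pos: "0 < wt m z"
  using wt_ge_1[of m z] by linarith

lemma wt_zero [simp]: "wt m 0 = 1"
  by (simp add: wt_def)

lemma wt_mono: "m \<le> n \<Longrightarrow> wt m z \<le> wt n z"
  by (simp add: wt_def power_increasing)

lemma wt_Suc: "wt (Suc m) z = (1 + (norm z)\<^sup>2) * wt m z"
  by (simp add: wt_def)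

lemma wt_add: "wt (m + n) z = wt m z * wt n z"
  by (simp add: wt_def power_add)

lemma wt_norm_mono: "norm z \<le> norm w \<Longrightarrow> wt m z \<le> wt m w"
  unfolding wt_def by (intro power_mono add_left_mono) (auto intro: power_mono)

text \<open>Submultiplicativity up to a constant is what makes the weighted classes stable under
  translation, at the price of a factor that depends on the shift alone.\<close>

lemma wt_shift: "wt m (z + w) \<le> 2 ^ m * wt m z * wt m w"
proof -
  have "(norm (z + w))\<^sup>2 \<le> (norm z + norm w)\<^sup>2"
    by (simp add: norm_triangle_ineq power_mono)
  also have "\<dots> \<le> 2 * (norm z)\<^sup>2 + 2 * (norm w)\<^sup>2"
    using sum_squares_bound[of "norm z" "norm w"] by (simp add: power2_sum)
  also have "\<dots> \<le> 2 * ((1 + (norm z)\<^sup>2) * (1 + (norm w)\<^sup>2)) - 1"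
    by (simp add: algebra_simps)
  finally have "1 + (norm (z + w))\<^sup>2 \<le> 2 * ((1 + (norm z)\<^sup>2) * (1 + (norm w)\<^sup>2))" by simp
  then have "wt m (z + w) \<le> (2 * ((1 + (norm z)\<^sup>2) * (1 + (norm w)\<^sup>2))) ^ m"
    unfolding wt_def by (intro power_mono) auto
  then show ?thesis by (simp add: wt_def power_mult_distrib)
qed

lemma norm_power_le_wt: "norm z ^ k \<le> wt k z"
proof -
  have "norm z \<le> 1 + (norm z)\<^sup>2"
    using sum_squares_bound[of "norm z" 1] by (simp add: power2_eq_square) (smt (verit) norm_ge_zero)
  then show ?thesis unfolding wt_def by (intro power_mono) auto
qed

lemma norm_le_wt: "norm z \<le> wt 1 z"
  using norm_power_le_wt[of z 1] by simp

lemma wt_le_power: "wt m z \<le> 2 ^ m * (1 + norm z ^ (2 * m))"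
proof -
  have "wt m z \<le> (2 * max 1 ((norm z)\<^sup>2)) ^ m"
    unfolding wt_def by (intro power_mono) auto
  also have "\<dots> = 2 ^ m * max 1 ((norm z)\<^sup>2) ^ m" by (simp add: power_mult_distrib)
  also have "max 1 ((norm z)\<^sup>2) ^ m \<le> 1 + norm z ^ (2 * m)"
    by (auto simp: max_def power_mult)
  finally show ?thesis by simp
qed

text \<open>Polynomial growth and polynomially weighted Lipschitz continuity with one explicit constant, since
  uniformity in time, in the step size and in the mollified function matters below.\<close>

definition wl :: "real \<Rightarrow> nat \<Rightarrow> ('z::real_normed_vector \<Rightarrow> 'b::real_normed_vector) \<Rightarrow> bool" where
  "wl C m f \<longleftrightarrow> (\<forall>z. norm (f z) \<le> C * wt m z)
     \<and> (\<forall>z z'. norm (f z - f z') \<le> C * (wt m z + wt m z') * norm (z - z'))"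

lemma wlI:
  assumes "\<And>z. norm (f z) \<le> C * wt m z"
    and "\<And>z z'. norm (f z - f z') \<le> C * (wt m z + wt m z') * norm (z - z')"
  shows "wl C m f"
  using assms by (simp add: wl_def)

lemma wl_growth: "wl C m f \<Longrightarrow> norm (f z) \<le> C * wt m z"
  by (simp add: wl_def)

lemma wl_lip: "wl C m f \<Longrightarrow> norm (f z - f z') \<le> C * (wt m z + wt m z') * norm (z - z')"
  by (simp add: wl_def)

lemma wl_nonneg: "wl C m f \<Longrightarrow> 0 \<le> C"
  using wl_growth[of C m f 0] norm_ge_zero[of "f 0"] by (simp del: norm_ge_zero)

lemma wl_weaken:
  assumes "wl C m f" "C \<le> C'" "m \<le> m'" shows "wl C' m' f"
proof (rule wlI)
  note C = wl_nonneg[OF assms(1)]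
  fix z z'
  show "norm (f z) \<le> C' * wt m' z"
    using wl_growth[OF assms(1), of z] mult_mono[OF assms(2) wt_mono[OF assms(3), of z]] C assms(2) wt_pos[of m z]
    by linarith
  have "C * (wt m z + wt m z') * norm (z - z') \<le> C' * (wt m' z + wt m' z') * norm (z - z')"
    by (intro mult_right_mono mult_mono add_mono wt_mono assms)
       (use C assms(2) wt_pos[of m z] wt_pos[of m z'] in auto)
  then show "norm (f z - f z') \<le> C' * (wt m' z + wt m' z') * norm (z - z')"
    using wl_lip[OF assms(1), of z z'] by linarith
qed

text \<open>The Lipschitz bound gives growth only after multiplication by the distance to 0, which
  costs one power; hence \<open>Suc m\<close>, in exchange for one constant that serves both
  bounds.\<close>

lemma C_lLip_iff_wl:
  fixes f :: "'z::real_normed_vector \<Rightarrow> real"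
  shows "f \<in> C_lLip \<longleftrightarrow> (\<exists>C m. wl C m f)"
proof
  assume "f \<in> C_lLip"
  then obtain C m where C: "C > 0"
    and f: "\<And>x y. \<bar>f x - f y\<bar> \<le> C * (1 + norm x ^ m + norm y ^ m) * norm (x - y)"
    by (auto simp: C_lLip_def)
  have *: "\<bar>f x - f y\<bar> \<le> 2 * C * (wt m x + wt m y) * norm (x - y)" for x y :: 'z
  proof -
    have "1 + norm x ^ m + norm y ^ m \<le> 2 * (wt m x + wt m y)"
      using norm_power_le_wt[of x m] norm_power_le_wt[of y m] wt_ge_1[of m x] wt_ge_1[of m y] by (smt (verit))
    then have "C * (1 + norm x ^ m + norm y ^ m) * norm (x - y) \<le> C * (2 * (wt m x + wt m y)) * norm (x - y)"
      using C by (intro mult_right_mono mult_left_mono) auto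
    then show ?thesis using f[of x y] by (simp add: mult_ac)
  qed
  define B where "B = \<bar>f 0\<bar> + 4 * C"
  have "wl B (Suc m) f"
  proof (rule wlI)
    fix x y :: 'z
    have "\<bar>f x\<bar> \<le> \<bar>f 0\<bar> + 2 * C * (wt m x + 1) * norm x"
      using *[of x 0] by simp
    also have "2 * C * (wt m x + 1) * norm x \<le> 2 * C * (2 * wt m x) * (1 + (norm x)\<^sup>2)"
      using norm_le_wt[of x] C wt_ge_1[of m x]
      by (intro mult_mono mult_left_mono) (auto simp: wt_def)
    also have "\<bar>f 0\<bar> + \<dots> \<le> \<bar>f 0\<bar> * wt (Suc m) x + 4 * C * wt (Suc m) x"
      using mult_left_mono[OF wt_ge_1[of "Suc m" x], of "\<bar>f 0\<bar>"] by (simp add: wt_Suc mult_ac)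
    finally show "norm (f x) \<le> B * wt (Suc m) x" by (simp add: B_def algebra_simps)
    have "2 * C * (wt m x + wt m y) * norm (x - y) \<le> B * (wt (Suc m) x + wt (Suc m) y) * norm (x - y)"
      by (intro mult_right_mono mult_mono add_mono wt_mono)
         (use C wt_pos[of m x] wt_pos[of m y] in \<open>auto simp: B_def\<close>)
    then show "norm (f x - f y) \<le> B * (wt (Suc m) x + wt (Suc m) y) * norm (x - y)"
      using *[of x y] by simp
  qed
  then show "\<exists>C m. wl C m f" by blast
next
  assume "\<exists>C m. wl C m f"
  then obtain C m where w: "wl C m f" by blast
  have C: "0 \<le> C" using wl_nonneg[OF w] .
  show "f \<in> C_lLip" unfolding C_lLip_def
  proof (intro CollectI exI conjI allI)
    show "0 < 2 * (C + 1) * 2 ^ m" using C by simp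
    fix x y :: 'z
    have "wt m x + wt m y \<le> 2 ^ m * (2 + norm x ^ (2 * m) + norm y ^ (2 * m))"
      using wt_le_power[of m x] wt_le_power[of m y] by (simp add: algebra_simps)
    also have "\<dots> \<le> 2 ^ m * (2 * (1 + norm x ^ (2 * m) + norm y ^ (2 * m)))"
      by (intro mult_left_mono) (auto simp: algebra_simps)
    finally have "C * (wt m x + wt m y) * norm (x - y) \<le>
      (C + 1) * (2 ^ m * (2 * (1 + norm x ^ (2 * m) + norm y ^ (2 * m)))) * norm (x - y)"
      using C wt_pos[of m x] wt_pos[of m y] by (intro mult_right_mono mult_mono) auto
    then show "\<bar>f x - f y\<bar> \<le> 2 * (C + 1) * 2 ^ m * (1 + norm x ^ (2 * m) + norm y ^ (2 * m)) * norm (x - y)"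
      using wl_lip[OF w, of x y] by (simp add: algebra_simps)
  qed
qed

lemma wl_add:
  assumes "wl C m f" "wl C' m g" shows "wl (C + C') m (\<lambda>z. f z + g z)"
proof (rule wlI)
  fix z z'
  show "norm (f z + g z) \<le> (C + C') * wt m z"
    using wl_growth[OF assms(1), of z] wl_growth[OF assms(2), of z] norm_triangle_ineq[of "f z" "g z"]
    by (simp add: algebra_simps)
  have "norm (f z + g z - (f z' + g z')) \<le> norm (f z - f z') + norm (g z - g z')"
    using norm_triangle_ineq[of "f z - f z'" "g z - g z'"] by (simp add: algebra_simps)
  then show "norm (f z + g z - (f z' + g z')) \<le> (C + C') * (wt m z + wt m z') * norm (z - z')"
    using wl_lip[OF assms(1), of z z'] wl_lip[OF assms(2), of z z'] by (simp add: algebra_simps)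
qed

lemma wl_bounded_linear:
  assumes f: "wl C m f" and B: "bounded_linear h" "\<And>x. norm (h x) \<le> norm x * K" "0 \<le> K"
  shows "wl (K * C) m (\<lambda>z. h (f z))"
proof (rule wlI)
  interpret bounded_linear h by fact
  fix z z'
  show "norm (h (f z)) \<le> K * C * wt m z"
    using B(2)[of "f z"] mult_left_mono[OF wl_growth[OF f, of z] B(3)] by (simp add: mult_ac)
  show "norm (h (f z) - h (f z')) \<le> K * C * (wt m z + wt m z') * norm (z - z')"
    using B(2)[of "f z - f z'"] mult_left_mono[OF wl_lip[OF f, of z z'] B(3)] by (simp add: mult_ac diff)
qed

lemma wl_scaleR: "wl C m f \<Longrightarrow> wl (\<bar>c\<bar> * C) m (\<lambda>z. c *\<^sub>R f z)"
  by (rule wl_bounded_linear) (auto simp: bounded_linear_scaleR_right)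

lemma wl_zero: "wl 0 m (\<lambda>z. 0)"
  by (simp add: wl_def)

lemma wl_sum:
  assumes "\<And>i. i \<in> I \<Longrightarrow> wl (C i) m (f i)"
  shows "wl (\<Sum>i\<in>I. C i) m (\<lambda>z. \<Sum>i\<in>I. f i z)"
  using assms by (induction I rule: infinite_finite_induct) (auto simp: wl_zero intro!: wl_add)

lemma wl_continuous: assumes "wl C m f" shows "continuous_on UNIV f"
proof -
  have "(f \<longlongrightarrow> f z) (at z)" for z
  proof -
    have "((\<lambda>z'. C * (wt m z' + wt m z) * norm (z' - z)) \<longlongrightarrow> C * (wt m z + wt m z) * norm (z - z)) (at z)"
      unfolding wt_def by (intro tendsto_intros)
    then have "((\<lambda>z'. C * (wt m z' + wt m z) * norm (z' - z)) \<longlongrightarrow> 0) (at z)" by simp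
    then have "((\<lambda>z'. f z' - f z) \<longlongrightarrow> 0) (at z)"
      by (rule Lim_null_comparison[rotated]) (simp add: wl_lip[OF assms])
    then show ?thesis by (simp add: LIM_zero_iff)
  qed
  then show ?thesis by (simp add: continuous_on_def)
qed

section \<open>Test functions and comparison with smooth supersolutions\<close>

definition C2 :: "('z::euclidean_space \<Rightarrow> real) \<Rightarrow> ('z \<Rightarrow> 'z) \<Rightarrow> ('z \<Rightarrow> 'z \<Rightarrow>\<^sub>L 'z) \<Rightarrow> bool" where
  "C2 f Df Hf \<longleftrightarrow> (\<forall>z. GDERIV f z :> Df z \<and> (Df has_derivative blinfun_apply (Hf z)) (at z))
     \<and> continuous_on UNIV Hf"

lemma C12_test_add:
  fixes f :: "real \<Rightarrow> 'z::euclidean_space \<Rightarrow> real"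
  assumes "C12_test f ft Df Hf" "C12_test g gt Dg Hg"
  shows "C12_test (\<lambda>t z. f t z + g t z) (\<lambda>t z. ft t z + gt t z) (\<lambda>t z. Df t z + Dg t z) (\<lambda>t z. Hf t z + Hg t z)"
proof -
  have c: "continuous_on S (\<lambda>(t, z). a t z + b t z)"
    if "continuous_on S (\<lambda>(t, z). a t z)" "continuous_on S (\<lambda>(t, z). b t z)"
    for S :: "(real \<times> 'z) set" and a b :: "real \<Rightarrow> 'z \<Rightarrow> 'c::real_normed_vector"
    using continuous_on_add[OF that] by (simp add: case_prod_unfold)
  show ?thesis
    using assms unfolding C12_test_def
    by (auto intro!: c derivative_eq_intros GDERIV_add simp: blinfun.add_left)
qed

lemma C12_test_cmult:
  fixes f :: "real \<Rightarrow> 'z::euclidean_space \<Rightarrow> real"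
  assumes "C12_test f ft Df Hf"
  shows "C12_test (\<lambda>t z. c * f t z) (\<lambda>t z. c * ft t z) (\<lambda>t z. c *\<^sub>R Df t z) (\<lambda>t z. c *\<^sub>R Hf t z)"
proof -
  have c: "continuous_on S (\<lambda>(t, z). c *\<^sub>R a t z)"
    if "continuous_on S (\<lambda>(t, z). a t z)"
    for S :: "(real \<times> 'z) set" and a :: "real \<Rightarrow> 'z \<Rightarrow> 'c::real_normed_vector"
    using continuous_on_scaleR[OF continuous_on_const that] by (simp add: case_prod_unfold)
  have g: "GDERIV (\<lambda>z. c * h z) z :> c *\<^sub>R D" if "GDERIV h z :> D" for h and z D :: 'z
    using that unfolding gderiv_def by (auto intro!: derivative_eq_intros)
  show ?thesis
    using assms c[of "{0<..} \<times> UNIV" f] c[of "{0<..} \<times> UNIV" ft] unfolding C12_test_def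
    by (auto intro!: c g derivative_eq_intros simp: blinfun.scaleR_left)
qed

text \<open>The barriers below are sums of such products, if need be added to a given test
  function.\<close>

lemma C12_test_prod:
  fixes f :: "'z::euclidean_space \<Rightarrow> real"
  assumes a: "\<And>t. (a has_real_derivative a' t) (at t)" "continuous_on UNIV a'" and f: "C2 f Df Hf"
  shows "C12_test (\<lambda>t z. a t * f z) (\<lambda>t z. a' t * f z) (\<lambda>t z. a t *\<^sub>R Df z) (\<lambda>t z. a t *\<^sub>R Hf z)"
proof -
  have ca: "continuous_on UNIV a"
    using a(1) by (auto simp: continuous_on_eq_continuous_at intro: DERIV_isCont)
  have cD: "continuous_on UNIV Df" and cf: "continuous_on UNIV f"
    using f unfolding C2_def gderiv_def continuous_on_eq_continuous_at[OF open_UNIV]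
    by (auto intro: has_derivative_continuous)
  have cH: "continuous_on UNIV Hf" using f by (simp add: C2_def)
  have c: "continuous_on S (\<lambda>(t, z). p t *\<^sub>R q z)"
    if "continuous_on UNIV p" "continuous_on UNIV q"
    for S :: "(real \<times> 'z) set" and p :: "real \<Rightarrow> real" and q :: "'z \<Rightarrow> 'c::real_normed_vector"
    unfolding case_prod_unfold
    by (intro continuous_on_scaleR continuous_on_compose2[OF that(1)] continuous_on_compose2[OF that(2)] continuous_intros) auto
  have g: "GDERIV (\<lambda>z. c * h z) z :> c *\<^sub>R D" if "GDERIV h z :> D" for h c and z D :: 'z
    using that unfolding gderiv_def by (auto intro!: derivative_eq_intros)
  show ?thesis
    using f c[OF ca cf, of "{0<..} \<times> UNIV"] c[OF a(2) cf, of "{0<..} \<times> UNIV"]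
    unfolding C12_test_def
    by (auto simp: C2_def blinfun.scaleR_left intro!: c ca cD cH g DERIV_mult' derivative_eq_intros a(1))
qed

lemma C2_const: "C2 (\<lambda>_. c) (\<lambda>_. 0) (\<lambda>_. 0)"
  unfolding C2_def by (auto simp: GDERIV_const zero_blinfun.rep_eq)

text \<open>The weight dominates its own first and second derivatives, so exp(l t)
  \<open>wt m\<close> is a supersolution for every operator of linear growth once l is large. This
  makes it the barrier against growth at infinity.\<close>

lemma C2_wt:
  fixes m :: nat
  obtains Df Hf K where "C2 (wt m :: 'z::euclidean_space \<Rightarrow> real) Df Hf"
    "\<And>z. norm (Df z) \<le> K * wt m z" "\<And>z. norm (Hf z) \<le> K * wt m z" "0 \<le> K"
proof -
  \<comment> \<open>The subtractions on natural numbers truncate only for m < 2, and there the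
    factor \<open>real m\<close> or \<open>real (m - 1)\<close> vanishes.\<close>
  define Df where "Df z = (2 * real m * wt (m - 1) z) *\<^sub>R z" for z :: 'z
  define P where "P z = blinfun_scaleR_left z o\<^sub>L blinfun_inner_left z" for z :: 'z
  define Hf where "Hf z = (2 * real m * wt (m - 1) z) *\<^sub>R id_blinfun
     + (4 * real m * real (m - 1) * wt (m - 2) z) *\<^sub>R P z" for z :: 'z
  have P: "blinfun_apply (P z) h = (z \<bullet> h) *\<^sub>R z" for z h
    by (simp add: P_def inner_commute)
  have wtd: "(wt k has_derivative (\<lambda>h. 2 * real k * wt (k - 1) z * (z \<bullet> h))) (at z)" for k and z :: 'z
    unfolding wt_def dot_square_norm[symmetric]
    by (auto intro!: derivative_eq_intros simp: inner_commute fun_eq_iff)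
  have g: "GDERIV (wt m) z :> Df z" for z
    unfolding gderiv_def Df_def using wtd[of m z] by (simp add: inner_commute mult_ac)
  have h: "(Df has_derivative blinfun_apply (Hf z)) (at z)" for z
    unfolding Df_def[abs_def]
    by (rule derivative_eq_intros wtd refl)+
      (auto simp: fun_eq_iff Hf_def blinfun.add_left blinfun.scaleR_left P algebra_simps diff_diff_eq numeral_2_eq_2)
  have cw: "continuous_on UNIV (wt k :: 'z \<Rightarrow> real)" for k
    unfolding wt_def by (intro continuous_intros)
  have cH: "continuous_on UNIV Hf"
    unfolding Hf_def P_def
    by (intro continuous_intros continuous_on_compose2[OF cw]
         bounded_linear.continuous_on[OF bounded_linear_blinfun_scaleR_left]
         bounded_linear.continuous_on[OF bounded_linear_blinfun_inner_left]) auto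
  have Pn: "norm (P z) \<le> (norm z)\<^sup>2" for z
  proof (rule norm_blinfun_bound)
    show "norm (blinfun_apply (P z) h) \<le> (norm z)\<^sup>2 * norm h" for h
      using mult_right_mono[OF Cauchy_Schwarz_ineq2[of z h] norm_ge_zero[of z]]
      by (simp add: P power2_eq_square mult_ac)
  qed simp
  define K where "K = 2 * real m + 4 * real m * real m"
  have w1: "real m * wt (m - 1) z \<le> real m * wt m z" for z :: 'z
    by (intro mult_left_mono wt_mono) auto
  have w2: "real m * (wt (m - 1) z * norm z) \<le> real m * wt m z" for z :: 'z
  proof (cases m)
    case (Suc k)
    have "wt k z * norm z \<le> wt k z * (1 + (norm z)\<^sup>2)"
      using norm_le_wt[of z] wt_pos[of k z] by (intro mult_left_mono) (auto simp: wt_def)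
    then have "real m * (wt k z * norm z) \<le> real m * (wt k z * (1 + (norm z)\<^sup>2))"
      by (rule mult_left_mono) simp
    then show ?thesis using Suc by (simp add: wt_Suc mult_ac)
  qed simp
  have w3: "real m * real (m - 1) * (wt (m - 2) z * (norm z)\<^sup>2) \<le> real m * real m * wt m z" for z :: 'z
  proof (cases "m \<ge> 2")
    case True
    then obtain k where k: "m = Suc (Suc k)" by (metis add_2_eq_Suc le_Suc_ex)
    have "wt k z * (norm z)\<^sup>2 \<le> wt (Suc k) z"
      using wt_pos[of k z] by (simp add: wt_Suc algebra_simps)
    also have "\<dots> \<le> wt m z" using k by (intro wt_mono) auto
    finally show ?thesis using k wt_pos[of k z] by (intro mult_mono) auto
  next
    case False then have "m = 0 \<or> m = 1" by auto
    then show ?thesis using wt_pos[of 1 z] by auto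
  qed
  show thesis
  proof (rule that)
    show "C2 (wt m) Df Hf" using g h cH by (simp add: C2_def)
    show "0 \<le> K" by (simp add: K_def)
    fix z :: 'z
    have nn: "0 \<le> real m * real m * wt m z" using wt_pos[of m z] by simp
    show "norm (Df z) \<le> K * wt m z"
      using w2[of z] wt_pos[of "m - 1" z] nn by (simp add: Df_def K_def algebra_simps)
    have "norm (Hf z) \<le> norm ((2 * real m * wt (m - 1) z) *\<^sub>R (id_blinfun::'z \<Rightarrow>\<^sub>L 'z))
       + norm ((4 * real m * real (m - 1) * wt (m - 2) z) *\<^sub>R P z)"
      unfolding Hf_def by (rule norm_triangle_ineq)
    also have "\<dots> = 2 * (real m * wt (m - 1) z) * norm (id_blinfun::'z \<Rightarrow>\<^sub>L 'z)
       + 4 * (real m * real (m - 1) * (wt (m - 2) z * norm (P z)))"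
      using wt_pos[of "m - 1" z] wt_pos[of "m - 2" z] by (simp add: abs_mult mult_ac)
    also have "\<dots> \<le> 2 * (real m * wt (m - 1) z) * 1
       + 4 * (real m * real (m - 1) * (wt (m - 2) z * (norm z)\<^sup>2))"
      using wt_pos[of "m - 1" z] wt_pos[of "m - 2" z] Pn[of z]
      by (intro add_mono mult_left_mono) (auto simp: norm_blinfun_id)
    also have "\<dots> \<le> K * wt m z"
      using w1[of z] w3[of z] by (simp add: K_def algebra_simps)
    finally show "norm (Hf z) \<le> K * wt m z" .
  qed
qed

text \<open>The operator is abstract and (x, y) is merged into one variable, so that the same notion
  serves the nonlinear operator and each linear generator below it. For a linear operator, V is a
  supersolution exactly if -V has this property.\<close>

definition vsub :: "('z::euclidean_space \<Rightarrow> ('z \<Rightarrow>\<^sub>L 'z) \<Rightarrow> real) \<Rightarrow> (real \<Rightarrow> 'z \<Rightarrow> real) \<Rightarrow> bool" where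
  "vsub F U \<longleftrightarrow> (\<forall>\<psi> \<psi>t D\<psi> H\<psi> t z. C12_test \<psi> \<psi>t D\<psi> H\<psi> \<longrightarrow> t > 0 \<longrightarrow> U t z = \<psi> t z \<longrightarrow>
     (\<forall>\<^sub>F (s, z') in nhds (t, z). U s z' \<le> \<psi> s z') \<longrightarrow> \<psi>t t z \<le> F (D\<psi> t z) (H\<psi> t z))"

text \<open>The penalty \<open>(t / t1)^N\<close> with large \<open>N\<close> keeps the maximum away from the final time \<open>T\<close>; its derivative
  has the right sign, and unlike \<open>1 / (T - t)\<close> it yields a test function on the whole half-line.\<close>

lemma viscosity_comparison_smooth:
  fixes F :: "'z::euclidean_space \<Rightarrow> ('z \<Rightarrow>\<^sub>L 'z) \<Rightarrow> real"
  assumes Fsub: "\<And>D D' B B'. F (D + D') (B + B') \<le> F D B + F D' B'"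
    and Fbd: "\<And>D B. F D B \<le> K * (norm D + norm B)" and K: "0 \<le> K"
    and U: "vsub F U"
    and w: "C12_test w wt' Dw Hw"
    and weq: "\<And>t z. t0 < t \<Longrightarrow> t < T \<Longrightarrow> F (Dw t z) (Hw t z) \<le> wt' t z"
    and cont: "continuous_on ({t0..T} \<times> UNIV) (\<lambda>(t, z). U t z - w t z)"
    and growth: "\<And>t z. t0 \<le> t \<Longrightarrow> t \<le> T \<Longrightarrow> U t z - w t z \<le> C * wt m z"
    and init: "\<And>z. U t0 z \<le> w t0 z"
    and t0: "0 \<le> t0" and t1: "t0 \<le> t1" "t1 < T"
  shows "U t1 z1 \<le> w t1 z1"
proof (rule ccontr)
  assume neg: "\<not> U t1 z1 \<le> w t1 z1"
  then have t01: "t0 < t1" using init t1 by (metis order_le_less)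
  then have t1pos: "0 < t1" using t0 by simp
  obtain D\<omega> H\<omega> c where \<omega>: "C2 (wt (Suc m) :: 'z \<Rightarrow> real) D\<omega> H\<omega>"
    and Dc: "\<And>z. norm (D\<omega> z) \<le> c * wt (Suc m) z" and Hc: "\<And>z. norm (H\<omega> z) \<le> c * wt (Suc m) z"
    and c: "0 \<le> c"
    using C2_wt[where 'z='z and m="Suc m"] by metis
  let ?\<omega> = "wt (Suc m) :: 'z \<Rightarrow> real"
  \<comment> \<open>By \<open>Fbd\<close>, the operator at a times the derivatives of the weight is
    at most 2 K c a times the weight; the extra 1 makes the growth term a strict
    supersolution.\<close>
  define l where "l = 2 * K * c + 1"
  have l: "0 < l" using K c by (simp add: l_def add_nonneg_pos)
  define B0 where "B0 = exp (l * t1) * ?\<omega> z1 + 1"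
  have B0: "0 < B0" using wt_pos[of "Suc m" z1] by (simp add: B0_def add_pos_pos)
  \<comment> \<open>Half of the assumed gap at (t1, z1) pays for both penalties there; the summand 1
    in B0 stands for the time penalty, which equals \<epsilon> at t1.\<close>
  define \<epsilon> where "\<epsilon> = (U t1 z1 - w t1 z1) / (2 * B0)"
  have \<epsilon>: "0 < \<epsilon>" using neg B0 by (simp add: \<epsilon>_def)
  define C' where "C' = max C 0"
  \<comment> \<open>The penalty uses \<open>wt (Suc m)\<close>, one factor 1 + |z|^2 more than the
    growth of the difference. Hence the penalized difference is positive only where |z|^2 is at most
    C' / \<epsilon>, and B bounds it there.\<close>
  define B where "B = C' * (C' / \<epsilon> + 1) ^ m"
  have C': "0 \<le> C'" by (simp add: C'_def)
  have bnd: "U t z - w t z - \<epsilon> * ?\<omega> z \<le> B" "U t z - w t z - \<epsilon> * ?\<omega> z > 0 \<longrightarrow> (norm z)\<^sup>2 \<le> C' / \<epsilon>"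
    if "t0 \<le> t" "t \<le> T" for t z
  proof -
    have "U t z - w t z \<le> C * wt m z" using growth that by simp
    also have "\<dots> \<le> C' * wt m z" using wt_pos[of m z] by (intro mult_right_mono) (auto simp: C'_def)
    finally have 1: "U t z - w t z - \<epsilon> * ?\<omega> z \<le> wt m z * (C' - \<epsilon> * (1 + (norm z)\<^sup>2))"
      by (simp add: wt_Suc algebra_simps)
    show 2: "U t z - w t z - \<epsilon> * ?\<omega> z > 0 \<longrightarrow> (norm z)\<^sup>2 \<le> C' / \<epsilon>"
    proof
      assume "U t z - w t z - \<epsilon> * ?\<omega> z > 0"
      then have "0 < wt m z * (C' - \<epsilon> * (1 + (norm z)\<^sup>2))" using 1 by linarith
      then have "0 < C' - \<epsilon> * (1 + (norm z)\<^sup>2)" using wt_pos[of m z] by (simp add: zero_less_mult_iff)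
      then show "(norm z)\<^sup>2 \<le> C' / \<epsilon>" using \<epsilon> by (simp add: field_simps)
    qed
    have B: "0 \<le> B" using C' \<epsilon> by (simp add: B_def)
    show "U t z - w t z - \<epsilon> * ?\<omega> z \<le> B"
    proof (cases "U t z - w t z - \<epsilon> * ?\<omega> z > 0")
      case True
      then have "(norm z)\<^sup>2 \<le> C' / \<epsilon>" using 2 by blast
      then have "wt m z \<le> (C' / \<epsilon> + 1) ^ m" unfolding wt_def by (intro power_mono) auto
      moreover have "C' - \<epsilon> * (1 + (norm z)\<^sup>2) \<le> C'" using \<epsilon> by simp
      ultimately have "wt m z * (C' - \<epsilon> * (1 + (norm z)\<^sup>2)) \<le> wt m z * C'"
        using wt_pos[of m z] by (intro mult_left_mono) auto
      also have "\<dots> \<le> (C' / \<epsilon> + 1) ^ m * C'"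
        using \<open>wt m z \<le> _\<close> C' by (intro mult_right_mono)
      finally show ?thesis using 1 by (simp add: B_def mult.commute)
    qed (use B in auto)
  qed
  have "1 < T / t1" using t1pos t1 by simp
  \<comment> \<open>The time penalty equals \<epsilon> at t1 for every N, but for this N it exceeds
    B at T, so that a positive maximum cannot sit at T.\<close>
  then obtain N where N: "B / \<epsilon> < (T / t1) ^ N" using real_arch_pow by blast
  define pen where "pen t = \<epsilon> * (t / t1) ^ N" for t
  define \<Phi> where "\<Phi> t z = U t z - w t z - \<epsilon> * exp (l * t) * ?\<omega> z - pen t" for t z
  have exp1: "\<epsilon> * ?\<omega> z \<le> \<epsilon> * exp (l * t) * ?\<omega> z" if "0 \<le> t" for t z
    using that l \<epsilon> wt_pos[of "Suc m" z] by simp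
  have pen0: "0 \<le> pen t" if "0 \<le> t" for t
    using that \<epsilon> t1pos by (simp add: pen_def)
  have pos: "0 < \<Phi> t1 z1"
  proof -
    have "\<epsilon> * B0 < U t1 z1 - w t1 z1" using neg B0 by (simp add: \<epsilon>_def)
    then show ?thesis using t1pos by (simp add: \<Phi>_def B0_def pen_def algebra_simps)
  qed
  have large: "(norm z)\<^sup>2 \<le> C' / \<epsilon>" if "t0 \<le> t" "t \<le> T" "0 < \<Phi> t z" for t z
    using that bnd(2)[OF that(1,2), of z] exp1[of t z] pen0[of t] t0 by (simp add: \<Phi>_def)
  define R where "R = sqrt (C' / \<epsilon>)"
  have inR: "norm z \<le> R" if "t0 \<le> t" "t \<le> T" "0 < \<Phi> t z" for t z
    using large[OF that] by (simp add: R_def real_le_rsqrt)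
  have cpt: "compact ({t0..T} \<times> cball (0::'z) R)" by (intro compact_Times) auto
  have "continuous_on ({t0..T} \<times> cball 0 R) (\<lambda>(t, z). U t z - w t z)"
    by (rule continuous_on_subset[OF cont]) auto
  then have cPhi: "continuous_on ({t0..T} \<times> cball 0 R) (\<lambda>p. \<Phi> (fst p) (snd p))"
    unfolding \<Phi>_def case_prod_unfold pen_def wt_def
    by (elim continuous_on_diff[OF continuous_on_diff]) (use t1pos in \<open>auto intro!: continuous_intros\<close>)
  have m1: "(t1, z1) \<in> {t0..T} \<times> cball 0 R" using inR[OF t1(1) _ pos] t1 by simp
  then obtain p where p: "p \<in> {t0..T} \<times> cball 0 R"
      and pmax: "\<And>q. q \<in> {t0..T} \<times> cball 0 R \<Longrightarrow> \<Phi> (fst q) (snd q) \<le> \<Phi> (fst p) (snd p)"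
    using continuous_attains_sup[OF cpt _ cPhi] by blast
  obtain t z where tz: "p = (t, z)" by (cases p)
  define M where "M = \<Phi> t z"
  have M: "0 < M" using pmax[OF m1] pos tz by (simp add: M_def)
  \<comment> \<open>Outside the ball \<Phi> is not positive, so the maximum over the compact set is
    global in space.\<close>
  have mx: "\<Phi> s z' \<le> M" if "t0 \<le> s" "s \<le> T" for s z'
    using pmax[of "(s, z')"] inR[OF that, of z'] that M tz
    by (cases "0 < \<Phi> s z'") (auto simp: M_def)
  have "t \<noteq> t0"
  proof
    assume "t = t0"
    then show False using M init[of z] exp1[OF t0, of z] pen0[OF t0] \<epsilon> wt_pos[of "Suc m" z]
      mult_pos_pos[OF \<epsilon> wt_pos[of "Suc m" z]]
      by (simp add: M_def \<Phi>_def)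
  qed
  moreover have "t \<noteq> T"
  proof
    assume "t = T"
    moreover have "B < pen T" using N \<epsilon> by (simp add: pen_def field_simps)
    ultimately show False
      using M bnd(1)[of T z] exp1[of T z] t0 t1 by (simp add: M_def \<Phi>_def)
  qed
  ultimately have t: "t0 < t" "t < T" using p tz by auto
  then have tpos: "0 < t" using t0 by simp
  define a where "a s = \<epsilon> * exp (l * s)" for s
  have a': "(a has_real_derivative l * a s) (at s)" for s
    unfolding a_def by (auto intro!: derivative_eq_intros)
  have ca: "continuous_on UNIV (\<lambda>s. l * a s)" unfolding a_def by (intro continuous_intros)
  have p': "((\<lambda>s. pen s + M) has_real_derivative \<epsilon> * (real N * (s / t1) ^ (N - 1) * (1 / t1))) (at s)" for s
    unfolding pen_def using t1pos by (auto intro!: derivative_eq_intros)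
  have cp: "continuous_on UNIV (\<lambda>s. \<epsilon> * (real N * (s / t1) ^ (N - 1) * (1 / t1)))"
    by (intro continuous_intros) (use t1pos in auto)
  \<comment> \<open>The maximal value M joins the time penalty, and their sum is multiplied by the
    spatial function 1 to fit the product form.\<close>
  note test = C12_test_add[OF C12_test_add[OF w C12_test_prod[OF a' ca \<omega>]]
      C12_test_prod[OF p' cp C2_const[of 1]]]
  have ev: "\<forall>\<^sub>F (s, z') in nhds (t, z). U s z' \<le> w s z' + a s * ?\<omega> z' + (pen s + M) * 1"
  proof -
    have "open ({t0<..<T} \<times> (UNIV :: 'z set))" by (intro open_Times) auto
    then have "\<forall>\<^sub>F q in nhds (t, z). q \<in> {t0<..<T} \<times> UNIV"
      by (rule eventually_nhds_in_open) (use t in auto)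
    then show ?thesis
      by (rule eventually_mono) (use mx in \<open>auto simp: \<Phi>_def a_def algebra_simps\<close>)
  qed
  have eq: "U t z = w t z + a t * ?\<omega> z + (pen t + M) * 1"
    by (simp add: M_def \<Phi>_def a_def)
  have "wt' t z + l * a t * ?\<omega> z + \<epsilon> * (real N * (t / t1) ^ (N - 1) * (1 / t1)) * 1
      \<le> F (Dw t z + a t *\<^sub>R D\<omega> z + (pen t + M) *\<^sub>R 0) (Hw t z + a t *\<^sub>R H\<omega> z + (pen t + M) *\<^sub>R 0)"
    using U[unfolded vsub_def, rule_format, OF test tpos eq ev] .
  then have 1: "wt' t z + l * a t * ?\<omega> z + \<epsilon> * (real N * (t / t1) ^ (N - 1) * (1 / t1))
      \<le> F (Dw t z + a t *\<^sub>R D\<omega> z) (Hw t z + a t *\<^sub>R H\<omega> z)" by simp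
  have apos: "0 < a t" using \<epsilon> by (simp add: a_def)
  have 2: "F (Dw t z + a t *\<^sub>R D\<omega> z) (Hw t z + a t *\<^sub>R H\<omega> z) \<le> wt' t z + F (a t *\<^sub>R D\<omega> z) (a t *\<^sub>R H\<omega> z)"
    using Fsub[of "Dw t z" "a t *\<^sub>R D\<omega> z" "Hw t z" "a t *\<^sub>R H\<omega> z"] weq[OF t, of z] by linarith
  have "F (a t *\<^sub>R D\<omega> z) (a t *\<^sub>R H\<omega> z) \<le> K * (a t * norm (D\<omega> z) + a t * norm (H\<omega> z))"
    using Fbd[of "a t *\<^sub>R D\<omega> z" "a t *\<^sub>R H\<omega> z"] apos by simp
  also have "\<dots> \<le> K * (a t * (c * ?\<omega> z) + a t * (c * ?\<omega> z))"
    using apos K Dc[of z] Hc[of z] by (intro mult_left_mono add_mono) auto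
  also have "\<dots> = l * a t * ?\<omega> z - a t * ?\<omega> z" by (simp add: l_def algebra_simps)
  finally have 3: "F (a t *\<^sub>R D\<omega> z) (a t *\<^sub>R H\<omega> z) < l * a t * ?\<omega> z"
    using mult_pos_pos[OF apos wt_pos[of "Suc m" z]] by linarith
  have "0 \<le> \<epsilon> * (real N * (t / t1) ^ (N - 1) * (1 / t1))" using \<epsilon> tpos t1pos by simp
  with 1 2 3 show False by linarith
qed

section \<open>Mollification by iterated averages\<close>

text \<open>The bounds hold for all real times, so that averaging never meets a boundary; functions
  given on [0, T] are extended by \<open>time_clamp\<close> below.\<close>

definition fam :: "real \<Rightarrow> nat \<Rightarrow> (real \<times> 'z::euclidean_space \<Rightarrow> 'b::real_normed_vector) \<Rightarrow> bool" where
  "fam C m f \<longleftrightarrow> continuous_on UNIV f \<and> (\<forall>t. wl C m (\<lambda>z. f (t, z)))"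

text \<open>A segment takes the place of a smooth kernel: the derivative along the segment is then a
  difference of two values, and only integrals over [0, 1] occur.\<close>

definition avg :: "'p::euclidean_space \<Rightarrow> ('p \<Rightarrow> real) \<Rightarrow> 'p \<Rightarrow> real" where
  "avg e f p = integral {0..1} (\<lambda>\<tau>. f (p + \<tau> *\<^sub>R e))"

primrec avgs :: "'p::euclidean_space list \<Rightarrow> ('p \<Rightarrow> real) \<Rightarrow> 'p \<Rightarrow> real" where
  "avgs [] f = f"
| "avgs (e # es) f = avg e (avgs es f)"

definition pd :: "'p::euclidean_space \<Rightarrow> ('p \<Rightarrow> real) \<Rightarrow> ('p \<Rightarrow> real) \<Rightarrow> bool" where
  "pd e f g \<longleftrightarrow> (\<forall>p. ((\<lambda>r. f (p + r *\<^sub>R e)) has_real_derivative g p) (at 0))"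

text \<open>Derivatives are counted in space only, and every level obeys the same weighted bound; in
  time there is just continuity. Recursion over partial derivatives fits a mollification that gains
  one direction at a time.\<close>

primrec smooth :: "nat \<Rightarrow> real \<Rightarrow> nat \<Rightarrow> (real \<times> 'z::euclidean_space \<Rightarrow> real) \<Rightarrow> bool" where
  "smooth 0 C m f = fam C m f"
| "smooth (Suc k) C m f = (fam C m f \<and> (\<forall>b\<in>Basis. \<exists>g. pd (0, b) f g \<and> smooth k C m g))"

lemma fam_wl: "fam C m f \<Longrightarrow> wl C m (\<lambda>z. f (t, z))"
  by (simp add: fam_def)

lemma fam_cont: "fam C m f \<Longrightarrow> continuous_on UNIV f"
  by (simp add: fam_def)

lemma fam_nonneg: "fam C m f \<Longrightarrow> 0 \<le> C"
  using fam_wl wl_nonneg by blast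

lemma fam_weaken: "fam C m f \<Longrightarrow> C \<le> C' \<Longrightarrow> fam C' m f"
  unfolding fam_def by (meson wl_weaken order_refl)

lemma fam_add: "fam C m f \<Longrightarrow> fam C' m g \<Longrightarrow> fam (C + C') m (\<lambda>p. f p + g p)"
  unfolding fam_def by (auto intro: continuous_on_add wl_add)

lemma fam_bounded_linear:
  "fam C m f \<Longrightarrow> bounded_linear h \<Longrightarrow> (\<And>x. norm (h x) \<le> norm x * K) \<Longrightarrow> 0 \<le> K \<Longrightarrow> fam (K * C) m (\<lambda>p. h (f p))"
  unfolding fam_def using wl_bounded_linear bounded_linear.continuous_on by blast

lemma fam_sum:
  assumes "\<And>i. i \<in> I \<Longrightarrow> fam (C i) m (f i)"
  shows "fam (\<Sum>i\<in>I. C i) m (\<lambda>p. \<Sum>i\<in>I. f i p)"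
  using assms unfolding fam_def by (auto intro!: wl_sum continuous_on_sum)

lemma fam_smooth: "smooth k C m f \<Longrightarrow> fam C m f"
  by (cases k) auto

lemma smooth_nonneg: "smooth k C m f \<Longrightarrow> 0 \<le> C"
  using fam_smooth fam_nonneg by blast

lemma smooth_weaken: "smooth k C m f \<Longrightarrow> C \<le> C' \<Longrightarrow> smooth k C' m f"
proof (induction k arbitrary: f)
  case (Suc k)
  then have "\<exists>g. pd (0, b) f g \<and> smooth k C' m g" if "b \<in> Basis" for b using that by fastforce
  then show ?case using fam_weaken Suc.prems by auto
qed (auto intro: fam_weaken)

lemma smooth_Suc: "smooth (Suc k) C m f \<Longrightarrow> smooth k C m f"
proof (induction k arbitrary: f)
  case (Suc k)
  then have "\<exists>g. pd (0, b) f g \<and> smooth k C m g" if "b \<in> Basis" for b using that by fastforce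
  then show ?case using Suc.prems by auto
qed auto

lemma pd_at:
  assumes "pd e f g"
  shows "((\<lambda>r. f (p + r *\<^sub>R e)) has_real_derivative g (p + r *\<^sub>R e)) (at r)"
proof -
  have "((\<lambda>s. f ((p + r *\<^sub>R e) + s *\<^sub>R e)) has_real_derivative g (p + r *\<^sub>R e)) (at 0)"
    using assms by (simp add: pd_def)
  then have "((\<lambda>s. f (p + (s + r) *\<^sub>R e)) has_real_derivative g (p + r *\<^sub>R e)) (at 0)"
    by (simp add: algebra_simps)
  then show ?thesis
    using DERIV_shift[of "\<lambda>s. f (p + s *\<^sub>R e)" "g (p + r *\<^sub>R e)" 0 r] by simp
qed

lemma pd_add: "pd e f g \<Longrightarrow> pd e f' g' \<Longrightarrow> pd e (\<lambda>p. f p + f' p) (\<lambda>p. g p + g' p)"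
  unfolding pd_def by (auto intro: DERIV_add)

lemma pd_cmult: "pd e f g \<Longrightarrow> pd e (\<lambda>p. c * f p) (\<lambda>p. c * g p)"
  unfolding pd_def by (auto intro: DERIV_cmult)

lemma pd_shift: "pd e f g \<Longrightarrow> pd e (\<lambda>p. f (p + d)) (\<lambda>p. g (p + d))"
  unfolding pd_def
proof
  fix p
  assume "\<forall>p. ((\<lambda>r. f (p + r *\<^sub>R e)) has_real_derivative g p) (at 0)"
  then have "((\<lambda>r. f ((p + d) + r *\<^sub>R e)) has_real_derivative g (p + d)) (at 0)" by blast
  then show "((\<lambda>r. f (p + r *\<^sub>R e + d)) has_real_derivative g (p + d)) (at 0)" by (simp add: ac_simps)
qed

lemma pd_rescale: assumes "pd (c *\<^sub>R e) f g" "c \<noteq> 0" shows "pd e f (\<lambda>p. (1/c) * g p)"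
  unfolding pd_def
proof
  fix p
  have "((\<lambda>r. f (p + r *\<^sub>R c *\<^sub>R e)) has_real_derivative g p) (at (0 / c))"
    using assms(1) by (simp add: pd_def)
  then have "((\<lambda>r. f (p + (r / c) *\<^sub>R c *\<^sub>R e)) has_real_derivative g p * (1 / c)) (at 0)"
    by (rule DERIV_chain2) (use assms(2) in \<open>auto intro!: derivative_eq_intros\<close>)
  then show "((\<lambda>r. f (p + r *\<^sub>R e)) has_real_derivative (1/c) * g p) (at 0)"
    using assms(2) by simp
qed

lemma cont_shift: "continuous_on UNIV f \<Longrightarrow> continuous_on UNIV (\<lambda>p. f (p + d))"
  for f :: "'a::real_normed_vector \<Rightarrow> 'b::topological_space"
  by (rule continuous_on_compose2) (auto intro!: continuous_intros)

lemma cont_line: "continuous_on UNIV f \<Longrightarrow> continuous_on S (\<lambda>\<tau>. f (p + \<tau> *\<^sub>R e))"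
  for f :: "'a::real_normed_vector \<Rightarrow> 'b::topological_space"
  by (rule continuous_on_compose2) (auto intro!: continuous_intros)

lemma avg_integrable: "continuous_on UNIV f \<Longrightarrow> (\<lambda>\<tau>. f (p + \<tau> *\<^sub>R e)) integrable_on {0..1::real}"
  for f :: "'p::euclidean_space \<Rightarrow> real"
  by (intro integrable_continuous_interval cont_line)

lemma avg_continuous:
  assumes "continuous_on UNIV f" shows "continuous_on UNIV (avg e f)"
proof -
  have "continuous_on (UNIV \<times> cbox 0 1) (\<lambda>(p, \<tau>). f (p + \<tau> *\<^sub>R e))"
    unfolding case_prod_unfold
    by (rule continuous_on_compose2[OF assms]) (auto intro!: continuous_intros)
  from integral_continuous_on_param[OF this] show ?thesis
    by (simp add: avg_def[abs_def])
qed

lemma avgs_continuous: "continuous_on UNIV f \<Longrightarrow> continuous_on UNIV (avgs es f)"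
  by (induction es) (auto intro: avg_continuous)

lemma avg_bound:
  assumes "continuous_on UNIV f" "\<And>\<tau>. 0 \<le> \<tau> \<Longrightarrow> \<tau> \<le> 1 \<Longrightarrow> \<bar>f (p + \<tau> *\<^sub>R e)\<bar> \<le> B"
  shows "\<bar>avg e f p\<bar> \<le> B"
  using integral_bound[of 0 1 "\<lambda>\<tau>. f (p + \<tau> *\<^sub>R e)" B] assms by (auto simp: avg_def intro: cont_line)

lemma avg_diff:
  assumes "continuous_on UNIV f" "continuous_on UNIV g"
  shows "avg e (\<lambda>p. f p - g p) p = avg e f p - avg e g p"
  unfolding avg_def by (intro integral_diff avg_integrable assms)

lemma avg_cmult: "avg e (\<lambda>p. c * f p) p = c * avg e f p"
  unfolding avg_def by simp

lemma avg_shift: "avg e (\<lambda>p. f (p + d)) p = avg e f (p + d)"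
  unfolding avg_def by (simp add: algebra_simps)

lemma avg_const: "avg e (\<lambda>_. c) p = c"
  by (simp add: avg_def)

lemma avg_mono:
  assumes "continuous_on UNIV f" "continuous_on UNIV g"
    "\<And>\<tau>. 0 \<le> \<tau> \<Longrightarrow> \<tau> \<le> 1 \<Longrightarrow> f (p + \<tau> *\<^sub>R e) \<le> g (p + \<tau> *\<^sub>R e)"
  shows "avg e f p \<le> avg e g p"
  unfolding avg_def by (intro integral_le avg_integrable assms) (use assms(3) in auto)

lemma pd_avg:
  assumes "pd b f g" and cf: "continuous_on UNIV f" and cg: "continuous_on UNIV g"
  shows "pd b (avg e f) (avg e g)"
  unfolding pd_def
proof
  fix p
  have eq: "p + r *\<^sub>R b + \<tau> *\<^sub>R e = (p + \<tau> *\<^sub>R e) + r *\<^sub>R b" for r \<tau> by simp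
  have d: "((\<lambda>r. f (p + r *\<^sub>R b + \<tau> *\<^sub>R e)) has_real_derivative g (p + r *\<^sub>R b + \<tau> *\<^sub>R e)) (at r)" for r \<tau>
    unfolding eq by (rule pd_at[OF assms(1)])
  have cc: "continuous_on (UNIV \<times> cbox 0 (1::real)) (\<lambda>(r, \<tau>). g (p + r *\<^sub>R b + \<tau> *\<^sub>R e))"
    unfolding case_prod_unfold
    by (rule continuous_on_compose2[OF cg]) (auto intro!: continuous_intros)
  have "((\<lambda>r. integral (cbox 0 1) (\<lambda>\<tau>. f (p + r *\<^sub>R b + \<tau> *\<^sub>R e))) has_field_derivative
      integral (cbox 0 1) (\<lambda>\<tau>. g (p + 0 *\<^sub>R b + \<tau> *\<^sub>R e))) (at 0 within UNIV)"
    by (rule leibniz_rule_field_derivative[OF _ _ cc])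
       (use d in \<open>auto intro!: avg_integrable[OF cf]\<close>)
  then show "((\<lambda>r. avg e f (p + r *\<^sub>R b)) has_real_derivative avg e g p) (at 0)"
    by (simp add: avg_def)
qed

lemma pd_avgs:
  assumes "pd b f g" "continuous_on UNIV f" "continuous_on UNIV g"
  shows "pd b (avgs es f) (avgs es g)"
  using assms by (induction es) (auto intro!: pd_avg avgs_continuous)

text \<open>Along the line through p, the average is the integral of f over the parameters from r to
  r + 1. The fundamental theorem of calculus leaves the difference of the two end values.\<close>

lemma pd_avg_self:
  assumes cf: "continuous_on UNIV f"
  shows "pd e (avg e f) (\<lambda>p. f (p + e) - f p)"
  unfolding pd_def
proof
  fix p
  define h where "h x = f (p + x *\<^sub>R e)" for x
  have ch: "continuous_on S h" for S unfolding h_def by (rule cont_line[OF cf])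
  \<comment> \<open>For -1 < r < 1 both r and 1 + r lie in the interior of this interval, where the
    antiderivative has a two-sided derivative.\<close>
  obtain A where A: "\<And>x. x \<in> {-1..3} \<Longrightarrow> (A has_vector_derivative h x) (at x within {-1..3})"
    using antiderivative_continuous[OF ch] by blast
  have A': "(A has_real_derivative h x) (at x)" if "-1 < x" "x < 3" for x
    using A[of x] that at_within_Icc_at[of "-1" x 3] by (simp add: has_real_derivative_iff_has_vector_derivative)
  have val: "avg e f (p + r *\<^sub>R e) = A (1 + r) - A r" if "r \<in> {-1<..<1}" for r
  proof -
    have "((\<lambda>\<tau>. h (\<tau> + r)) has_integral A (1 + r) - A (0 + r)) {0..1}"
    proof (rule fundamental_theorem_of_calculus)
      fix x :: real assume x: "x \<in> {0..1}"
      then have "(A has_real_derivative h (x + r)) (at (x + r))" using that by (intro A') auto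
      then have "((\<lambda>\<tau>. A (\<tau> + r)) has_real_derivative h (x + r)) (at x)"
        by (simp add: DERIV_shift)
      then show "((\<lambda>\<tau>. A (\<tau> + r)) has_vector_derivative h (x + r)) (at x within {0..1})"
        using has_real_derivative_iff_has_vector_derivative has_vector_derivative_at_within by blast
    qed simp
    moreover have "h (\<tau> + r) = f (p + r *\<^sub>R e + \<tau> *\<^sub>R e)" for \<tau> by (simp add: h_def algebra_simps)
    ultimately show ?thesis by (simp add: avg_def integral_unique)
  qed
  have "((\<lambda>r. A (1 + r) - A r) has_real_derivative h 1 - h 0) (at 0)"
    using A'[of 1] A'[of 0] by (intro DERIV_diff) (auto simp: DERIV_shift add.commute DERIV_shift[of A _ 0 1, symmetric])
  then have "((\<lambda>r. avg e f (p + r *\<^sub>R e)) has_real_derivative h 1 - h 0) (at 0)"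
    by (rule has_field_derivative_transform_within_open[of _ _ _ "{-1<..<1}"]) (auto simp: val)
  then show "((\<lambda>r. avg e f (p + r *\<^sub>R e)) has_real_derivative f (p + e) - f p) (at 0)"
    by (simp add: h_def)
qed

section \<open>Weighted bounds under translation and averaging\<close>

lemma wt_shift_le:
  assumes "norm w \<le> norm e" shows "wt m (z + w) \<le> 2 ^ m * wt m e * wt m z"
proof -
  have "2 ^ m * wt m z * wt m w \<le> 2 ^ m * wt m z * wt m e"
    using wt_norm_mono[OF assms, of m] wt_pos[of m z] by (intro mult_left_mono) auto
  then show ?thesis using wt_shift[of m z w] by (simp add: mult_ac)
qed

lemma norm_scale_le: "0 \<le> \<tau> \<Longrightarrow> \<tau> \<le> 1 \<Longrightarrow> norm (\<tau> *\<^sub>R e) \<le> norm e"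
  using mult_right_mono[of \<tau> 1 "norm e"] by simp

lemma wl_shift_le:
  assumes f: "wl C m f" and w: "norm w \<le> norm e"
  shows "wl (2 ^ m * wt m e * C) m (\<lambda>z. f (z + w))"
proof (rule wlI)
  note C = wl_nonneg[OF f]
  fix z z'
  show "norm (f (z + w)) \<le> 2 ^ m * wt m e * C * wt m z"
    using wl_growth[OF f, of "z + w"] mult_left_mono[OF wt_shift_le[OF w, of m z] C] by (simp add: mult_ac)
  have "C * (wt m (z + w) + wt m (z' + w)) * norm (z - z')
     \<le> C * (2 ^ m * wt m e * wt m z + 2 ^ m * wt m e * wt m z') * norm (z - z')"
    by (intro mult_right_mono mult_left_mono add_mono wt_shift_le w C) auto
  then show "norm (f (z + w) - f (z' + w)) \<le> 2 ^ m * wt m e * C * (wt m z + wt m z') * norm (z - z')"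
    using wl_lip[OF f, of "z + w" "z' + w"] by (simp add: algebra_simps)
qed

text \<open>The time component of the shift does not enter, because the bounds in \<open>fam\<close>
  are uniform in time.\<close>

definition shift_const :: "nat \<Rightarrow> (real \<times> 'z::euclidean_space) \<Rightarrow> real" where
  "shift_const m e = 2 ^ m * wt m (snd e)"

lemma shift_const_ge_1: "1 \<le> shift_const m e"
  unfolding shift_const_def using mult_mono[of 1 "2^m::real" 1 "wt m (snd e)"] wt_ge_1[of m "snd e"] by simp

lemma fam_shift: assumes "fam C m f" shows "fam (shift_const m e * C) m (\<lambda>p. f (p + e))"
proof -
  have "wl (shift_const m e * C) m (\<lambda>z. f ((t, z) + e))" for t
    using wl_shift_le[OF fam_wl[OF assms, of "t + fst e"] order_refl, of "snd e"]
    by (simp add: shift_const_def plus_prod_def)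
  then show ?thesis using cont_shift[OF fam_cont[OF assms]] by (simp add: fam_def)
qed

lemma fam_avg: assumes f: "fam C m f" shows "fam (shift_const m e * C) m (avg e f)"
  unfolding fam_def
proof (intro conjI allI wlI)
  note cf = fam_cont[OF f]
  show "continuous_on UNIV (avg e f)" by (rule avg_continuous[OF cf])
  fix t and z z' :: 'a
  have w: "wl (shift_const m e * C) m (\<lambda>z. f ((t, z) + \<tau> *\<^sub>R e))" if "0 \<le> \<tau>" "\<tau> \<le> 1" for \<tau>
    using wl_shift_le[OF fam_wl[OF f, of "t + \<tau> * fst e"] norm_scale_le[OF that, of "snd e"]]
    by (simp add: shift_const_def plus_prod_def)
  show "norm (avg e f (t, z)) \<le> shift_const m e * C * wt m z"
    using wl_growth[OF w, of _ z] by (auto intro!: avg_bound[OF cf])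
  define d where "d = (0::real, z' - z)"
  have dd: "(t, z) + x + d = (t, z') + x" for x by (simp add: d_def plus_prod_def)
  have "avg e f (t, z) - avg e f (t, z') = avg e (\<lambda>p. f p - f (p + d)) (t, z)"
    using avg_diff[OF cf cont_shift[OF cf], of e d] avg_shift[of e f d] by (simp add: d_def plus_prod_def)
  also have "\<bar>\<dots>\<bar> \<le> shift_const m e * C * (wt m z + wt m z') * norm (z - z')"
    using wl_lip[OF w, of _ z z']
    by (intro avg_bound continuous_on_diff cf cont_shift) (auto simp: dd)
  finally show "norm (avg e f (t, z) - avg e f (t, z')) \<le> shift_const m e * C * (wt m z + wt m z') * norm (z - z')"
    by simp
qed

lemma smooth_shift: "smooth k C m f \<Longrightarrow> smooth k (shift_const m e * C) m (\<lambda>p. f (p + e))"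
proof (induction k arbitrary: f)
  case (Suc k)
  have "\<exists>g'. pd (0, b) (\<lambda>p. f (p + e)) g' \<and> smooth k (shift_const m e * C) m g'" if b: "b \<in> Basis" for b
  proof -
    obtain g where "pd (0, b) f g" "smooth k C m g" using Suc.prems b by auto
    then show ?thesis using pd_shift Suc.IH by blast
  qed
  then show ?case using fam_shift[of C m f e] Suc.prems by simp
qed (auto intro: fam_shift)

lemma smooth_avg: "smooth k C m f \<Longrightarrow> smooth k (shift_const m e * C) m (avg e f)"
proof (induction k arbitrary: f)
  case (Suc k)
  have f: "fam C m f" using Suc.prems by simp
  have "\<exists>g'. pd (0, b) (avg e f) g' \<and> smooth k (shift_const m e * C) m g'" if b: "b \<in> Basis" for b
  proof -
    obtain g where g: "pd (0, b) f g" "smooth k C m g" using Suc.prems b by auto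
    have "pd (0, b) (avg e f) (avg e g)"
      by (rule pd_avg[OF g(1) fam_cont[OF f] fam_cont[OF fam_smooth[OF g(2)]]])
    then show ?thesis using Suc.IH g(2) by blast
  qed
  then show ?case using fam_avg[OF f, of e] by simp
qed (auto intro: fam_avg)

lemma smooth_add: "smooth k C m f \<Longrightarrow> smooth k C' m g \<Longrightarrow> smooth k (C + C') m (\<lambda>p. f p + g p)"
proof (induction k arbitrary: f g)
  case (Suc k)
  have "\<exists>h. pd (0, b) (\<lambda>p. f p + g p) h \<and> smooth k (C + C') m h" if b: "b \<in> Basis" for b
  proof -
    obtain f' g' where "pd (0, b) f f'" "smooth k C m f'" "pd (0, b) g g'" "smooth k C' m g'"
      using Suc.prems b by (metis smooth.simps(2))
    then show ?thesis using pd_add Suc.IH by blast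
  qed
  then show ?case using fam_add Suc.prems by auto
qed (auto intro: fam_add)

lemma fam_cmult: "fam C m f \<Longrightarrow> fam (\<bar>c\<bar> * C) m (\<lambda>p. c * f p)"
  using fam_bounded_linear[of C m f "\<lambda>x. c * x" "\<bar>c\<bar>"]
  using bounded_linear_mult_right[of c] by (simp add: abs_mult mult.commute)

lemma smooth_cmult: "smooth k C m f \<Longrightarrow> smooth k (\<bar>c\<bar> * C) m (\<lambda>p. c * f p)"
proof (induction k arbitrary: f)
  case (Suc k)
  have "\<exists>h. pd (0, b) (\<lambda>p. c * f p) h \<and> smooth k (\<bar>c\<bar> * C) m h" if b: "b \<in> Basis" for b
  proof -
    obtain g where "pd (0, b) f g" "smooth k C m g" using Suc.prems b by auto
    then show ?thesis using pd_cmult Suc.IH by blast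
  qed
  then show ?case using fam_cmult Suc.prems by auto
qed (auto intro: fam_cmult)

lemma smooth_zero: "smooth k 0 m (\<lambda>_. 0)"
proof (induction k)
  case 0 then show ?case by (auto simp: fam_def wl_zero)
next
  case (Suc k)
  have "pd b (\<lambda>_. 0) (\<lambda>_. 0)" for b :: "real \<times> 'a" by (simp add: pd_def)
  then show ?case using Suc by (auto simp: fam_def wl_zero)
qed

lemma smooth_sum:
  assumes "\<And>i. i \<in> I \<Longrightarrow> smooth k (C i) m (f i)"
  shows "smooth k (\<Sum>i\<in>I. C i) m (\<lambda>p. \<Sum>i\<in>I. f i p)"
  using assms by (induction I rule: infinite_finite_induct) (auto simp: smooth_zero intro!: smooth_add)

lemma avgs_append: "avgs (es @ es') f = avgs es (avgs es' f)"
  by (induction es) auto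

text \<open>Wherever the segment along b occurs in the list, the derivative along b turns into a
  difference quotient, which then passes through the remaining averages. K is chosen before k, C and
  f, so that several rounds can be chained.\<close>

lemma avgs_smooth_gain:
  assumes \<delta>: "0 < \<delta>"
  shows "\<exists>K\<ge>0. \<forall>k C f. smooth k C m f \<longrightarrow> smooth k (K * C) m (avgs es f) \<and>
    (\<forall>b\<in>Basis. (0, \<delta> *\<^sub>R b) \<in> set es \<longrightarrow> (\<exists>g. pd (0, b) (avgs es f) g \<and> smooth k (K * C) m g))"
proof (induction es)
  case Nil
  show ?case by (rule exI[of _ 1]) auto
next
  case (Cons e es)
  then obtain K where K: "0 \<le> K"
    and s: "\<And>k C f. smooth k C m f \<Longrightarrow> smooth k (K * C) m (avgs es f)"
    and g: "\<And>k C f b. smooth k C m f \<Longrightarrow> b \<in> Basis \<Longrightarrow> (0, \<delta> *\<^sub>R b) \<in> set es \<Longrightarrow>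
       \<exists>g. pd (0, b) (avgs es f) g \<and> smooth k (K * C) m g"
    by blast
  define s0 where "s0 = shift_const m e"
  have s0: "1 \<le> s0" by (simp add: s0_def shift_const_ge_1)
  \<comment> \<open>One more average costs the factor s0, hence s0 * K; a difference quotient adds a
    shifted and an unshifted copy and divides by \<delta>.\<close>
  define K' where "K' = s0 * K + (1 / \<delta>) * (s0 * K + K)"
  have "0 \<le> (1 / \<delta>) * (s0 * K + K)" "0 \<le> s0 * K" using \<delta> s0 K by auto
  then have K': "0 \<le> K'" "s0 * K \<le> K'" "(1 / \<delta>) * (s0 * K + K) \<le> K'" by (auto simp: K'_def)
  show ?case
  proof (intro exI[of _ K'] conjI K'(1) allI impI ballI)
    fix k C and f :: "real \<times> 'a \<Rightarrow> real" assume f: "smooth k C m f"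
    have C: "0 \<le> C" using smooth_nonneg[OF f] .
    have F: "smooth k (K * C) m (avgs es f)" using s[OF f] .
    have cF: "continuous_on UNIV (avgs es f)" using F fam_smooth fam_cont by blast
    have le: "s0 * (K * C) \<le> K' * C" "\<bar>1 / \<delta>\<bar> * (s0 * (K * C) + \<bar>- 1\<bar> * (K * C)) \<le> K' * C"
      using mult_right_mono[OF K'(2) C] mult_right_mono[OF K'(3) C] \<delta> by (auto simp: algebra_simps)
    show "smooth k (K' * C) m (avgs (e # es) f)"
      using smooth_weaken[OF smooth_avg[OF F, of e] le(1)[unfolded s0_def]] by simp
    fix b :: 'a assume b: "b \<in> Basis" and "(0, \<delta> *\<^sub>R b) \<in> set (e # es)"
    then consider "e = \<delta> *\<^sub>R (0, b)" | "(0, \<delta> *\<^sub>R b) \<in> set es" by auto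
    then show "\<exists>g. pd (0, b) (avgs (e # es) f) g \<and> smooth k (K' * C) m g"
    proof cases
      case 1
      have "pd e (avg e (avgs es f)) (\<lambda>p. avgs es f (p + e) - avgs es f p)"
        by (rule pd_avg_self[OF cF])
      then have "pd (0, b) (avg e (avgs es f)) (\<lambda>p. (1/\<delta>) * (avgs es f (p + e) - avgs es f p))"
        using pd_rescale 1 \<delta> by blast
      moreover have "smooth k (\<bar>1 / \<delta>\<bar> * (s0 * (K * C) + \<bar>- 1\<bar> * (K * C))) m
          (\<lambda>p. (1/\<delta>) * (avgs es f (p + e) + (-1) * avgs es f p))"
        unfolding s0_def by (intro smooth_cmult smooth_add smooth_shift F)
      ultimately show ?thesis using smooth_weaken[OF _ le(2)] by auto
    next
      case 2
      then obtain g where g: "pd (0, b) (avgs es f) g" "smooth k (K * C) m g" using g[OF f b] by blast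
      have "continuous_on UNIV g" using g(2) fam_smooth fam_cont by blast
      then have "pd (0, b) (avg e (avgs es f)) (avg e g)" using pd_avg[OF g(1) cF] by blast
      moreover have "smooth k (K' * C) m (avg e g)"
        using smooth_weaken[OF smooth_avg[OF g(2), of e] le(1)[unfolded s0_def]] .
      ultimately show ?thesis by auto
    qed
  qed
qed

text \<open>Averaging along all coordinate directions replaces derivatives by finite differences, so each
  round of averaging gains one order of differentiability.\<close>

definition dirs :: "real \<Rightarrow> (real \<times> 'z::euclidean_space) list" where
  "dirs \<delta> = map (\<lambda>b. (0, \<delta> *\<^sub>R b)) (SOME bs. set bs = Basis)"

lemma set_dirs: "set (dirs \<delta> :: (real \<times> 'z::euclidean_space) list) = (\<lambda>b. (0, \<delta> *\<^sub>R b)) ` Basis"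
proof -
  have "\<exists>bs. set bs = (Basis :: 'z set)" by (simp add: finite_list)
  from someI_ex[OF this] show ?thesis by (simp add: dirs_def)
qed

lemma length_dirs: "length (dirs \<delta> :: (real \<times> 'z::euclidean_space) list) = length (dirs 0 :: (real \<times> 'z) list)"
  by (simp add: dirs_def)

definition moll :: "nat \<Rightarrow> real \<Rightarrow> (real \<times> 'z::euclidean_space \<Rightarrow> real) \<Rightarrow> real \<times> 'z \<Rightarrow> real" where
  "moll n \<delta> = avgs (concat (replicate n (dirs \<delta>)))"

text \<open>K may depend on \<delta>, since \<delta> stays fixed while the step size of the walk
  shrinks.\<close>

lemma moll_smooth:
  assumes \<delta>: "0 < \<delta>"
  shows "\<exists>K\<ge>0. \<forall>C f. fam C m f \<longrightarrow> smooth n (K * C) m (moll n \<delta> f :: real \<times> 'z::euclidean_space \<Rightarrow> real)"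
proof (induction n)
  case 0 show ?case by (rule exI[of _ 1]) (auto simp: moll_def)
next
  case (Suc n)
  then obtain K where K: "0 \<le> K" and s: "\<And>C f. fam C m f \<Longrightarrow> smooth n (K * C) m (moll n \<delta> f :: real \<times> 'z \<Rightarrow> real)"
    by blast
  obtain K' where K': "0 \<le> K'"
    and g: "\<And>k C f. smooth k C m f \<Longrightarrow> smooth k (K' * C) m (avgs (dirs \<delta>) f) \<and>
    (\<forall>b\<in>Basis. (0, \<delta> *\<^sub>R b) \<in> set (dirs \<delta>) \<longrightarrow>
       (\<exists>g. pd (0, b :: 'z) (avgs (dirs \<delta>) f) g \<and> smooth k (K' * C) m g))"
    using avgs_smooth_gain[OF \<delta>, of m "dirs \<delta> :: (real \<times> 'z) list"] by blast
  show ?case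
  proof (intro exI[of _ "K' * K"] conjI allI impI)
    fix C and f :: "real \<times> 'z \<Rightarrow> real" assume "fam C m f"
    from g[OF s[OF this]] have "smooth (Suc n) (K' * (K * C)) m (avgs (dirs \<delta>) (moll n \<delta> f))"
      using fam_smooth by (auto simp: set_dirs)
    then show "smooth (Suc n) (K' * K * C) m (moll (Suc n) \<delta> f)"
      by (simp add: moll_def avgs_append mult_ac)
  qed (use K K' in auto)
qed

section \<open>Distance between a function and its mollification\<close>

lemma wt_shift_small:
  assumes "norm w \<le> \<delta>" "\<delta> \<le> 1" shows "wt m (z + w) \<le> 4 ^ m * wt m z"
proof -
  have "1 + (norm w)\<^sup>2 \<le> 2" using assms by (simp add: power_le_one)
  then have "wt m w \<le> 2 ^ m" unfolding wt_def by (intro power_mono) auto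
  then have "2 ^ m * wt m z * wt m w \<le> 2 ^ m * wt m z * 2 ^ m"
    using wt_pos[of m z] by (intro mult_left_mono) auto
  then show ?thesis using wt_shift[of m z w] by (simp add: power_mult_distrib[symmetric] mult_ac)
qed

lemma avg_close:
  assumes f: "fam C m f" and e: "fst e = 0" "norm (snd e) \<le> \<delta>" and \<delta>: "\<delta> \<le> 1"
  shows "\<bar>avg e f (t, z) - f (t, z)\<bar> \<le> (1 + 4 ^ m) * \<delta> * C * wt m z"
proof -
  note cf = fam_cont[OF f] and C = fam_nonneg[OF f]
  have "avg e f (t, z) - f (t, z) = avg e (\<lambda>p. f p - f (t, z)) (t, z)"
    using avg_diff[OF cf continuous_on_const] by (simp add: avg_const)
  also have "\<bar>\<dots>\<bar> \<le> (1 + 4 ^ m) * \<delta> * C * wt m z"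
  proof (rule avg_bound)
    fix \<tau> :: real assume \<tau>: "0 \<le> \<tau>" "\<tau> \<le> 1"
    have n: "norm (\<tau> *\<^sub>R snd e) \<le> \<delta>" using norm_scale_le[OF \<tau>, of "snd e"] e(2) by linarith
    have "\<bar>f (t, z + \<tau> *\<^sub>R snd e) - f (t, z)\<bar> \<le> C * (wt m (z + \<tau> *\<^sub>R snd e) + wt m z) * norm (\<tau> *\<^sub>R snd e)"
      using wl_lip[OF fam_wl[OF f, of t], of "z + \<tau> *\<^sub>R snd e" z] by simp
    also have "\<dots> \<le> C * (4 ^ m * wt m z + wt m z) * \<delta>"
      using n wt_shift_small[OF n \<delta>, of m z] C wt_pos[of m z] by (intro mult_mono mult_left_mono add_mono) auto
    finally show "\<bar>f ((t, z) + \<tau> *\<^sub>R e) - f (t, z)\<bar> \<le> (1 + 4 ^ m) * \<delta> * C * wt m z"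
      using e(1) by (simp add: plus_prod_def algebra_simps)
  qed (intro continuous_intros cf)
  finally show ?thesis .
qed

text \<open>In contrast to the smoothness constant, K precedes \<delta> here and depends only on m
  and the number of segments. The restriction \<delta> \<le> 1 bounds the change of the weight under
  each shift by the factor 4^m.\<close>

lemma avgs_close:
  "\<exists>K\<ge>0. \<forall>\<delta> es C (f :: real \<times> 'z::euclidean_space \<Rightarrow> real). length es = n \<longrightarrow> 0 \<le> \<delta> \<longrightarrow> \<delta> \<le> 1 \<longrightarrow> fam C m f \<longrightarrow>
     (\<forall>e\<in>set es. fst e = 0 \<and> norm (snd e) \<le> \<delta>) \<longrightarrow>
     (\<forall>t z. \<bar>avgs es f (t, z) - f (t, z)\<bar> \<le> K * \<delta> * C * wt m z)"
proof (induction n)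
  case 0 show ?case by (rule exI[of _ 0]) auto
next
  case (Suc n)
  then obtain K where K: "0 \<le> K" and IH: "\<And>\<delta> es C t z (f :: real \<times> 'z \<Rightarrow> real). length es = n \<Longrightarrow> 0 \<le> \<delta> \<Longrightarrow> \<delta> \<le> 1 \<Longrightarrow> fam C m f \<Longrightarrow>
     (\<forall>e\<in>set es. fst e = 0 \<and> norm (snd e) \<le> \<delta>) \<Longrightarrow> \<bar>avgs es f (t, z) - f (t, z)\<bar> \<le> K * \<delta> * C * wt m z"
    by blast
  define K' where "K' = K * 4 ^ m + (1 + 4 ^ m)"
  show ?case
  proof (intro exI[of _ K'] conjI allI impI)
    show "0 \<le> K'" using K by (simp add: K'_def add_nonneg_nonneg)
    fix \<delta> C t and z :: 'z and es :: "(real \<times> 'z) list" and f :: "real \<times> 'z \<Rightarrow> real"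
    assume l: "length es = Suc n" and \<delta>: "0 \<le> \<delta>" "\<delta> \<le> 1" and f: "fam C m f"
      and es: "\<forall>e\<in>set es. fst e = 0 \<and> norm (snd e) \<le> \<delta>"
    obtain e es' where e: "es = e # es'" "length es' = n" using l by (cases es) auto
    note cf = fam_cont[OF f] and C = fam_nonneg[OF f]
    let ?F = "avgs es' f"
    have cF: "continuous_on UNIV ?F" by (rule avgs_continuous[OF cf])
    have "avg e ?F (t, z) - avg e f (t, z) = avg e (\<lambda>p. ?F p - f p) (t, z)"
      using avg_diff[OF cF cf] by simp
    also have "\<bar>\<dots>\<bar> \<le> K * \<delta> * C * (4 ^ m * wt m z)"
    proof (rule avg_bound)
      fix \<tau> :: real assume \<tau>: "0 \<le> \<tau>" "\<tau> \<le> 1"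
      have n: "norm (\<tau> *\<^sub>R snd e) \<le> \<delta>" using norm_scale_le[OF \<tau>, of "snd e"] es e by force
      have "\<bar>?F (t, z + \<tau> *\<^sub>R snd e) - f (t, z + \<tau> *\<^sub>R snd e)\<bar> \<le> K * \<delta> * C * wt m (z + \<tau> *\<^sub>R snd e)"
        using es e by (intro IH \<delta> f) auto
      also have "\<dots> \<le> K * \<delta> * C * (4 ^ m * wt m z)"
        using K \<delta> C wt_shift_small[OF n \<delta>(2), of m z] by (intro mult_left_mono) auto
      finally show "\<bar>?F ((t, z) + \<tau> *\<^sub>R e) - f ((t, z) + \<tau> *\<^sub>R e)\<bar> \<le> K * \<delta> * C * (4 ^ m * wt m z)"
        using es e by (simp add: plus_prod_def)
    qed (intro continuous_intros cf cF)
    finally have 1: "\<bar>avg e ?F (t, z) - avg e f (t, z)\<bar> \<le> K * \<delta> * C * (4 ^ m * wt m z)" .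
    have 2: "\<bar>avg e f (t, z) - f (t, z)\<bar> \<le> (1 + 4 ^ m) * \<delta> * C * wt m z"
      using es e by (intro avg_close[OF f _ _ \<delta>(2)]) auto
    have "K' * \<delta> * C * wt m z = K * \<delta> * C * (4 ^ m * wt m z) + (1 + 4 ^ m) * \<delta> * C * wt m z"
      by (simp add: K'_def algebra_simps)
    with 1 2 show "\<bar>avgs es f (t, z) - f (t, z)\<bar> \<le> K' * \<delta> * C * wt m z"
      unfolding e by simp
  qed
qed

lemma moll_close:
  "\<exists>K\<ge>0. \<forall>\<delta> C (f :: real \<times> 'z::euclidean_space \<Rightarrow> real) t z. 0 \<le> \<delta> \<longrightarrow> \<delta> \<le> 1 \<longrightarrow> fam C m f \<longrightarrow>
     \<bar>moll n \<delta> f (t, z) - f (t, z)\<bar> \<le> K * \<delta> * C * wt m z"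
proof -
  let ?len = "length (concat (replicate n (dirs 0 :: (real \<times> 'z) list)))"
  have len: "length (concat (replicate n (dirs \<delta> :: (real \<times> 'z) list))) = ?len" for \<delta>
    using length_dirs[where 'z='z, of \<delta>] by (induction n) auto
  have es: "\<forall>e\<in>set (concat (replicate n (dirs \<delta> :: (real \<times> 'z) list))). fst e = 0 \<and> norm (snd e) \<le> \<delta>"
    if "0 \<le> \<delta>" for \<delta>
    using that by (auto simp: set_dirs)
  obtain K where "0 \<le> K" "\<And>\<delta> es C t z (f :: real \<times> 'z \<Rightarrow> real). length es = ?len \<Longrightarrow> 0 \<le> \<delta> \<Longrightarrow> \<delta> \<le> 1 \<Longrightarrow> fam C m f \<Longrightarrow>
     (\<forall>e\<in>set es. fst e = 0 \<and> norm (snd e) \<le> \<delta>) \<Longrightarrow> \<bar>avgs es f (t, z) - f (t, z)\<bar> \<le> K * \<delta> * C * wt m z"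
    using avgs_close[of ?len m] by blast
  then show ?thesis unfolding moll_def using len es by blast
qed

text \<open>The coordinates of the increment are switched on one at a time. Each new one is handled
  by the mean value inequality and the continuity of its partial derivative.\<close>

lemma has_derivative_from_partials:
  fixes f :: "'z::euclidean_space \<Rightarrow> real" and g :: "'z \<Rightarrow> 'z \<Rightarrow> real"
  assumes d: "\<And>b z. b \<in> Basis \<Longrightarrow> ((\<lambda>r. f (z + r *\<^sub>R b)) has_real_derivative g b z) (at 0)"
    and c: "\<And>b. b \<in> Basis \<Longrightarrow> continuous_on UNIV (g b)"
  shows "(f has_derivative (\<lambda>h. \<Sum>b\<in>Basis. (h \<bullet> b) * g b z)) (at z)"
proof -
  have step: "\<exists>\<delta>>0. \<forall>h. norm h < \<delta> \<longrightarrow>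
     \<bar>f (z + (\<Sum>b\<in>B. (h \<bullet> b) *\<^sub>R b)) - f z - (\<Sum>b\<in>B. (h \<bullet> b) * g b z)\<bar> \<le> \<epsilon> * norm h"
    if "finite B" "B \<subseteq> Basis" "0 < \<epsilon>" for B \<epsilon>
    using that
  proof (induction B arbitrary: \<epsilon> rule: finite_induct)
    case empty
    then show ?case by (auto intro: exI[of _ 1])
  next
    case (insert b B)
    then have b: "b \<in> Basis" by simp
    obtain \<delta>1 where \<delta>1: "\<delta>1 > 0" "\<And>h. norm h < \<delta>1 \<Longrightarrow>
       \<bar>f (z + (\<Sum>b\<in>B. (h \<bullet> b) *\<^sub>R b)) - f z - (\<Sum>b\<in>B. (h \<bullet> b) * g b z)\<bar> \<le> \<epsilon> / 2 * norm h"
      using insert.IH[of "\<epsilon> / 2"] insert.prems by auto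
    have "continuous (at z) (g b)" using c[OF b] by (simp add: continuous_on_eq_continuous_at)
    then obtain \<delta>2 where \<delta>2: "\<delta>2 > 0" "\<And>w. dist w z < \<delta>2 \<Longrightarrow> dist (g b w) (g b z) < \<epsilon> / 2"
      using insert.prems unfolding continuous_at_eps_delta by (metis half_gt_zero)
    \<comment> \<open>Every coordinate of h is at most |h|, so all intermediate points lie within
      (card B + 1) |h| of z.\<close>
    define k where "k = real (card B) + 1"
    have k: "1 \<le> k" by (simp add: k_def)
    define \<delta> where "\<delta> = min \<delta>1 (\<delta>2 / k)"
    have "0 < \<delta>" using \<delta>1 \<delta>2 k by (simp add: \<delta>_def)
    moreover have "\<bar>f (z + (\<Sum>b\<in>insert b B. (h \<bullet> b) *\<^sub>R b)) - f z - (\<Sum>b\<in>insert b B. (h \<bullet> b) * g b z)\<bar> \<le> \<epsilon> * norm h"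
      if h: "norm h < \<delta>" for h
    proof -
      define y where "y = (\<Sum>b\<in>B. (h \<bullet> b) *\<^sub>R b)"
      have "norm y \<le> (\<Sum>b\<in>B. norm ((h \<bullet> b) *\<^sub>R b))" unfolding y_def by (rule norm_sum)
      also have "\<dots> \<le> (\<Sum>b\<in>B. norm h)"
        using insert.prems by (intro sum_mono) (auto simp: Basis_le_norm subset_eq)
      finally have y: "norm y \<le> real (card B) * norm h" by simp
      define r where "r = h \<bullet> b"
      have r: "\<bar>r\<bar> \<le> norm h" using b by (simp add: r_def Basis_le_norm)
      have near: "dist (z + y + s *\<^sub>R b) z < \<delta>2" if "\<bar>s\<bar> \<le> \<bar>r\<bar>" for s
      proof -
        have "dist (z + y + s *\<^sub>R b) z \<le> norm y + norm (s *\<^sub>R b)"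
          using norm_triangle_ineq[of y "s *\<^sub>R b"] by (simp add: dist_norm add.assoc)
        also have "\<dots> \<le> k * norm h" using y that r b by (simp add: k_def algebra_simps)
        also have "\<dots> < \<delta>2" using h k by (simp add: \<delta>_def field_simps)
        finally show ?thesis .
      qed
      define \<phi> where "\<phi> s = f (z + y + s *\<^sub>R b) - s * g b z" for s
      have pdb: "pd b f (g b)" using d[OF b] by (simp add: pd_def)
      have \<phi>': "(\<phi> has_field_derivative g b (z + y + s *\<^sub>R b) - g b z) (at s within {-\<bar>r\<bar>..\<bar>r\<bar>})" for s
        unfolding \<phi>_def
        by (rule DERIV_subset[of _ _ _ UNIV]) (auto intro!: derivative_eq_intros pd_at[OF pdb])
      have "norm (\<phi> r - \<phi> 0) \<le> \<epsilon> / 2 * norm (r - 0)"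
        by (rule field_differentiable_bound[OF _ \<phi>'])
           (use \<delta>2(2)[OF near] in \<open>auto simp: dist_norm less_imp_le\<close>)
      then have 1: "\<bar>f (z + y + r *\<^sub>R b) - f (z + y) - r * g b z\<bar> \<le> \<epsilon> / 2 * \<bar>r\<bar>"
        by (simp add: \<phi>_def algebra_simps)
      have 2: "\<bar>f (z + y) - f z - (\<Sum>b\<in>B. (h \<bullet> b) * g b z)\<bar> \<le> \<epsilon> / 2 * norm h"
        unfolding y_def using h by (intro \<delta>1(2)) (simp add: \<delta>_def)
      have 3: "\<epsilon> / 2 * \<bar>r\<bar> \<le> \<epsilon> / 2 * norm h" using r insert.prems by (intro mult_left_mono) auto
      have "(\<Sum>b\<in>insert b B. (h \<bullet> b) *\<^sub>R b) = y + r *\<^sub>R b"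
        "(\<Sum>b\<in>insert b B. (h \<bullet> b) * g b z) = (\<Sum>b\<in>B. (h \<bullet> b) * g b z) + r * g b z"
        using insert.hyps by (simp_all add: y_def r_def)
      then show ?thesis using 1 2 3 by (simp only: add.assoc[symmetric])
    qed
    ultimately show ?case by blast
  qed
  have bl: "bounded_linear (\<lambda>h. \<Sum>b\<in>Basis. (h \<bullet> b) * g b z)"
    by (intro bounded_linear_sum bounded_linear_mult_const bounded_linear_inner_left)
  show ?thesis unfolding has_derivative_at_alt
  proof (intro conjI bl allI impI)
    fix \<epsilon> :: real assume "0 < \<epsilon>"
    from step[OF finite_Basis order_refl this] obtain \<delta> where "\<delta> > 0" and \<delta>: "\<And>h. norm h < \<delta> \<Longrightarrow>
     \<bar>f (z + h) - f z - (\<Sum>b\<in>Basis. (h \<bullet> b) * g b z)\<bar> \<le> \<epsilon> * norm h"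
      by (auto simp: euclidean_representation)
    then show "\<exists>d>0. \<forall>y. norm (y - z) < d \<longrightarrow>
        norm (f y - f z - (\<Sum>b\<in>Basis. ((y - z) \<bullet> b) * g b z)) \<le> \<epsilon> * norm (y - z)"
      by (intro exI[of _ \<delta>]) (use \<delta>[of "y - z" for y] in auto)
  qed
qed

text \<open>The elementary matrix with a single 1 at position (b, b'), as a linear map.\<close>

definition E2 :: "'z::euclidean_space \<Rightarrow> 'z \<Rightarrow> 'z \<Rightarrow>\<^sub>L 'z" where
  "E2 b b' = blinfun_scaleR_left b o\<^sub>L blinfun_inner_left b'"

lemma E2_apply: "blinfun_apply (E2 b b') h = (h \<bullet> b') *\<^sub>R b"
  by (simp add: E2_def inner_commute)

lemma norm_E2: "b \<in> Basis \<Longrightarrow> b' \<in> Basis \<Longrightarrow> norm (E2 b b') \<le> 1"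
  by (rule norm_blinfun_bound) (auto simp: E2_apply Basis_le_norm)

text \<open>The last clause is made for the generator of a walk, which is a linear functional of the
  gradient plus one of the Hessian: the generator of f inherits the remaining k orders of
  smoothness.\<close>

lemma smooth_derivatives:
  fixes f :: "real \<times> 'z::euclidean_space \<Rightarrow> real"
  assumes f: "smooth (Suc (Suc k)) C m f"
  obtains Df Hf where
    "\<And>t z. GDERIV (\<lambda>z. f (t, z)) z :> Df (t, z)"
    "\<And>t z. ((\<lambda>z. Df (t, z)) has_derivative blinfun_apply (Hf (t, z))) (at z)"
    "fam (real DIM('z) * C) m Df" "fam (real DIM('z) * (real DIM('z) * C)) m Hf"
    "\<And>l1 l2. linear l1 \<Longrightarrow> linear l2 \<Longrightarrow>
       smooth k ((\<Sum>b\<in>Basis. \<bar>l1 b\<bar> * C) + (\<Sum>b\<in>Basis. \<Sum>b'\<in>Basis. \<bar>l2 (E2 b b')\<bar> * C)) m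
         (\<lambda>p. l1 (Df p) + l2 (Hf p))"
proof -
  have "\<forall>b\<in>Basis. \<exists>g. pd (0, b) f g \<and> smooth (Suc k) C m g" using f by simp
  then obtain G1 where G1: "\<And>b. b \<in> Basis \<Longrightarrow> pd (0, b) f (G1 b)" "\<And>b. b \<in> Basis \<Longrightarrow> smooth (Suc k) C m (G1 b)"
    by metis
  then have "\<forall>b\<in>Basis. \<forall>b'\<in>Basis. \<exists>g. pd (0, b') (G1 b) g \<and> smooth k C m g" by simp
  then obtain G2 where G2: "\<And>b b'. b \<in> Basis \<Longrightarrow> b' \<in> Basis \<Longrightarrow> pd (0, b') (G1 b) (G2 b b')"
    "\<And>b b'. b \<in> Basis \<Longrightarrow> b' \<in> Basis \<Longrightarrow> smooth k C m (G2 b b')"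
    by metis
  have pdz: "((\<lambda>r. h (t, z + r *\<^sub>R b)) has_real_derivative g (t, z)) (at 0)" if "pd (0, b) h g"
    for h g :: "real \<times> 'z \<Rightarrow> real" and b t z
    using that[unfolded pd_def, rule_format, of "(t, z)"] by (simp add: plus_prod_def)
  have cz: "continuous_on UNIV (\<lambda>z. g (t, z))" if "smooth j C m g" for g :: "real \<times> 'z \<Rightarrow> real" and j t
    by (rule continuous_on_compose2[OF fam_cont[OF fam_smooth[OF that]]]) (auto intro!: continuous_intros)
  have f': "((\<lambda>z. f (t, z)) has_derivative (\<lambda>h. \<Sum>b\<in>Basis. (h \<bullet> b) * G1 b (t, z))) (at z)" for t z
    by (rule has_derivative_from_partials[where g="\<lambda>b z. G1 b (t, z)"]) (auto intro: pdz cz G1)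
  have G1': "((\<lambda>z. G1 b (t, z)) has_derivative (\<lambda>h. \<Sum>b'\<in>Basis. (h \<bullet> b') * G2 b b' (t, z))) (at z)"
    if "b \<in> Basis" for b t z
    by (rule has_derivative_from_partials[where g="\<lambda>b' z. G2 b b' (t, z)"]) (auto intro: pdz cz G2 that)
  define Df where "Df p = (\<Sum>b\<in>Basis. G1 b p *\<^sub>R b)" for p
  define Hf where "Hf p = (\<Sum>b\<in>Basis. \<Sum>b'\<in>Basis. G2 b b' p *\<^sub>R E2 b b')" for p
  have fR: "fam (1 * C) m (\<lambda>p. g p *\<^sub>R x)" if "fam C m g" "norm x \<le> 1"
    for g :: "real \<times> 'z \<Rightarrow> real" and x :: "'b::real_normed_vector"
    by (rule fam_bounded_linear[OF that(1) bounded_linear_scaleR_left])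
       (use mult_left_mono[OF that(2), of "\<bar>y\<bar>" for y] in auto)
  show thesis
  proof (rule that[of Df Hf])
    show "GDERIV (\<lambda>z. f (t, z)) z :> Df (t, z)" for t z
      unfolding gderiv_def Df_def using f'[of t z] by (simp add: inner_sum_right mult.commute)
    show "((\<lambda>z. Df (t, z)) has_derivative blinfun_apply (Hf (t, z))) (at z)" for t z
    proof -
      have "((\<lambda>z. \<Sum>b\<in>Basis. G1 b (t, z) *\<^sub>R b) has_derivative
         (\<lambda>h. \<Sum>b\<in>Basis. (\<Sum>b'\<in>Basis. (h \<bullet> b') * G2 b b' (t, z)) *\<^sub>R b)) (at z)"
        by (intro has_derivative_sum has_derivative_scaleR_left G1')
      moreover have "blinfun_apply (Hf (t, z)) = (\<lambda>h. \<Sum>b\<in>Basis. (\<Sum>b'\<in>Basis. (h \<bullet> b') * G2 b b' (t, z)) *\<^sub>R b)"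
        by (simp add: fun_eq_iff Hf_def blinfun.sum_left blinfun.scaleR_left E2_apply scaleR_sum_left mult.commute)
      ultimately show ?thesis by (simp add: Df_def)
    qed
    have "fam (\<Sum>b\<in>(Basis :: 'z set). 1 * C) m Df" unfolding Df_def
      by (intro fam_sum fR fam_smooth[OF G1(2)]) auto
    then show "fam (real DIM('z) * C) m Df" by simp
    have "fam (\<Sum>b\<in>(Basis :: 'z set). \<Sum>b'\<in>(Basis :: 'z set). 1 * C) m Hf" unfolding Hf_def
      by (intro fam_sum fR fam_smooth[OF G2(2)] norm_E2)
    then show "fam (real DIM('z) * (real DIM('z) * C)) m Hf" by simp
    fix l1 :: "'z \<Rightarrow> real" and l2 :: "('z \<Rightarrow>\<^sub>L 'z) \<Rightarrow> real"
    assume l1: "linear l1" and l2: "linear l2"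
    have "l1 (Df p) + l2 (Hf p) = (\<Sum>b\<in>Basis. l1 b * G1 b p) + (\<Sum>b\<in>Basis. \<Sum>b'\<in>Basis. l2 (E2 b b') * G2 b b' p)" for p
      by (simp add: Df_def Hf_def linear_sum[OF l1] linear_sum[OF l2] linear_scale[OF l1] linear_scale[OF l2] mult.commute)
    moreover have "smooth k ((\<Sum>b\<in>Basis. \<bar>l1 b\<bar> * C) + (\<Sum>b\<in>Basis. \<Sum>b'\<in>Basis. \<bar>l2 (E2 b b')\<bar> * C)) m
      (\<lambda>p. (\<Sum>b\<in>Basis. l1 b * G1 b p) + (\<Sum>b\<in>Basis. \<Sum>b'\<in>Basis. l2 (E2 b b') * G2 b b' p))"
      by (intro smooth_add smooth_sum smooth_cmult G2(2) smooth_Suc[OF G1(2)])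
    ultimately show "smooth k ((\<Sum>b\<in>Basis. \<bar>l1 b\<bar> * C) + (\<Sum>b\<in>Basis. \<Sum>b'\<in>Basis. \<bar>l2 (E2 b b')\<bar> * C)) m
         (\<lambda>p. l1 (Df p) + l2 (Hf p))" by simp
  qed
qed

lemma C12_test_from_family:
  fixes W :: "real \<times> 'z::euclidean_space \<Rightarrow> real"
  assumes "continuous_on UNIV W" "pd (1, 0) W Wt" "continuous_on UNIV Wt"
    "\<And>t z. GDERIV (\<lambda>z. W (t, z)) z :> DW (t, z)" "continuous_on UNIV DW"
    "\<And>t z. ((\<lambda>z. DW (t, z)) has_derivative blinfun_apply (HW (t, z))) (at z)" "continuous_on UNIV HW"
  shows "C12_test (\<lambda>t z. W (t, z)) (\<lambda>t z. Wt (t, z)) (\<lambda>t z. DW (t, z)) (\<lambda>t z. HW (t, z))"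
proof -
  have "((\<lambda>s. W (s, z)) has_real_derivative Wt (t, z)) (at t)" for t z
    using pd_at[OF assms(2), of "(0, z)" t] by (simp add: plus_prod_def)
  then show ?thesis unfolding C12_test_def
    using assms by (auto intro: continuous_on_subset)
qed

section \<open>Random walks and their generators\<close>

definition reg :: "real \<Rightarrow> nat \<Rightarrow> ('z::euclidean_space \<Rightarrow> real) \<Rightarrow> ('z \<Rightarrow> 'z) \<Rightarrow> ('z \<Rightarrow> 'z \<Rightarrow>\<^sub>L 'z) \<Rightarrow> bool" where
  "reg C m f Df Hf \<longleftrightarrow> C2 f Df Hf \<and> wl C m f \<and> wl C m Df \<and> wl C m Hf"

lemma reg_wl: "reg C m f Df Hf \<Longrightarrow> wl C m f" "reg C m f Df Hf \<Longrightarrow> wl C m Df" "reg C m f Df Hf \<Longrightarrow> wl C m Hf"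
  by (auto simp: reg_def)

lemma reg_C2: "reg C m f Df Hf \<Longrightarrow> C2 f Df Hf"
  by (simp add: reg_def)

lemma reg_weaken: "reg C m f Df Hf \<Longrightarrow> C \<le> C' \<Longrightarrow> reg C' m f Df Hf"
  unfolding reg_def by (meson wl_weaken order_refl)

lemma smooth_regular:
  fixes f :: "real \<times> 'z::euclidean_space \<Rightarrow> real"
  assumes f: "smooth (Suc (Suc k)) C m f"
  obtains Df Hf C' where
    "\<And>t. reg C' m (\<lambda>z. f (t, z)) (\<lambda>z. Df (t, z)) (\<lambda>z. Hf (t, z))"
    "continuous_on UNIV Df" "continuous_on UNIV Hf"
    "\<And>l1 l2. linear l1 \<Longrightarrow> linear l2 \<Longrightarrow> \<exists>B. smooth k B m (\<lambda>p. l1 (Df p) + l2 (Hf p))"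
proof -
  let ?d = "real DIM('z)"
  obtain Df Hf where D: "\<And>t z. GDERIV (\<lambda>z. f (t, z)) z :> Df (t, z)"
    "\<And>t z. ((\<lambda>z. Df (t, z)) has_derivative blinfun_apply (Hf (t, z))) (at z)"
    and F: "fam (?d * C) m Df" "fam (?d * (?d * C)) m Hf"
    and sm: "\<And>l1 l2. linear l1 \<Longrightarrow> linear l2 \<Longrightarrow>
       smooth k ((\<Sum>b\<in>Basis. \<bar>l1 b\<bar> * C) + (\<Sum>b\<in>Basis. \<Sum>b'\<in>Basis. \<bar>l2 (E2 b b')\<bar> * C)) m
         (\<lambda>p. l1 (Df p) + l2 (Hf p))"
    by (rule smooth_derivatives[OF f]) (rule that; assumption)
  let ?C = "C + ?d * C + ?d * (?d * C)"
  have le: "C \<le> ?C" "?d * C \<le> ?C" "?d * (?d * C) \<le> ?C"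
    using fam_nonneg[OF F(1)] fam_nonneg[OF F(2)] smooth_nonneg[OF f] by linarith+
  have cz: "continuous_on UNIV (\<lambda>z. Hf (t, z))" for t
    by (rule continuous_on_compose2[OF fam_cont[OF F(2)]]) (auto intro!: continuous_intros)
  have "reg ?C m (\<lambda>z. f (t, z)) (\<lambda>z. Df (t, z)) (\<lambda>z. Hf (t, z))" for t
    unfolding reg_def C2_def
    using D fam_wl[OF fam_weaken[OF fam_smooth[OF f] le(1)], of t] fam_wl[OF fam_weaken[OF F(1) le(2)], of t]
      fam_wl[OF fam_weaken[OF F(2) le(3)], of t] cz[of t] by blast
  then show thesis using sm fam_cont[OF F(1)] fam_cont[OF F(2)] by (intro that[of _ Df Hf]) blast+
qed

text \<open>Taylor's formula of order two along the segment leaves the Hessian at an intermediate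
  point. Its Lipschitz bound supplies the third power of |v| without third derivatives.\<close>

lemma reg_taylor:
  assumes f: "reg C m f Df Hf"
  shows "\<bar>f (z + v) - f z - Df z \<bullet> v - 1/2 * (blinfun_apply (Hf z) v \<bullet> v)\<bar>
    \<le> C * (2 ^ m * wt m v) * wt m z * norm v ^ 3"
proof -
  have fd: "GDERIV f y :> Df y" "(Df has_derivative blinfun_apply (Hf y)) (at y)" for y
    using reg_C2[OF f] by (auto simp: C2_def)
  have line: "((\<lambda>t. z + t *\<^sub>R v) has_derivative (\<lambda>s. s *\<^sub>R v)) (at t)" for t
    by (auto intro!: derivative_eq_intros)
  define d where "d n t = (if n = 0 then f (z + t *\<^sub>R v) else if n = 1 then Df (z + t *\<^sub>R v) \<bullet> v
     else blinfun_apply (Hf (z + t *\<^sub>R v)) v \<bullet> v)" for n :: nat and t :: real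
  have d0: "DERIV (d 0) t :> d (Suc 0) t" for t
  proof -
    have "(f has_derivative (\<lambda>h. h \<bullet> Df (z + t *\<^sub>R v))) (at (z + t *\<^sub>R v))" using fd(1) by (simp add: gderiv_def)
    from has_derivative_compose[OF line this] show ?thesis
      by (simp add: d_def[abs_def] has_field_derivative_def inner_commute mult_commute_abs)
  qed
  have d1: "DERIV (d (Suc 0)) t :> d (Suc (Suc 0)) t" for t
  proof -
    from has_derivative_inner_left[OF has_derivative_compose[OF line fd(2)[of "z + t *\<^sub>R v"]], of v]
    show ?thesis
      by (simp add: d_def[abs_def] has_field_derivative_def blinfun.scaleR_right mult_commute_abs)
  qed
  have "\<exists>t>0. t < 1 \<and> d 0 1 = (\<Sum>m<2. d m 0 / fact m * (1 - 0) ^ m) + d 2 t / fact 2 * (1 - 0) ^ 2"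
    by (rule Taylor_up) (use d0 d1 in \<open>auto simp: less_2_cases_iff\<close>)
  then obtain t where t: "0 < t" "t < 1" and
    eq: "f (z + v) = f z + Df z \<bullet> v + 1/2 * (blinfun_apply (Hf (z + t *\<^sub>R v)) v \<bullet> v)"
    by (auto simp: d_def numeral_2_eq_2)
  have C: "0 \<le> C" using wl_nonneg reg_wl(1)[OF f] by blast
  have n: "norm (t *\<^sub>R v) \<le> norm v" using t by (intro norm_scale_le) auto
  have "f (z + v) - f z - Df z \<bullet> v - 1/2 * (blinfun_apply (Hf z) v \<bullet> v)
     = 1/2 * (blinfun_apply (Hf (z + t *\<^sub>R v) - Hf z) v \<bullet> v)"
    by (simp add: eq blinfun.diff_left inner_diff_left)
  also have "\<bar>\<dots>\<bar> \<le> 1/2 * (norm (Hf (z + t *\<^sub>R v) - Hf z) * norm v * norm v)"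
  proof -
    let ?B = "Hf (z + t *\<^sub>R v) - Hf z"
    have "\<bar>blinfun_apply ?B v \<bullet> v\<bar> \<le> norm ?B * norm v * norm v"
      using Cauchy_Schwarz_ineq2[of "blinfun_apply ?B v" v]
        mult_right_mono[OF norm_blinfun[of ?B v] norm_ge_zero[of v]] by linarith
    then show ?thesis by (simp add: abs_mult)
  qed
  also have "\<dots> \<le> 1/2 * (C * (wt m (z + t *\<^sub>R v) + wt m z) * norm (t *\<^sub>R v) * norm v * norm v)"
    using wl_lip[OF reg_wl(3)[OF f], of "z + t *\<^sub>R v" z] by (intro mult_left_mono mult_right_mono) auto
  also have "\<dots> \<le> 1/2 * (C * (2 ^ m * wt m v * wt m z + 2 ^ m * wt m v * wt m z) * norm v * norm v * norm v)"
  proof -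
    have "1 \<le> 2 ^ m * wt m v" using mult_mono[of 1 "2^m::real" 1 "wt m v"] wt_ge_1[of m v] by simp
    then have "wt m z \<le> 2 ^ m * wt m v * wt m z" using wt_pos[of m z] mult_right_mono[of 1 _ "wt m z"] by auto
    then show ?thesis
      using wt_shift_le[OF n, of m z] C n wt_pos[of m z] wt_pos[of m "z + t *\<^sub>R v"]
      using wt_pos[of m v]
      by (intro mult_left_mono mult_right_mono mult_mono add_mono) (auto simp: zero_le_mult_iff)
  qed
  also have "\<dots> = C * (2 ^ m * wt m v) * wt m z * norm v ^ 3" by (simp add: power3_eq_cube)
  finally show ?thesis .
qed

text \<open>The linear term must be kept exactly: in \<open>step_wt\<close> the x are of order sqrt
  h one by one, but their mean is only of order h.\<close>

lemma power_second_order: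
  fixes B :: real assumes "0 \<le> B"
  shows "\<exists>C\<ge>0. \<forall>x. \<bar>x\<bar> \<le> B \<longrightarrow> \<bar>(1 + x) ^ m - 1 - real m * x\<bar> \<le> C * x\<^sup>2"
proof (induction m)
  case 0 show ?case by (rule exI[of _ 0]) auto
next
  case (Suc m)
  then obtain C where C: "C \<ge> 0" "\<And>x. \<bar>x\<bar> \<le> B \<Longrightarrow> \<bar>(1 + x) ^ m - 1 - real m * x\<bar> \<le> C * x\<^sup>2" by blast
  show ?case
  proof (intro exI[of _ "real m + C * (1 + B)"] conjI allI impI)
    show "0 \<le> real m + C * (1 + B)" using C assms by simp
    fix x :: real assume x: "\<bar>x\<bar> \<le> B"
    define R where "R = (1 + x) ^ m - 1 - real m * x"
    have "(1 + x) ^ Suc m - 1 - real (Suc m) * x = real m * x\<^sup>2 + R * (1 + x)"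
      by (simp add: R_def algebra_simps power2_eq_square)
    also have "\<bar>\<dots>\<bar> \<le> real m * x\<^sup>2 + \<bar>R\<bar> * \<bar>1 + x\<bar>"
      using abs_triangle_ineq[of "real m * x\<^sup>2" "R * (1 + x)"] by (simp add: abs_mult)
    also have "\<dots> \<le> real m * x\<^sup>2 + C * x\<^sup>2 * (1 + B)"
      using C(2)[OF x] x C(1) by (intro add_left_mono mult_mono) (auto simp: R_def)
    finally show "\<bar>(1 + x) ^ Suc m - 1 - real (Suc m) * x\<bar> \<le> (real m + C * (1 + B)) * x\<^sup>2"
      by (simp add: algebra_simps)
  qed
qed

text \<open>In time h a particle jumps by sqrt h a_i + h q, each i with probability 1/N. As the a_i
  sum to 0, the terms of order sqrt h cancel on average; the drift q and the second moments of the
  a_i form the generator.\<close>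

locale walk =
  fixes N :: nat and a :: "nat \<Rightarrow> 'z::euclidean_space" and q :: 'z
  assumes N: "0 < N" and centered: "(\<Sum>i<N. a i) = 0"
begin

definition v :: "real \<Rightarrow> nat \<Rightarrow> 'z" where "v h i = sqrt h *\<^sub>R a i + h *\<^sub>R q"

definition step :: "real \<Rightarrow> ('z \<Rightarrow> 'b::real_vector) \<Rightarrow> 'z \<Rightarrow> 'b" where
  "step h f z = (1 / real N) *\<^sub>R (\<Sum>i<N. f (z + v h i))"

definition trace_part :: "('z \<Rightarrow>\<^sub>L 'z) \<Rightarrow> real" where
  "trace_part B = (1 / real N) * (\<Sum>i<N. 1/2 * (blinfun_apply B (a i) \<bullet> a i))"

definition gen :: "'z \<Rightarrow> ('z \<Rightarrow>\<^sub>L 'z) \<Rightarrow> real" where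
  "gen D B = q \<bullet> D + trace_part B"

definition R :: real where "R = norm q + (\<Sum>i<N. norm (a i))"

lemma R_nonneg: "0 \<le> R" by (simp add: R_def sum_nonneg)

lemma norm_a_le: "i < N \<Longrightarrow> norm (a i) \<le> R"
  using member_le_sum[of i "{..<N}" "\<lambda>i. norm (a i)"] by (auto simp: R_def intro: add_increasing)

lemma norm_q_le: "norm q \<le> R"
  by (simp add: R_def sum_nonneg)

lemma norm_v: assumes "0 \<le> h" "h \<le> 1" "i < N" shows "norm (v h i) \<le> sqrt h * R"
proof -
  have h: "h \<le> sqrt h" using assms by (simp add: real_le_rsqrt power2_eq_square mult_left_le)
  have "norm (v h i) \<le> sqrt h * norm (a i) + h * norm q"
    unfolding v_def using norm_triangle_ineq[of "sqrt h *\<^sub>R a i" "h *\<^sub>R q"] assms by simp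
  also have "\<dots> \<le> sqrt h * norm (a i) + sqrt h * norm q"
    using h by (intro add_left_mono mult_right_mono) auto
  also have "\<dots> = sqrt h * (norm (a i) + norm q)" by (simp add: algebra_simps)
  also have "\<dots> \<le> sqrt h * R"
    using member_le_sum[of i "{..<N}" "\<lambda>i. norm (a i)"] assms
    by (intro mult_left_mono) (auto simp: R_def)
  finally show ?thesis .
qed

lemma sum_v: "(\<Sum>i<N. v h i) = (real N * h) *\<^sub>R q"
  by (simp add: v_def sum.distrib scaleR_sum_right[symmetric] centered sum_constant_scaleR)

lemma step_add: "step h (\<lambda>z. f z + g z) z = step h f z + step h g z"
  by (simp add: step_def sum.distrib scaleR_add_right)

lemma step_cmult: "step h (\<lambda>z. c * f z) z = c * step h f z" for c :: real
  by (simp add: step_def sum_distrib_left[symmetric])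

lemma step_mono: "(\<And>z. f z \<le> g z) \<Longrightarrow> step h f z \<le> step h g z" for f g :: "'z \<Rightarrow> real"
  unfolding step_def by (intro scaleR_left_mono sum_mono) auto

lemma step_norm_le: "norm (step h f z) \<le> step h (\<lambda>z. norm (f z)) z"
  unfolding step_def using norm_sum[of "\<lambda>i. f (z + v h i)" "{..<N}"] N by (simp add: divide_right_mono)

lemma step_linear: "linear l \<Longrightarrow> l (step h f z) = step h (\<lambda>z. l (f z)) z"
  by (simp add: step_def linear_scale linear_sum)

lemma linear_trace_part: "linear trace_part"
  by (rule linearI)
     (simp_all add: trace_part_def blinfun.add_left blinfun.scaleR_left inner_add_left
        sum.distrib distrib_left sum_distrib_left mult_ac add_divide_distrib sum_divide_distrib)

lemma linear_inner_q: "linear (\<lambda>D. q \<bullet> D)"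
  by (rule linearI) (simp_all add: inner_add_right)

lemma gen_add: "gen (D + D') (B + B') = gen D B + gen D' B'"
  by (simp add: gen_def linear_add[OF linear_trace_part] inner_add_right)

lemma gen_scale: "gen (c *\<^sub>R D) (c *\<^sub>R B) = c * gen D B"
  by (simp add: gen_def linear_scale[OF linear_trace_part] algebra_simps)

lemma trace_part_bound: "\<bar>trace_part B\<bar> \<le> R\<^sup>2 * norm B"
proof -
  have "\<bar>1/2 * (blinfun_apply B (a i) \<bullet> a i)\<bar> \<le> R\<^sup>2 * norm B" if "i < N" for i
  proof -
    have "\<bar>blinfun_apply B (a i) \<bullet> a i\<bar> \<le> norm B * norm (a i) * norm (a i)"
      using Cauchy_Schwarz_ineq2[of "blinfun_apply B (a i)" "a i"] mult_right_mono[OF norm_blinfun[of B "a i"] norm_ge_zero[of "a i"]]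
      by linarith
    also have "\<dots> \<le> norm B * R * R"
      using norm_a_le[OF that] R_nonneg by (intro mult_mono mult_left_mono) auto
    finally show ?thesis using R_nonneg by (simp add: power2_eq_square mult_ac abs_mult)
  qed
  then have "\<bar>\<Sum>i<N. 1/2 * (blinfun_apply B (a i) \<bullet> a i)\<bar> \<le> (\<Sum>i<N. R\<^sup>2 * norm B)"
    by (intro order_trans[OF sum_abs] sum_mono) auto
  then have "\<bar>\<Sum>i<N. 1/2 * (blinfun_apply B (a i) \<bullet> a i)\<bar> \<le> real N * (R\<^sup>2 * norm B)" by simp
  then show ?thesis using N by (simp add: trace_part_def abs_mult divide_le_eq mult.commute)
qed

definition KL :: real where "KL = R + R\<^sup>2"

lemma KL_nonneg: "0 \<le> KL" using R_nonneg by (simp add: KL_def)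

lemma gen_bound: "\<bar>gen D B\<bar> \<le> KL * (norm D + norm B)"
proof -
  have "\<bar>q \<bullet> D\<bar> \<le> R * norm D"
    using Cauchy_Schwarz_ineq2[of q D] mult_right_mono[OF norm_q_le norm_ge_zero[of D]] by linarith
  moreover have "0 \<le> R * norm B" "0 \<le> R\<^sup>2 * norm D" using R_nonneg by auto
  moreover have "KL * (norm D + norm B) = R * norm D + R * norm B + R\<^sup>2 * norm D + R\<^sup>2 * norm B"
    by (simp add: KL_def algebra_simps)
  ultimately show ?thesis
    using trace_part_bound[of B] abs_triangle_ineq[of "q \<bullet> D" "trace_part B"] unfolding gen_def by linarith
qed

text \<open>A factor exp(l h) is needed, as 1 + C sqrt h would not survive s / h iterations. A jump
  changes r = 1 + |z|^2 by the relative amount x_i; this is of order sqrt h, and centering makes its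
  mean of order h.\<close>

lemma step_wt: "\<exists>l\<ge>0. \<forall>h z. 0 \<le> h \<longrightarrow> h \<le> 1 \<longrightarrow> step h (wt m) z \<le> exp (l * h) * wt m z"
proof -
  define B where "B = 2 * R + R\<^sup>2"
  have B: "0 \<le> B" using R_nonneg by (simp add: B_def)
  obtain C where C: "C \<ge> 0" "\<And>x. \<bar>x\<bar> \<le> B \<Longrightarrow> \<bar>(1 + x) ^ m - 1 - real m * x\<bar> \<le> C * x\<^sup>2"
    using power_second_order[OF B] by blast
  define l where "l = real m * B + C * B\<^sup>2"
  have "step h (wt m) z \<le> exp (l * h) * wt m z" if h: "0 \<le> h" "h \<le> 1" for h z
  proof -
    define r where "r = 1 + (norm z)\<^sup>2"
    have r: "1 \<le> r" "norm z \<le> r" using norm_le_wt[of z] by (auto simp: r_def wt_def)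
    define x where "x i = (2 * (z \<bullet> v h i) + (norm (v h i))\<^sup>2) / r" for i
    have v2: "(norm (v h i))\<^sup>2 \<le> h * R\<^sup>2" if "i < N" for i
      using power_mono[OF norm_v[OF h that], of 2] h by (simp add: power_mult_distrib)
    have wtv: "wt m (z + v h i) = wt m z * (1 + x i) ^ m" for i
    proof -
      have "1 + (norm (z + v h i))\<^sup>2 = r * (1 + x i)"
      proof -
        have "r * x i = 2 * (z \<bullet> v h i) + (norm (v h i))\<^sup>2" using r by (simp add: x_def)
        then show ?thesis
          by (simp add: distrib_left r_def power2_norm_eq_inner inner_add_left inner_add_right inner_commute)
      qed
      then show ?thesis by (simp add: wt_def power_mult_distrib r_def)
    qed
    have xb: "\<bar>x i\<bar> \<le> sqrt h * B" if i: "i < N" for i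
    proof -
      have "\<bar>2 * (z \<bullet> v h i) + (norm (v h i))\<^sup>2\<bar> \<le> 2 * (norm z * norm (v h i)) + (norm (v h i))\<^sup>2"
        using Cauchy_Schwarz_ineq2[of z "v h i"] by (simp add: abs_le_iff) (smt (verit) zero_le_power2)
      also have "\<dots> \<le> 2 * (r * (sqrt h * R)) + sqrt h * R\<^sup>2 * r"
      proof (intro add_mono mult_left_mono mult_mono)
        have "h \<le> sqrt h" using h by (simp add: real_le_rsqrt power2_eq_square mult_left_le)
        then have "h * R\<^sup>2 \<le> sqrt h * R\<^sup>2 * 1" by (simp add: mult_right_mono)
        also have "\<dots> \<le> sqrt h * R\<^sup>2 * r" using r h by (intro mult_left_mono) auto
        finally show "(norm (v h i))\<^sup>2 \<le> sqrt h * R\<^sup>2 * r" using v2[OF i] by linarith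
      qed (use r norm_v[OF h i] in auto)
      also have "\<dots> = sqrt h * B * r" by (simp add: B_def algebra_simps)
      finally show ?thesis using r by (simp add: x_def abs_divide divide_le_eq)
    qed
    \<comment> \<open>Here centering enters: by \<open>sum_v\<close> only the drift contributes to
      the inner products with z.\<close>
    have sx: "(\<Sum>i<N. x i) \<le> real N * (h * B)"
    proof -
      have "(\<Sum>i<N. x i) = (2 * (z \<bullet> (\<Sum>i<N. v h i)) + (\<Sum>i<N. (norm (v h i))\<^sup>2)) / r"
        by (simp add: x_def sum_divide_distrib sum.distrib inner_sum_right sum_distrib_left add_divide_distrib)
      also have "z \<bullet> (\<Sum>i<N. v h i) = real N * h * (z \<bullet> q)" by (simp add: sum_v)
      also have "(2 * (real N * h * (z \<bullet> q)) + (\<Sum>i<N. (norm (v h i))\<^sup>2)) / r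
        \<le> (2 * (real N * h * (r * R)) + real N * (h * R\<^sup>2) * r) / r"
      proof (intro divide_right_mono add_mono mult_left_mono)
        show "z \<bullet> q \<le> r * R"
          using norm_cauchy_schwarz[of z q] mult_mono[OF r(2) norm_q_le _ norm_ge_zero] r by linarith
        have "(\<Sum>i<N. (norm (v h i))\<^sup>2) \<le> (\<Sum>i<N. h * R\<^sup>2)" using v2 by (intro sum_mono) auto
        then have "(\<Sum>i<N. (norm (v h i))\<^sup>2) \<le> real N * (h * R\<^sup>2) * 1" by simp
        also have "\<dots> \<le> real N * (h * R\<^sup>2) * r" using r h by (intro mult_left_mono) auto
        finally show "(\<Sum>i<N. (norm (v h i))\<^sup>2) \<le> real N * (h * R\<^sup>2) * r" .
      qed (use r h in auto)
      also have "\<dots> = real N * (h * B)" using r by (simp add: B_def field_simps)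
      finally show ?thesis .
    qed
    have px: "(1 + x i) ^ m \<le> 1 + real m * x i + C * (h * B\<^sup>2)" if i: "i < N" for i
    proof -
      have "sqrt h * B \<le> 1 * B" using h B by (intro mult_right_mono) auto
      then have xB: "\<bar>x i\<bar> \<le> B" using xb[OF i] by simp
      have "(x i)\<^sup>2 \<le> (sqrt h * B)\<^sup>2" using xb[OF i] by (metis abs_ge_zero power2_abs power_mono)
      then have "C * (x i)\<^sup>2 \<le> C * (h * B\<^sup>2)"
        using h C(1) by (intro mult_left_mono) (simp_all add: power_mult_distrib)
      then show ?thesis using C(2)[OF xB] by linarith
    qed
    have "(\<Sum>i<N. (1 + x i) ^ m) \<le> (\<Sum>i<N. 1 + real m * x i + C * (h * B\<^sup>2))"
      using px by (intro sum_mono) auto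
    also have "\<dots> = real N + real m * (\<Sum>i<N. x i) + real N * (C * (h * B\<^sup>2))"
      by (simp add: sum.distrib sum_distrib_left)
    also have "\<dots> \<le> real N + real m * (real N * (h * B)) + real N * (C * (h * B\<^sup>2))"
      using mult_left_mono[OF sx, of "real m"] by simp
    also have "\<dots> = real N * (1 + l * h)" by (simp add: l_def algebra_simps)
    also have "\<dots> \<le> real N * exp (l * h)" using exp_ge_add_one_self[of "l * h"] by (intro mult_left_mono) auto
    finally have s: "(\<Sum>i<N. (1 + x i) ^ m) \<le> real N * exp (l * h)" .
    have "step h (wt m) z = (1 / real N) * (wt m z * (\<Sum>i<N. (1 + x i) ^ m))"
      by (simp add: step_def wtv sum_distrib_left)
    also have "\<dots> \<le> (1 / real N) * (wt m z * (real N * exp (l * h)))"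
      using s wt_pos[of m z] by (intro mult_left_mono) auto
    also have "\<dots> = exp (l * h) * wt m z" using N by simp
    finally show ?thesis .
  qed
  moreover have "0 \<le> l" using B C by (simp add: l_def)
  ultimately show ?thesis by blast
qed

definition lam :: "nat \<Rightarrow> real" where
  "lam m = (SOME l. 0 \<le> l \<and> (\<forall>h z. 0 \<le> h \<longrightarrow> h \<le> 1 \<longrightarrow> step h (wt m) z \<le> exp (l * h) * wt m z))"

lemma lam: "0 \<le> lam m" "0 \<le> h \<Longrightarrow> h \<le> 1 \<Longrightarrow> step h (wt m) z \<le> exp (lam m * h) * wt m z"
  using someI_ex[OF step_wt[of m]] by (auto simp: lam_def)

text \<open>Since one step costs only exp(lam m * h), any number of steps of total length s costs
  exp(lam m * s).\<close>

lemma step_wl: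
  assumes f: "wl C m f" and h: "0 \<le> h" "h \<le> 1"
  shows "wl (exp (lam m * h) * C) m (step h f)"
proof (rule wlI)
  note C = wl_nonneg[OF f]
  fix z z'
  have "norm (step h f z) \<le> step h (\<lambda>z. norm (f z)) z" by (rule step_norm_le)
  also have "\<dots> \<le> step h (\<lambda>z. C * wt m z) z" by (rule step_mono) (rule wl_growth[OF f])
  also have "\<dots> \<le> C * (exp (lam m * h) * wt m z)"
    unfolding step_cmult by (intro mult_left_mono lam h C)
  finally show "norm (step h f z) \<le> exp (lam m * h) * C * wt m z" by (simp add: mult_ac)
  have "step h f z - step h f z' = (1 / real N) *\<^sub>R (\<Sum>i<N. f (z + v h i) - f (z' + v h i))"
    by (simp add: step_def sum_subtractf scaleR_diff_right)
  also have "norm \<dots> \<le> (1 / real N) * (\<Sum>i<N. norm (f (z + v h i) - f (z' + v h i)))"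
    using norm_sum[of "\<lambda>i. f (z + v h i) - f (z' + v h i)" "{..<N}"] N by (simp add: divide_right_mono)
  also have "\<dots> \<le> (1 / real N) * (\<Sum>i<N. C * (wt m (z + v h i) + wt m (z' + v h i)) * norm (z - z'))"
    using wl_lip[OF f, of "z + v h i" "z' + v h i" for i] N by (intro mult_left_mono sum_mono) auto
  also have "\<dots> = C * (step h (wt m) z + step h (wt m) z') * norm (z - z')"
  proof -
    have "(\<Sum>i<N. C * (wt m (z + v h i) + wt m (z' + v h i)) * norm (z - z'))
      = C * ((\<Sum>i<N. wt m (z + v h i)) + (\<Sum>i<N. wt m (z' + v h i))) * norm (z - z')"
      by (simp add: sum_distrib_left sum_distrib_right sum.distrib algebra_simps)
    then show ?thesis by (simp add: step_def add_divide_distrib[symmetric])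
  qed
  also have "\<dots> \<le> C * (exp (lam m * h) * wt m z + exp (lam m * h) * wt m z') * norm (z - z')"
    by (intro mult_right_mono mult_left_mono add_mono lam h C) auto
  finally show "norm (step h f z - step h f z') \<le> exp (lam m * h) * C * (wt m z + wt m z') * norm (z - z')"
    by (simp add: algebra_simps)
qed

lemma step_C2:
  assumes "C2 f Df Hf" shows "C2 (step h f) (step h Df) (step h Hf)"
proof -
  have sh: "((\<lambda>z. g (z + d)) has_derivative g') (at z)" if "(g has_derivative g') (at (z + d))"
    for g :: "'z \<Rightarrow> 'b::real_normed_vector" and g' z d
  proof -
    have "((\<lambda>z. z + d) has_derivative (\<lambda>x. x)) (at z)" by (auto intro!: derivative_eq_intros)
    from has_derivative_compose[OF this that] show ?thesis .
  qed
  have 1: "GDERIV (step h f) z :> step h Df z" for z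
  proof -
    have "(f has_derivative (\<lambda>x. x \<bullet> Df y)) (at y)" for y using assms by (auto simp: C2_def gderiv_def)
    then have "((\<lambda>z. (1 / real N) *\<^sub>R (\<Sum>i<N. f (z + v h i))) has_derivative
      (\<lambda>x. (1 / real N) *\<^sub>R (\<Sum>i<N. x \<bullet> Df (z + v h i)))) (at z)"
      by (intro has_derivative_scaleR_right has_derivative_sum sh)
    then show ?thesis by (simp add: gderiv_def step_def[abs_def] inner_sum_right)
  qed
  have 2: "(step h Df has_derivative blinfun_apply (step h Hf z)) (at z)" for z
  proof -
    have "(Df has_derivative blinfun_apply (Hf y)) (at y)" for y using assms by (auto simp: C2_def)
    then have "((\<lambda>z. (1 / real N) *\<^sub>R (\<Sum>i<N. Df (z + v h i))) has_derivative
      (\<lambda>x. (1 / real N) *\<^sub>R (\<Sum>i<N. blinfun_apply (Hf (z + v h i)) x))) (at z)"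
      by (intro has_derivative_scaleR_right has_derivative_sum sh)
    moreover have "blinfun_apply (step h Hf z) = (\<lambda>x. (1 / real N) *\<^sub>R (\<Sum>i<N. blinfun_apply (Hf (z + v h i)) x))"
      by (simp add: fun_eq_iff step_def blinfun.scaleR_left blinfun.sum_left)
    ultimately show ?thesis by (simp add: step_def[abs_def])
  qed
  have "continuous_on UNIV Hf" using assms by (simp add: C2_def)
  then have "continuous_on UNIV (step h Hf)"
    unfolding step_def by (intro continuous_intros continuous_on_sum cont_shift)
  then show ?thesis using 1 2 by (simp add: C2_def)
qed

lemma step_reg:
  "reg C m f Df Hf \<Longrightarrow> 0 \<le> h \<Longrightarrow> h \<le> 1 \<Longrightarrow>
   reg (exp (lam m * h) * C) m (step h f) (step h Df) (step h Hf)"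
  by (auto simp: reg_def intro: step_wl step_C2)

lemma step_gen: "step h (\<lambda>z. gen (Df z) (Hf z)) z = gen (step h Df z) (step h Hf z)"
  unfolding gen_def step_add
  by (simp add: step_linear[OF linear_trace_part] step_linear[OF linear_inner_q])

definition KT :: "nat \<Rightarrow> real" where "KT m = 2 ^ m * (1 + R\<^sup>2) ^ m * R ^ 3 + R\<^sup>2"

lemma KT_nonneg: "0 \<le> KT m" using R_nonneg by (simp add: KT_def)

text \<open>Consistency of the walk with its generator. The Taylor remainder is of order |v|^3, that
  is h^(3/2); in the quadratic term the products of a_i with q cancel by centering, and q with
  itself has order h^2.\<close>

lemma step_expand:
  assumes f: "reg C m f Df Hf" and h: "0 \<le> h" "h \<le> 1"
  shows "\<bar>step h f z - f z - h * gen (Df z) (Hf z)\<bar> \<le> KT m * C * (h * sqrt h) * wt m z"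
proof -
  have C: "0 \<le> C" using wl_nonneg reg_wl(1)[OF f] by blast
  define P where "P = Hf z"
  define Q where "Q x y = blinfun_apply P x \<bullet> y" for x y
  define e where "e i = f (z + v h i) - f z - Df z \<bullet> v h i - 1/2 * Q (v h i) (v h i)" for i
  define K1 where "K1 = 2 ^ m * (1 + R\<^sup>2) ^ m * R ^ 3"
  have eb: "\<bar>e i\<bar> \<le> K1 * C * (h * sqrt h) * wt m z" if i: "i < N" for i
  proof -
    have n: "norm (v h i) \<le> sqrt h * R" using norm_v[OF h i] .
    also have "\<dots> \<le> 1 * R" using h R_nonneg by (intro mult_right_mono) auto
    finally have "norm (v h i) \<le> R" by simp
    then have w: "wt m (v h i) \<le> (1 + R\<^sup>2) ^ m"
      unfolding wt_def by (intro power_mono add_left_mono) (auto intro: power_mono)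
    have "norm (v h i) ^ 3 \<le> (sqrt h * R) ^ 3" using n by (intro power_mono) auto
    also have "\<dots> = h * sqrt h * R ^ 3" using h by (simp add: power3_eq_cube mult_ac)
    finally have n3: "norm (v h i) ^ 3 \<le> h * sqrt h * R ^ 3" .
    have "\<bar>e i\<bar> \<le> C * (2 ^ m * wt m (v h i)) * wt m z * norm (v h i) ^ 3"
      using reg_taylor[OF f, of z "v h i"] by (simp add: e_def Q_def P_def)
    also have "\<dots> \<le> C * (2 ^ m * (1 + R\<^sup>2) ^ m) * wt m z * (h * sqrt h * R ^ 3)"
      using w n3 C wt_pos[of m z] wt_pos[of m "v h i"] by (intro mult_mono mult_left_mono mult_right_mono mult_nonneg_nonneg) auto
    also have "\<dots> = K1 * C * (h * sqrt h) * wt m z" by (simp add: K1_def mult_ac)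
    finally show ?thesis .
  qed
  have Qv: "Q (v h i) (v h i) = h * Q (a i) (a i) + sqrt h * h * Q (a i) q + sqrt h * h * Q q (a i) + h\<^sup>2 * Q q q" for i
  proof -
    have "Q (s *\<^sub>R x + h *\<^sub>R q) (s *\<^sub>R x + h *\<^sub>R q)
       = (s * s) * Q x x + s * h * Q x q + s * h * Q q x + h\<^sup>2 * Q q q" for s x
      by (simp add: Q_def blinfun.add_right blinfun.scaleR_right inner_add_left inner_add_right
        algebra_simps power2_eq_square)
    then show ?thesis using h by (simp add: v_def)
  qed
  have c1: "(\<Sum>i<N. Q (a i) q) = 0" "(\<Sum>i<N. Q q (a i)) = 0"
    by (simp_all add: Q_def inner_sum_left[symmetric] inner_sum_right[symmetric] blinfun.sum_right[symmetric] centered)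
  have sumQ: "(\<Sum>i<N. Q (v h i) (v h i)) = h * (\<Sum>i<N. Q (a i) (a i)) + real N * (h\<^sup>2 * Q q q)"
    by (simp add: Qv sum.distrib sum_distrib_left[symmetric] c1)
  have sumD: "(\<Sum>i<N. Df z \<bullet> v h i) = real N * (h * (q \<bullet> Df z))"
    by (simp add: inner_sum_right[symmetric] sum_v inner_commute)
  have fe: "f (z + v h i) = f z + Df z \<bullet> v h i + 1/2 * Q (v h i) (v h i) + e i" for i
    by (simp add: e_def)
  have "(\<Sum>i<N. f (z + v h i)) = real N * f z + (\<Sum>i<N. Df z \<bullet> v h i) + 1/2 * (\<Sum>i<N. Q (v h i) (v h i)) + (\<Sum>i<N. e i)"
    by (simp add: fe sum.distrib sum_distrib_left)
  then have tot: "step h f z - f z - h * gen (Df z) (Hf z) = 1/2 * (h\<^sup>2 * Q q q) + (1 / real N) * (\<Sum>i<N. e i)"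
  proof -
    define S where "S = (\<Sum>i<N. Q (a i) (a i))"
    have g: "gen (Df z) (Hf z) = q \<bullet> Df z + (1 / real N) * (1/2 * S)"
      by (simp add: gen_def trace_part_def S_def Q_def P_def sum_divide_distrib)
    assume "(\<Sum>i<N. f (z + v h i)) = real N * f z + (\<Sum>i<N. Df z \<bullet> v h i) + 1/2 * (\<Sum>i<N. Q (v h i) (v h i)) + (\<Sum>i<N. e i)"
    then have "(\<Sum>i<N. f (z + v h i)) = real N * f z + real N * (h * (q \<bullet> Df z))
       + 1/2 * (h * S + real N * (h\<^sup>2 * Q q q)) + (\<Sum>i<N. e i)"
      unfolding sumD sumQ S_def .
    then show ?thesis unfolding g step_def using N by (simp add: field_simps)
  qed
  have "\<bar>\<Sum>i<N. e i\<bar> \<le> (\<Sum>i<N. K1 * C * (h * sqrt h) * wt m z)"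
    using eb by (intro order_trans[OF sum_abs] sum_mono) auto
  then have e1: "\<bar>(1 / real N) * (\<Sum>i<N. e i)\<bar> \<le> K1 * C * (h * sqrt h) * wt m z"
    using N by (simp add: abs_mult divide_le_eq mult.commute)
  have "\<bar>Q q q\<bar> \<le> norm P * norm q * norm q"
    using Cauchy_Schwarz_ineq2[of "blinfun_apply P q" q] mult_right_mono[OF norm_blinfun[of P q] norm_ge_zero[of q]]
    by (simp add: Q_def)
  also have "\<dots> \<le> (C * wt m z) * R * R"
    using wl_growth[OF reg_wl(3)[OF f], of z] norm_q_le R_nonneg C wt_pos[of m z]
    by (intro mult_mono) (auto simp: P_def)
  finally have q: "\<bar>Q q q\<bar> \<le> R\<^sup>2 * C * wt m z" by (simp add: power2_eq_square mult_ac)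
  have "h * h \<le> h * sqrt h" using h by (intro mult_left_mono real_le_rsqrt) (auto simp: power2_eq_square mult_left_le)
  then have "h\<^sup>2 * \<bar>Q q q\<bar> \<le> (h * sqrt h) * (R\<^sup>2 * C * wt m z)"
    using q h by (intro mult_mono) (auto simp: power2_eq_square)
  then have "\<bar>1/2 * (h\<^sup>2 * Q q q)\<bar> \<le> R\<^sup>2 * C * (h * sqrt h) * wt m z"
  proof -
    assume 1: "h\<^sup>2 * \<bar>Q q q\<bar> \<le> (h * sqrt h) * (R\<^sup>2 * C * wt m z)"
    have 2: "0 \<le> R\<^sup>2 * C * (h * sqrt h) * wt m z" using h C wt_pos[of m z] by simp
    have "\<bar>1/2 * (h\<^sup>2 * Q q q)\<bar> = 1/2 * (h\<^sup>2 * \<bar>Q q q\<bar>)" by (simp add: abs_mult)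
    moreover have "(h * sqrt h) * (R\<^sup>2 * C * wt m z) = R\<^sup>2 * C * (h * sqrt h) * wt m z" by (simp add: mult_ac)
    ultimately show ?thesis using 1 2 by linarith
  qed
  moreover have "KT m * C * (h * sqrt h) * wt m z
      = K1 * C * (h * sqrt h) * wt m z + R\<^sup>2 * C * (h * sqrt h) * wt m z"
    by (simp add: KT_def K1_def algebra_simps)
  ultimately show ?thesis unfolding tot
    using e1 abs_triangle_ineq[of "1/2 * (h\<^sup>2 * Q q q)" "(1 / real N) * (\<Sum>i<N. e i)"] by linarith
qed

end

section \<open>Supersolutions dominate random walks\<close>

context walk begin

lemma gen_wt:
  "\<exists>l. 0 \<le> l \<and> (\<exists>D H. C2 (wt m) D H \<and> (\<forall>z. gen (D z) (H z) \<le> l * wt m z))"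
proof -
  obtain D H K where c: "C2 (wt m :: 'z \<Rightarrow> real) D H" and
    DH: "\<And>z. norm (D z) \<le> K * wt m z" "\<And>z. norm (H z) \<le> K * wt m z" and K: "0 \<le> K"
    using C2_wt[where 'z='z and m=m] by metis
  have "gen (D z) (H z) \<le> KL * (2 * K) * wt m z" for z
  proof -
    have "gen (D z) (H z) \<le> KL * (norm (D z) + norm (H z))" using gen_bound[of "D z" "H z"] by linarith
    also have "\<dots> \<le> KL * (K * wt m z + K * wt m z)"
      using DH[of z] KL_nonneg by (intro mult_left_mono add_mono) auto
    finally show ?thesis by (simp add: algebra_simps)
  qed
  moreover have "0 \<le> KL * (2 * K)" using KL_nonneg K by simp
  ultimately show ?thesis using c by blast
qed

text \<open>The rate at which a multiple of the weight must grow to be a supersolution of the linear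
  equation, the counterpart in continuous time of \<open>lam\<close>.\<close>

definition mu :: "nat \<Rightarrow> real" where
  "mu m = (SOME l. 0 \<le> l \<and> (\<exists>D H. C2 (wt m) D H \<and> (\<forall>z. gen (D z) (H z) \<le> l * wt m z)))"

lemma mu_nonneg: "0 \<le> mu m"
  and mu_gen: "\<exists>D H. C2 (wt m) D H \<and> (\<forall>z. gen (D z) (H z) \<le> mu m * wt m z)"
  using someI_ex[OF gen_wt[of m]] by (auto simp: mu_def)

text \<open>The barrier \<open>f + (t - t0) L f\<close> replaces the evolution of \<open>f\<close> under the linear equation; being smooth for
  all times, it is a global test function even though the comparison starts at \<open>t0\<close>.\<close>

lemma supersolution_one_step:
  assumes V: "vsub gen (\<lambda>t z. - V t z)"
    and cont: "continuous_on ({0..T} \<times> UNIV) (\<lambda>(t, z). V t z)"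
    and growth: "\<And>t z. 0 \<le> t \<Longrightarrow> t \<le> T \<Longrightarrow> \<bar>V t z\<bar> \<le> Cv * wt m z"
    and f: "reg C m f Df Hf" and g: "reg C m g Dg Hg" and fg: "\<And>z. g z = gen (Df z) (Hf z)"
    and b: "0 \<le> b" "\<And>z. f z - b * wt m z \<le> V t0 z"
    and t0: "0 \<le> t0" and h: "0 < h" "t0 + h < T"
  shows "f z + h * g z - (b + 4 * KL * C * h\<^sup>2) * exp (mu m * h) * wt m z \<le> V (t0 + h) z"
proof -
  have C: "0 \<le> C" using wl_nonneg reg_wl(1)[OF f] by blast
  obtain D\<omega> H\<omega> where \<omega>: "C2 (wt m :: 'z \<Rightarrow> real) D\<omega> H\<omega>"
    and gw: "\<And>z. gen (D\<omega> z) (H\<omega> z) \<le> mu m * wt m z" using mu_gen[of m] by blast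
  \<comment> \<open>The barrier has time derivative g, but its generator is g + (t - t0) L g. Up to
    time t0 + 2 h the mismatch is at most 2 h * 2 KL C times the weight.\<close>
  define \<kappa> where "\<kappa> = 4 * KL * C * h"
  have \<kappa>: "0 \<le> \<kappa>" using KL_nonneg C h by (simp add: \<kappa>_def)
  define \<alpha> where "\<alpha> t = (b + \<kappa> * (t - t0)) * exp (mu m * (t - t0))" for t
  have \<alpha>': "(\<alpha> has_real_derivative \<kappa> * exp (mu m * (t - t0)) + mu m * \<alpha> t) (at t)" for t
    unfolding \<alpha>_def by (auto intro!: derivative_eq_intros simp: algebra_simps)
  have c\<alpha>: "continuous_on UNIV (\<lambda>t. \<kappa> * exp (mu m * (t - t0)) + mu m * \<alpha> t)"
    unfolding \<alpha>_def by (intro continuous_intros)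
  have \<beta>': "((\<lambda>t. - (t - t0)) has_real_derivative - 1) (at t)" for t
    by (auto intro!: derivative_eq_intros)
  have \<gamma>': "((\<lambda>t. - 1) has_real_derivative 0) (at t)" for t :: real by simp
  note test = C12_test_add[OF C12_test_add[OF C12_test_prod[OF \<gamma>' continuous_on_const reg_C2[OF f]]
      C12_test_prod[OF \<beta>' continuous_on_const reg_C2[OF g]]] C12_test_prod[OF \<alpha>' c\<alpha> \<omega>]]
  \<comment> \<open>The comparison holds strictly before the final time, so the horizon must lie
    beyond t0 + h.\<close>
  define T1 where "T1 = min T (t0 + 2 * h)"
  have \<alpha>0: "0 \<le> \<alpha> t" if "t0 \<le> t" for t using that b(1) \<kappa> by (simp add: \<alpha>_def)
  have "- V (t0 + h) z \<le> - 1 * f z + - (t0 + h - t0) * g z + \<alpha> (t0 + h) * wt m z"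
  proof (rule viscosity_comparison_smooth[OF _ _ KL_nonneg V test, where ?t0.0=t0 and T=T1 and C="Cv + C + T * C" and m=m])
    show "gen (D + D') (B + B') \<le> gen D B + gen D' B'" for D D' B B' by (simp add: gen_add)
    show "gen D B \<le> KL * (norm D + norm B)" for D B using gen_bound[of D B] by linarith
    fix t z assume t: "t0 < t" "t < T1"
    have eq: "gen (- 1 *\<^sub>R Df z + - (t - t0) *\<^sub>R Dg z + \<alpha> t *\<^sub>R D\<omega> z) (- 1 *\<^sub>R Hf z + - (t - t0) *\<^sub>R Hg z + \<alpha> t *\<^sub>R H\<omega> z)
      = - 1 * g z + - (t - t0) * gen (Dg z) (Hg z) + \<alpha> t * gen (D\<omega> z) (H\<omega> z)"
      unfolding gen_add gen_scale fg ..
    have "- (t - t0) * gen (Dg z) (Hg z) = (t - t0) * (- gen (Dg z) (Hg z))" by (simp only: minus_mult_commute)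
    also have "\<dots> \<le> (t - t0) * \<bar>gen (Dg z) (Hg z)\<bar>" using t by (intro mult_left_mono) auto
    also have "\<dots> \<le> (2 * h) * (KL * (C * wt m z + C * wt m z))"
    proof (intro mult_mono)
      have "KL * (norm (Dg z) + norm (Hg z)) \<le> KL * (C * wt m z + C * wt m z)"
        using wl_growth[OF reg_wl(2)[OF g], of z] wl_growth[OF reg_wl(3)[OF g], of z] KL_nonneg
        by (intro mult_left_mono add_mono) auto
      then show "\<bar>gen (Dg z) (Hg z)\<bar> \<le> KL * (C * wt m z + C * wt m z)" using gen_bound[of "Dg z" "Hg z"] by linarith
    qed (use t h in \<open>auto simp: T1_def\<close>)
    also have "\<dots> = \<kappa> * wt m z * 1" by (simp add: \<kappa>_def algebra_simps)
    also have "\<dots> \<le> \<kappa> * wt m z * exp (mu m * (t - t0))"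
      using \<kappa> wt_pos[of m z] t mu_nonneg[of m] by (intro mult_left_mono) auto
    finally have 1: "- (t - t0) * gen (Dg z) (Hg z) \<le> \<kappa> * exp (mu m * (t - t0)) * wt m z" by (simp add: mult_ac)
    have "\<alpha> t * gen (D\<omega> z) (H\<omega> z) \<le> \<alpha> t * (mu m * wt m z)"
      using \<alpha>0[of t] t gw by (intro mult_left_mono) auto
    then show "gen (- 1 *\<^sub>R Df z + - (t - t0) *\<^sub>R Dg z + \<alpha> t *\<^sub>R D\<omega> z) (- 1 *\<^sub>R Hf z + - (t - t0) *\<^sub>R Hg z + \<alpha> t *\<^sub>R H\<omega> z)
       \<le> 0 * f z + - 1 * g z + (\<kappa> * exp (mu m * (t - t0)) + mu m * \<alpha> t) * wt m z"
      unfolding eq using 1 by (simp add: algebra_simps)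
  next
    have cs: "continuous_on S (\<lambda>p. k (snd p))" if "continuous_on UNIV k" for k :: "'z \<Rightarrow> real" and S :: "(real \<times> 'z) set"
      by (rule continuous_on_compose2[OF that]) (auto intro!: continuous_intros)
    have cw: "continuous_on UNIV (wt m :: 'z \<Rightarrow> real)" unfolding wt_def by (intro continuous_intros)
    have "continuous_on ({t0..T1} \<times> UNIV) (\<lambda>(t, z). V t z)"
      by (rule continuous_on_subset[OF cont]) (use t0 in \<open>auto simp: T1_def\<close>)
    then show "continuous_on ({t0..T1} \<times> UNIV) (\<lambda>(t, z). - V t z - (- 1 * f z + - (t - t0) * g z + \<alpha> t * wt m z))"
      unfolding case_prod_unfold \<alpha>_def
      using cs[OF wl_continuous[OF reg_wl(1)[OF f]]] cs[OF wl_continuous[OF reg_wl(1)[OF g]]] cs[OF cw]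
      by (intro continuous_intros) auto
  next
    fix t z assume t: "t0 \<le> t" "t \<le> T1"
    have "(t - t0) * g z \<le> T * (C * wt m z)"
    proof -
      have "(t - t0) * g z \<le> (t - t0) * \<bar>g z\<bar>" using t by (intro mult_left_mono) auto
      also have "\<dots> \<le> T * (C * wt m z)"
        using t t0 wl_growth[OF reg_wl(1)[OF g], of z] by (intro mult_mono) (auto simp: T1_def)
      finally show ?thesis .
    qed
    moreover have "\<bar>V t z\<bar> \<le> Cv * wt m z" using growth t t0 by (simp add: T1_def)
    moreover have "\<bar>f z\<bar> \<le> C * wt m z" using wl_growth[OF reg_wl(1)[OF f], of z] by simp
    moreover have "0 \<le> \<alpha> t * wt m z" using \<alpha>0[OF t(1)] wt_pos[of m z] by simp
    ultimately show "- V t z - (- 1 * f z + - (t - t0) * g z + \<alpha> t * wt m z) \<le> (Cv + C + T * C) * wt m z"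
      by (simp add: algebra_simps)
  next
    show "- V t0 z \<le> - 1 * f z + - (t0 - t0) * g z + \<alpha> t0 * wt m z" for z
      using b(2)[of z] by (simp add: \<alpha>_def)
    show "t0 \<le> t0 + h" "t0 + h < T1" using h by (auto simp: T1_def)
  qed (rule t0)
  then show ?thesis by (simp add: \<alpha>_def \<kappa>_def power2_eq_square mult_ac)
qed

definition LL :: "nat \<Rightarrow> real" where "LL m = max (lam m) (mu m)"
definition K2 :: "nat \<Rightarrow> real" where "K2 m = KT m + 4 * KL"

lemma LL: "0 \<le> LL m" "lam m \<le> LL m" "mu m \<le> LL m"
  using mu_nonneg[of m] by (auto simp: LL_def)

lemma K2_nonneg: "0 \<le> K2 m" using KT_nonneg[of m] KL_nonneg by (simp add: K2_def)

text \<open>The Euler step f + h L f is replaced by \<open>step h f\<close>. The two agree up to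
  h^(3/2), but the Euler step uses up two derivatives, whereas averaging preserves the regularity of
  f and can be iterated.\<close>

lemma supersolution_step:
  assumes V: "vsub gen (\<lambda>t z. - V t z)"
    and cont: "continuous_on ({0..T} \<times> UNIV) (\<lambda>(t, z). V t z)"
    and growth: "\<And>t z. 0 \<le> t \<Longrightarrow> t \<le> T \<Longrightarrow> \<bar>V t z\<bar> \<le> Cv * wt m z"
    and f: "reg C m f Df Hf" and g: "reg C m g Dg Hg" and fg: "\<And>z. g z = gen (Df z) (Hf z)"
    and b: "0 \<le> b" "\<And>z. f z - b * wt m z \<le> V t0 z"
    and t0: "0 \<le> t0" and h: "0 < h" "h \<le> 1" "t0 + h < T"
  shows "step h f z - (b + K2 m * C * (h * sqrt h)) * exp (LL m * h) * wt m z \<le> V (t0 + h) z"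
proof -
  have C: "0 \<le> C" using wl_nonneg reg_wl(1)[OF f] by blast
  have 1: "f z + h * g z - (b + 4 * KL * C * h\<^sup>2) * exp (mu m * h) * wt m z \<le> V (t0 + h) z"
    by (rule supersolution_one_step[OF V cont growth f g fg b t0 h(1,3)])
  have "h * h \<le> h * sqrt h"
    using h by (intro mult_left_mono real_le_rsqrt) (auto simp: power2_eq_square mult_left_le)
  then have hh: "4 * KL * C * h\<^sup>2 \<le> 4 * KL * C * (h * sqrt h)"
    using C KL_nonneg by (intro mult_left_mono) (auto simp: power2_eq_square)
  have e: "exp (mu m * h) \<le> exp (LL m * h)" "1 \<le> exp (LL m * h)" using LL[of m] h by auto
  have "(b + 4 * KL * C * h\<^sup>2) * exp (mu m * h) * wt m z \<le> (b + 4 * KL * C * (h * sqrt h)) * exp (LL m * h) * wt m z"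
  proof -
    have "(b + p) * e1 * wt m z \<le> (b + r) * e2 * wt m z" if "p \<le> r" "0 \<le> p" "e1 \<le> e2" "0 \<le> e1" for p r e1 e2 :: real
      using that b(1) wt_pos[of m z] by (intro mult_right_mono mult_mono add_mono) auto
    from this[OF hh _ e(1)] show ?thesis using C KL_nonneg by simp
  qed
  moreover have "KT m * C * (h * sqrt h) * wt m z * 1 \<le> KT m * C * (h * sqrt h) * wt m z * exp (LL m * h)"
    using e C KT_nonneg[of m] h wt_pos[of m z] by (intro mult_left_mono) auto
  moreover have "step h f z \<le> f z + h * g z + KT m * C * (h * sqrt h) * wt m z"
    using step_expand[OF f, of h z] h by (simp add: fg)
  moreover have "(b + K2 m * C * (h * sqrt h)) * exp (LL m * h) * wt m z
     = (b + 4 * KL * C * (h * sqrt h)) * exp (LL m * h) * wt m z + KT m * C * (h * sqrt h) * wt m z * exp (LL m * h)"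
    by (simp add: K2_def algebra_simps)
  ultimately show ?thesis using 1 by linarith
qed

lemma iter_reg:
  assumes "reg C m f Df Hf" "0 \<le> h" "h \<le> 1"
  shows "reg (exp (lam m * (real j * h)) * C) m ((step h ^^ j) f) ((step h ^^ j) Df) ((step h ^^ j) Hf)"
proof (induction j)
  case (Suc j)
  have "exp (lam m * h) * (exp (lam m * (real j * h)) * C) = exp (lam m * (real (Suc j) * h)) * C"
    by (simp add: exp_add[symmetric] algebra_simps)
  then show ?case using step_reg[OF Suc assms(2,3)] by (simp only: funpow.simps o_apply)
qed (use assms in simp)

text \<open>The walk averages translates and the generator is linear with constant coefficients.
  Thus the generator of an iterate is an iterate of the generator and stays regular, as
  \<open>supersolution_step\<close> demands.\<close>

lemma iter_gen: "(step h ^^ j) (\<lambda>z. gen (Df z) (Hf z)) z = gen ((step h ^^ j) Df z) ((step h ^^ j) Hf z)"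
proof (induction j arbitrary: z)
  case (Suc j)
  have "(step h ^^ j) (\<lambda>z. gen (Df z) (Hf z)) = (\<lambda>z. gen ((step h ^^ j) Df z) ((step h ^^ j) Hf z))"
    using Suc by blast
  then show ?case by (simp add: step_gen)
qed simp

lemma iter_add: "(step h ^^ j) (\<lambda>z. f z + g z) z = (step h ^^ j) f z + (step h ^^ j) g z"
proof (induction j arbitrary: z)
  case (Suc j)
  have "(step h ^^ j) (\<lambda>z. f z + g z) = (\<lambda>z. (step h ^^ j) f z + (step h ^^ j) g z)" using Suc by blast
  then show ?case by (simp add: step_add)
qed simp

lemma iter_cmult: "(step h ^^ j) (\<lambda>z. c * f z) z = c * (step h ^^ j) f z" for c :: real
proof (induction j arbitrary: z)
  case (Suc j)
  have "(step h ^^ j) (\<lambda>z. c * f z) = (\<lambda>z. c * (step h ^^ j) f z)" using Suc by blast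
  then show ?case by (simp add: step_cmult)
qed simp

lemma iter_mono: "(\<And>z. f z \<le> g z) \<Longrightarrow> (step h ^^ j) f z \<le> (step h ^^ j) g z" for f g :: "'z \<Rightarrow> real"
  by (induction j arbitrary: z) (auto intro: step_mono)

lemma iter_wt:
  assumes "0 \<le> h" "h \<le> 1"
  shows "(step h ^^ j) (wt m) z \<le> exp (lam m * (real j * h)) * wt m z"
proof (induction j arbitrary: z)
  case (Suc j)
  have "(step h ^^ Suc j) (wt m) z \<le> step h (\<lambda>z. exp (lam m * (real j * h)) * wt m z) z"
    using Suc by (auto intro: step_mono)
  also have "\<dots> \<le> exp (lam m * (real j * h)) * (exp (lam m * h) * wt m z)"
    unfolding step_cmult by (intro mult_left_mono lam assms) auto
  also have "\<dots> = exp (lam m * (real (Suc j) * h)) * wt m z" by (simp add: exp_add[symmetric] algebra_simps)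
  finally show ?case .
qed simp

text \<open>The regularity constants of all iterates stay below C exp(LL m * s), so the loss per
  step has one bound for all j. After n = s / h steps the accumulated loss is of order sqrt
  h.\<close>

lemma supersolution_iterate:
  assumes V: "vsub gen (\<lambda>t z. - V t z)"
    and cont: "continuous_on ({0..T} \<times> UNIV) (\<lambda>(t, z). V t z)"
    and growth: "\<And>t z. 0 \<le> t \<Longrightarrow> t \<le> T \<Longrightarrow> \<bar>V t z\<bar> \<le> Cv * wt m z"
    and f: "reg C m f Df Hf" and g: "reg C m g Dg Hg" and fg: "\<And>z. g z = gen (Df z) (Hf z)"
    and b: "0 \<le> b" "\<And>z. f z - b * wt m z \<le> V t0 z"
    and t0: "0 \<le> t0" and h: "0 < h" "h \<le> 1" and s: "real n * h = s" "t0 + s < T"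
    and j: "j \<le> n"
  shows "(step h ^^ j) f z - (b + real j * (K2 m * (C * exp (LL m * s)) * (h * sqrt h))) * exp (LL m * (real j * h)) * wt m z
     \<le> V (t0 + real j * h) z"
  using j
proof (induction j arbitrary: z)
  case 0 then show ?case using b(2)[of z] by simp
next
  case (Suc j)
  have C: "0 \<le> C" using wl_nonneg reg_wl(1)[OF f] by blast
  define M where "M = K2 m * (C * exp (LL m * s)) * (h * sqrt h)"
  have M: "0 \<le> M" using K2_nonneg C h by (simp add: M_def)
  define Cj where "Cj = exp (lam m * (real j * h)) * C"
  define bj where "bj = (b + real j * M) * exp (LL m * (real j * h))"
  have jh: "real j * h \<le> s" "real (Suc j) * h \<le> s"
    using Suc.prems h s mult_right_mono[of "real j" "real n" h] mult_right_mono[of "real (Suc j)" "real n" h] by auto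
  have "lam m * (real j * h) \<le> LL m * s" using LL[of m] jh(1) h by (intro mult_mono) auto
  then have "Cj \<le> C * exp (LL m * s)" using C by (simp add: Cj_def mult.commute mult_left_mono)
  then have MM: "K2 m * Cj * (h * sqrt h) \<le> M"
    unfolding M_def using K2_nonneg h by (intro mult_right_mono mult_left_mono) auto
  have fgj: "(step h ^^ j) g z = gen ((step h ^^ j) Df z) ((step h ^^ j) Hf z)" for z
    using iter_gen[of j h Df Hf z] fg by (metis (no_types, lifting) ext)
  have bj: "0 \<le> bj" using b(1) M by (simp add: bj_def)
  have step: "step h ((step h ^^ j) f) z - (bj + K2 m * Cj * (h * sqrt h)) * exp (LL m * h) * wt m z \<le> V (t0 + real j * h + h) z"
  proof (rule supersolution_step[OF V cont growth _ _ fgj bj])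
    show "reg Cj m ((step h ^^ j) f) ((step h ^^ j) Df) ((step h ^^ j) Hf)"
      "reg Cj m ((step h ^^ j) g) ((step h ^^ j) Dg) ((step h ^^ j) Hg)"
      unfolding Cj_def using iter_reg f g h by auto
    show "(step h ^^ j) f z - bj * wt m z \<le> V (t0 + real j * h) z" for z
      using Suc.IH[of z] Suc.prems by (simp add: bj_def M_def)
    show "t0 + real j * h + h < T" using jh s by (simp add: algebra_simps)
  qed (use t0 h in auto)
  have "(bj + K2 m * Cj * (h * sqrt h)) * exp (LL m * h) \<le> (bj + M * exp (LL m * (real j * h))) * exp (LL m * h)"
  proof (intro mult_right_mono add_left_mono)
    have "M * 1 \<le> M * exp (LL m * (real j * h))" using M LL[of m] h by (intro mult_left_mono) auto
    then show "K2 m * Cj * (h * sqrt h) \<le> M * exp (LL m * (real j * h))" using MM by linarith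
  qed auto
  also have "\<dots> = (b + real (Suc j) * M) * (exp (LL m * (real j * h)) * exp (LL m * h))"
    by (simp add: bj_def algebra_simps)
  also have "exp (LL m * (real j * h)) * exp (LL m * h) = exp (LL m * (real (Suc j) * h))"
    by (simp add: exp_add[symmetric] algebra_simps)
  finally have "(bj + K2 m * Cj * (h * sqrt h)) * exp (LL m * h) * wt m z
     \<le> (b + real (Suc j) * M) * exp (LL m * (real (Suc j) * h)) * wt m z"
    using wt_pos[of m z] by (intro mult_right_mono) auto
  then show ?case using step by (simp add: M_def algebra_simps)
qed

text \<open>V is only Lipschitz in space, while the iteration needs a regular start, so V at time t0
  is replaced by a mollification. The choices are made in the order \<epsilon>, \<delta>, n. That n0
  is uniform in t0 and z is what allows averaging over translates later.\<close>

lemma supersolution_superharmonic: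
  assumes V: "vsub gen (\<lambda>t z. - V t z)"
    and vb: "fam Cv m vb" "\<And>t z. 0 \<le> t \<Longrightarrow> t \<le> T \<Longrightarrow> V t z = vb (t, z)"
    and s: "0 < s" and \<epsilon>: "0 < \<epsilon>"
  shows "\<exists>n0>0. \<forall>n\<ge>n0. \<forall>t0 z. 0 \<le> t0 \<longrightarrow> t0 + s < T \<longrightarrow>
     (step (s / real n) ^^ n) (\<lambda>z. vb (t0, z)) z - \<epsilon> * wt m z \<le> vb (t0 + s, z)"
proof -
  have cont: "continuous_on ({0..T} \<times> UNIV) (\<lambda>(t, z). V t z)"
    by (rule continuous_on_eq[OF continuous_on_subset[OF fam_cont[OF vb(1)]]]) (use vb(2) in auto)
  have growth: "\<bar>V t z\<bar> \<le> Cv * wt m z" if "0 \<le> t" "t \<le> T" for t z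
    using wl_growth[OF fam_wl[OF vb(1), of t], of z] vb(2)[OF that] by simp
  have Cv: "0 \<le> Cv" using fam_nonneg[OF vb(1)] .
  obtain Km where Km: "0 \<le> Km" and close: "\<And>\<delta> t z. 0 \<le> \<delta> \<Longrightarrow> \<delta> \<le> 1 \<Longrightarrow> \<bar>moll 4 \<delta> vb (t, z) - vb (t, z)\<bar> \<le> Km * \<delta> * Cv * wt m z"
    using moll_close[where m=m and n=4 and 'z='z] vb(1) by blast
  define X where "X = exp (LL m * s)"
  have X: "1 \<le> X" using LL[of m] s by (simp add: X_def)
  \<comment> \<open>The mollification error b is paid twice, as the initial defect and again when
    the smoothed datum is exchanged for \<open>vb\<close> after n steps, each time with the growth
    factor X. With \<epsilon> / 4 for each, half of \<epsilon> remains for the steps.\<close>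
  define \<delta> where "\<delta> = min 1 (\<epsilon> / (4 * (Km * Cv * X + 1)))"
  have KCX: "0 \<le> Km * Cv * X" using Km Cv X by simp
  have \<delta>: "0 < \<delta>" "\<delta> \<le> 1" using \<epsilon> KCX by (auto simp: \<delta>_def)
  define b where "b = Km * \<delta> * Cv"
  have b: "0 \<le> b" using Km \<delta> Cv by (simp add: b_def)
  have bX: "b * X \<le> \<epsilon> / 4"
  proof -
    have "b * X = \<delta> * (Km * Cv * X)" by (simp add: b_def)
    also have "\<dots> \<le> \<epsilon> / (4 * (Km * Cv * X + 1)) * (Km * Cv * X + 1)"
      using KCX \<epsilon> \<delta> by (intro mult_mono) (auto simp: \<delta>_def)
    also have "\<dots> = \<epsilon> / 4" using KCX by (simp add: field_simps)
    finally show ?thesis .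
  qed
  let ?F = "moll 4 \<delta> vb"
  \<comment> \<open>Four derivatives: two for the datum and two more for its generator, which has to
    be regular itself.\<close>
  obtain K4 where "smooth 4 (K4 * Cv) m ?F" using moll_smooth[OF \<delta>(1), of m 4] vb(1) by blast
  then have F4: "smooth (Suc (Suc 2)) (K4 * Cv) m ?F" by (simp add: numeral_eq_Suc)
  obtain Df Hf Cf where rf0: "\<And>t. reg Cf m (\<lambda>z. ?F (t, z)) (\<lambda>z. Df (t, z)) (\<lambda>z. Hf (t, z))"
    and sm: "\<And>l1 l2. linear l1 \<Longrightarrow> linear l2 \<Longrightarrow> \<exists>B. smooth 2 B m (\<lambda>p. l1 (Df p) + l2 (Hf p))"
    by (rule smooth_regular[OF F4]) (rule that; assumption)
  define g where "g p = gen (Df p) (Hf p)" for p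
  obtain C1 where "smooth 2 C1 m g"
    using sm[OF linear_inner_q linear_trace_part] unfolding g_def gen_def by blast
  then have g2: "smooth (Suc (Suc 0)) C1 m g" by (simp add: numeral_eq_Suc)
  obtain Dg Hg Cg where rg0: "\<And>t. reg Cg m (\<lambda>z. g (t, z)) (\<lambda>z. Dg (t, z)) (\<lambda>z. Hg (t, z))"
    by (rule smooth_regular[OF g2]) (rule that; assumption)
  define C where "C = max Cf Cg"
  have rf: "reg C m (\<lambda>z. ?F (t, z)) (\<lambda>z. Df (t, z)) (\<lambda>z. Hf (t, z))"
    and rg: "reg C m (\<lambda>z. g (t, z)) (\<lambda>z. Dg (t, z)) (\<lambda>z. Hg (t, z))" for t
    using reg_weaken[OF rf0] reg_weaken[OF rg0] by (auto simp: C_def)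
  have C: "0 \<le> C" using wl_nonneg reg_wl(1)[OF rf] by blast
  define Y where "Y = K2 m * (C * X) * X"
  have Y: "0 \<le> Y" using K2_nonneg C X by (simp add: Y_def)
  define \<eta> where "\<eta> = \<epsilon> / (2 * (s * Y + 1))"
  have sY: "0 \<le> s * Y" using s Y by simp
  have \<eta>: "0 < \<eta>" using sY \<epsilon> by (simp add: \<eta>_def)
  \<comment> \<open>The two summands ensure h \<le> 1 and sqrt h \<le> \<eta>.\<close>
  obtain n0 :: nat where n0: "s + s / \<eta>\<^sup>2 < real n0" using reals_Archimedean2 by blast
  have pos: "0 < s / \<eta>\<^sup>2" using s \<eta> by simp
  then have n0pos: "0 < n0" using n0 s by (metis add_pos_pos of_nat_0_less_iff order_less_trans)
  show ?thesis
  proof (intro exI[of _ n0] conjI n0pos allI impI)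
    fix n t0 and z :: 'z assume n: "n0 \<le> n" and t0: "0 \<le> t0" "t0 + s < T"
    define h where "h = s / real n"
    have nn: "s + s / \<eta>\<^sup>2 < real n" using n n0 by simp
    then have npos: "0 < real n" using s pos by linarith
    have h: "0 < h" "h \<le> 1" "real n * h = s" using s npos nn pos by (auto simp: h_def divide_le_eq)
    have sh: "sqrt h \<le> \<eta>"
    proof -
      have "s / \<eta>\<^sup>2 \<le> real n" using nn s by linarith
      then have "h \<le> \<eta>\<^sup>2" using npos \<eta> by (simp add: h_def field_simps)
      then show ?thesis using \<eta> by (simp add: real_le_lsqrt)
    qed
    have b2: "\<bar>?F (t, z) - vb (t, z)\<bar> \<le> b * wt m z" for t z
      using close[of \<delta> t z] \<delta> by (simp add: b_def)
    have Vt0: "V t0 z = vb (t0, z)" for z using vb(2) t0 s by simp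
    have "(step h ^^ n) (\<lambda>z. ?F (t0, z)) z - (b + real n * (K2 m * (C * exp (LL m * s)) * (h * sqrt h))) * exp (LL m * (real n * h)) * wt m z
     \<le> V (t0 + real n * h) z"
    proof (rule supersolution_iterate[OF V cont growth rf rg _ b _ t0(1) h t0(2) order_refl])
      show "g (t0, z) = gen (Df (t0, z)) (Hf (t0, z))" for z by (simp add: g_def)
      show "?F (t0, z) - b * wt m z \<le> V t0 z" for z using b2[of t0 z] Vt0[of z] by linarith
    qed auto
    moreover have "V (t0 + real n * h) z = vb (t0 + s, z)" using vb(2) t0 s h by simp
    moreover have "(step h ^^ n) (\<lambda>z. vb (t0, z)) z - b * X * wt m z \<le> (step h ^^ n) (\<lambda>z. ?F (t0, z)) z"
    proof -
      have "(step h ^^ n) (\<lambda>z. vb (t0, z)) z \<le> (step h ^^ n) (\<lambda>z. ?F (t0, z) + b * wt m z) z"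
        by (rule iter_mono) (use b2[of t0] in \<open>auto simp: abs_le_iff algebra_simps\<close>)
      also have "\<dots> = (step h ^^ n) (\<lambda>z. ?F (t0, z)) z + b * (step h ^^ n) (wt m) z"
        unfolding iter_add iter_cmult ..
      also have "(step h ^^ n) (wt m) z \<le> X * wt m z"
      proof -
        have "exp (lam m * s) \<le> X" using LL[of m] s by (simp add: X_def)
        then have "exp (lam m * (real n * h)) * wt m z \<le> X * wt m z" using h wt_pos[of m z] by (simp add: mult_right_mono)
        then show ?thesis using iter_wt[of h n m z] h by linarith
      qed
      finally show ?thesis using b by (simp add: mult_left_mono mult.assoc)
    qed
    moreover have "(b + real n * (K2 m * (C * exp (LL m * s)) * (h * sqrt h))) * exp (LL m * (real n * h)) * wt m z + b * X * wt m z
       \<le> \<epsilon> * wt m z"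
    proof -
      have "(b + real n * (K2 m * (C * exp (LL m * s)) * (h * sqrt h))) * exp (LL m * (real n * h)) + b * X
        = 2 * (b * X) + s * sqrt h * Y"
        using h(3)[symmetric] by (simp add: X_def Y_def algebra_simps)
      also have "s * sqrt h * Y \<le> \<eta> * (s * Y + 1)"
      proof -
        have "s * sqrt h * Y = sqrt h * (s * Y)" by simp
        also have "\<dots> \<le> \<eta> * (s * Y + 1)" using sh sY \<eta> h by (intro mult_mono) auto
        finally show ?thesis .
      qed
      also have "\<eta> * (s * Y + 1) = \<epsilon> / 2" using sY by (simp add: \<eta>_def field_simps)
      finally have "(b + real n * (K2 m * (C * exp (LL m * s)) * (h * sqrt h))) * exp (LL m * (real n * h)) + b * X \<le> \<epsilon>"
        using bX by linarith
      then show ?thesis using wt_pos[of m z] by (simp add: distrib_right[symmetric] mult_right_mono)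
    qed
    ultimately show "(step (s / real n) ^^ n) (\<lambda>z. vb (t0, z)) z - \<epsilon> * wt m z \<le> vb (t0 + s, z)"
      unfolding h_def[symmetric] by linarith
  qed
qed

end

section \<open>Averages of superharmonic functions\<close>

context walk begin

definition stepf :: "real \<Rightarrow> (real \<times> 'z \<Rightarrow> real) \<Rightarrow> real \<times> 'z \<Rightarrow> real" where
  "stepf h f p = (1 / real N) * (\<Sum>i<N. f (p + (0, v h i)))"

lemma stepf_iter: "(stepf h ^^ n) f (t, z) = (step h ^^ n) (\<lambda>z. f (t, z)) z"
proof (induction n arbitrary: z)
  case (Suc n)
  then show ?case by (simp add: stepf_def step_def plus_prod_def)
qed simp

lemma stepf_continuous: "continuous_on UNIV f \<Longrightarrow> continuous_on UNIV ((stepf h ^^ n) f)"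
proof (induction n)
  case (Suc n)
  then have "continuous_on UNIV (\<lambda>p. (1 / real N) * (\<Sum>i<N. (stepf h ^^ n) f (p + (0, v h i))))"
    by (intro continuous_intros cont_shift) auto
  then show ?case by (simp add: stepf_def[abs_def])
qed simp

lemma avg_sum:
  assumes "\<And>i. i \<in> I \<Longrightarrow> continuous_on UNIV (f i)" "finite I"
  shows "avg e (\<lambda>p. \<Sum>i\<in>I. f i p) p = (\<Sum>i\<in>I. avg e (f i) p)"
  unfolding avg_def using assms by (intro integral_sum avg_integrable) auto

lemma avg_stepf:
  assumes "continuous_on UNIV f" shows "avg e (stepf h f) = stepf h (avg e f)"
proof
  fix p
  have "avg e (\<lambda>p. \<Sum>i<N. f (p + (0, v h i))) p = (\<Sum>i<N. avg e (\<lambda>p. f (p + (0, v h i))) p)"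
    by (intro avg_sum cont_shift assms) auto
  then show "avg e (stepf h f) p = stepf h (avg e f) p"
    unfolding stepf_def[abs_def] avg_cmult by (simp add: avg_shift)
qed

lemma avg_stepf_iter:
  assumes "continuous_on UNIV f" shows "avg e ((stepf h ^^ n) f) = (stepf h ^^ n) (avg e f)"
  by (induction n) (simp_all add: avg_stepf stepf_continuous assms)

lemma avg_wt: "avg e (\<lambda>p. wt m (snd p)) (t, z) \<le> shift_const m e * wt m z" for e :: "real \<times> 'z"
proof -
  have "continuous_on UNIV (\<lambda>p :: real \<times> 'z. wt m (snd p))" unfolding wt_def by (intro continuous_intros)
  moreover have "\<bar>wt m (snd ((t, z) + \<tau> *\<^sub>R e))\<bar> \<le> shift_const m e * wt m z" if "0 \<le> \<tau>" "\<tau> \<le> 1" for \<tau>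
    using wt_shift_le[OF norm_scale_le[OF that], of m z "snd e"] wt_pos[of m "z + \<tau> *\<^sub>R snd e"]
    by (simp add: shift_const_def)
  ultimately have "\<bar>avg e (\<lambda>p. wt m (snd p)) (t, z)\<bar> \<le> shift_const m e * wt m z"
    by (intro avg_bound) auto
  then show ?thesis by simp
qed

text \<open>The error, the step size and the number of steps are parameters, instead of a limit,
  because a single inequality valid at all points of a time range can be integrated over
  translates.\<close>

definition superharm :: "real \<Rightarrow> nat \<Rightarrow> real \<Rightarrow> real \<Rightarrow> nat \<Rightarrow> real \<Rightarrow> (real \<times> 'z \<Rightarrow> real) \<Rightarrow> bool" where
  "superharm S m \<epsilon> h n s f \<longleftrightarrow> (\<forall>t z. 0 \<le> t \<longrightarrow> t < S \<longrightarrow>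
     (stepf h ^^ n) f (t, z) - \<epsilon> * wt m z \<le> f (t + s, z))"

text \<open>The walk commutes with the average, so the inequality is simply integrated along the
  segment. A segment pointing forward in time looks ahead by \<open>fst e\<close>, which shortens
  the time range.\<close>

lemma superharm_avg:
  assumes f: "superharm S m \<epsilon> h n s f" "continuous_on UNIV f" and e: "0 \<le> fst e" and \<epsilon>: "0 \<le> \<epsilon>"
  shows "superharm (S - fst e) m (shift_const m e * \<epsilon>) h n s (avg e f)"
  unfolding superharm_def
proof (intro allI impI)
  fix t and z :: 'z assume t: "0 \<le> t" "t < S - fst e"
  have cw: "continuous_on UNIV (\<lambda>p :: real \<times> 'z. \<epsilon> * wt m (snd p))" unfolding wt_def by (intro continuous_intros)
  have cF: "continuous_on UNIV ((stepf h ^^ n) f)" by (rule stepf_continuous[OF f(2)])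
  have "avg e (\<lambda>p. (stepf h ^^ n) f p - \<epsilon> * wt m (snd p)) (t, z) \<le> avg e (\<lambda>p. f (p + (s, 0))) (t, z)"
  proof (rule avg_mono)
    fix \<tau> :: real assume \<tau>: "0 \<le> \<tau>" "\<tau> \<le> 1"
    have "\<tau> * fst e \<le> 1 * fst e" using \<tau> e by (intro mult_right_mono) auto
    then have "0 \<le> t + \<tau> * fst e" "t + \<tau> * fst e < S" using t e \<tau> by auto
    then show "(stepf h ^^ n) f ((t, z) + \<tau> *\<^sub>R e) - \<epsilon> * wt m (snd ((t, z) + \<tau> *\<^sub>R e)) \<le> f ((t, z) + \<tau> *\<^sub>R e + (s, 0))"
      using f(1) by (simp add: superharm_def plus_prod_def)
  qed (intro continuous_on_diff cF cw cont_shift f(2))+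
  moreover have "avg e (\<lambda>p. (stepf h ^^ n) f p - \<epsilon> * wt m (snd p)) (t, z)
      = (stepf h ^^ n) (avg e f) (t, z) - \<epsilon> * avg e (\<lambda>p. wt m (snd p)) (t, z)"
    by (simp add: avg_diff[OF cF cw] avg_cmult avg_stepf_iter[OF f(2)])
  moreover have "avg e (\<lambda>p. f (p + (s, 0))) (t, z) = avg e f (t + s, z)"
    using avg_shift[of e f "(s, 0)" "(t, z)"] by simp
  moreover have "\<epsilon> * avg e (\<lambda>p. wt m (snd p)) (t, z) \<le> shift_const m e * \<epsilon> * wt m z"
    using mult_left_mono[OF avg_wt[of e m t z] \<epsilon>] by (simp add: mult_ac)
  ultimately show "(stepf h ^^ n) (avg e f) (t, z) - shift_const m e * \<epsilon> * wt m z \<le> avg e f (t + s, z)"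
    by linarith
qed

lemma superharm_avgs:
  assumes "\<forall>e\<in>set es. fst e = 0"
  shows "\<exists>K>0. \<forall>\<epsilon> h n s f. 0 \<le> \<epsilon> \<longrightarrow> superharm S m \<epsilon> h n s f \<longrightarrow> continuous_on UNIV f \<longrightarrow>
    superharm S m (K * \<epsilon>) h n s (avgs es f)"
  using assms
proof (induction es)
  case Nil show ?case by (rule exI[of _ 1]) auto
next
  case (Cons e es)
  then obtain K where K: "0 < K" "\<And>\<epsilon> h n s f. 0 \<le> \<epsilon> \<Longrightarrow> superharm S m \<epsilon> h n s f \<Longrightarrow> continuous_on UNIV f \<Longrightarrow>
    superharm S m (K * \<epsilon>) h n s (avgs es f)" by auto
  show ?case
  proof (intro exI[of _ "shift_const m e * K"] conjI allI impI)
    show "0 < shift_const m e * K" using K shift_const_ge_1[of m e] by simp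
    fix \<epsilon> h n s f assume *: "0 \<le> (\<epsilon>::real)" "superharm S m \<epsilon> h n s f" "continuous_on UNIV f"
    have "superharm (S - fst e) m (shift_const m e * (K * \<epsilon>)) h n s (avg e (avgs es f))"
      using * K Cons.prems by (intro superharm_avg avgs_continuous) auto
    then show "superharm S m (shift_const m e * K * \<epsilon>) h n s (avgs (e # es) f)"
      using Cons.prems by (simp add: mult.assoc)
  qed
qed

lemma superharm_moll:
  "\<exists>K>0. \<forall>\<epsilon> h n s f. 0 \<le> \<epsilon> \<longrightarrow> superharm S m \<epsilon> h n s f \<longrightarrow> continuous_on UNIV f \<longrightarrow>
    superharm S m (K * \<epsilon>) h n s (moll k \<delta> f)"
  unfolding moll_def by (rule superharm_avgs) (auto simp: set_dirs)

section \<open>From the walk inequality back to the generator\<close>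

lemma step_translate: "step h (\<lambda>z. f (z + d)) z = step h f (z + d)"
  by (simp add: step_def ac_simps)

lemma step_const: "step h (\<lambda>z. c) z = c" for c :: real
  using N by (simp add: step_def)

lemma iter_translate: "(step h ^^ j) (\<lambda>z. f (z + d)) z = (step h ^^ j) f (z + d)"
proof (induction j arbitrary: z)
  case (Suc j)
  have "(step h ^^ j) (\<lambda>z. f (z + d)) = (\<lambda>z. (step h ^^ j) f (z + d))" using Suc by blast
  then show ?case by (simp add: step_translate)
qed simp

lemma iter_const: "(step h ^^ j) (\<lambda>z. c) z = c" for c :: real
proof (induction j arbitrary: z)
  case (Suc j)
  have "(step h ^^ j) (\<lambda>z. c) = (\<lambda>z. c)" using Suc by blast
  then show ?case by (simp add: step_const)
qed simp

lemma iter_lower: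
  assumes f: "reg C m f Df Hf" and h: "0 \<le> h" "h \<le> 1"
    and g: "\<And>z. c - K * (wt k (z - z0) - 1) \<le> gen (Df z) (Hf z)" and K: "0 \<le> K"
    and s: "real n * h = s" and j: "j \<le> n"
  shows "f z0 + real j * (h * (c - K * (exp (lam k * s) - 1)) - KT m * C * (h * sqrt h) * (exp (lam m * s) * wt m z0))
    \<le> (step h ^^ j) f z0"
  using j
proof (induction j)
  case (Suc j)
  have C: "0 \<le> C" using wl_nonneg reg_wl(1)[OF f] by blast
  define \<kappa> where "\<kappa> = KT m * C * (h * sqrt h)"
  have \<kappa>: "0 \<le> \<kappa>" using KT_nonneg[of m] C h by (simp add: \<kappa>_def)
  have jh: "real j * h \<le> s" "0 \<le> real j * h" using Suc.prems h s mult_right_mono[of "real j" "real n" h] by auto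
  define w where "w z = wt k (z + (- z0))" for z
  define c1 where "c1 = h * (c + K)"
  define X where "X = h * (c - K * (exp (lam k * s) - 1)) - KT m * C * (h * sqrt h) * (exp (lam m * s) * wt m z0)"
  have "(step h ^^ j) (\<lambda>z. f z + (c1 + ((- (h * K)) * w z + (- \<kappa>) * wt m z))) z0 \<le> (step h ^^ j) (step h f) z0"
  proof (rule iter_mono)
    fix z
    have "h * (c - K * (wt k (z - z0) - 1)) \<le> h * gen (Df z) (Hf z)" using g h by (intro mult_left_mono) auto
    moreover have "f z + h * gen (Df z) (Hf z) - \<kappa> * wt m z \<le> step h f z"
      using step_expand[OF f h, of z] unfolding \<kappa>_def by linarith
    moreover have "f z + (c1 + ((- (h * K)) * w z + (- \<kappa>) * wt m z)) = f z + h * (c - K * (wt k (z - z0) - 1)) - \<kappa> * wt m z"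
      by (simp add: c1_def w_def algebra_simps)
    ultimately show "f z + (c1 + ((- (h * K)) * w z + (- \<kappa>) * wt m z)) \<le> step h f z" by linarith
  qed
  then have "(step h ^^ j) f z0 + (c1 + ((- (h * K)) * (step h ^^ j) w z0 + (- \<kappa>) * (step h ^^ j) (wt m) z0))
     \<le> (step h ^^ Suc j) f z0"
    unfolding iter_add iter_cmult iter_const by (simp add: funpow_swap1)
  then have "(step h ^^ j) f z0 + c1 - h * K * (step h ^^ j) w z0 - \<kappa> * (step h ^^ j) (wt m) z0 \<le> (step h ^^ Suc j) f z0"
    by (simp del: funpow.simps add: add.assoc)
  moreover have "h * K * (step h ^^ j) w z0 \<le> h * K * exp (lam k * s)"
  proof -
    \<comment> \<open>By translation invariance the walk may start at 0, where the weight is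
      1.\<close>
    have "(step h ^^ j) w z0 = (step h ^^ j) (wt k) 0"
      unfolding w_def iter_translate by simp
    also have "\<dots> \<le> exp (lam k * (real j * h))" using iter_wt[OF h, of j k 0] by simp
    also have "\<dots> \<le> exp (lam k * s)" using lam(1)[of k] jh by (simp add: mult_left_mono)
    finally show ?thesis using h K by (intro mult_left_mono) auto
  qed
  moreover have "\<kappa> * (step h ^^ j) (wt m) z0 \<le> \<kappa> * (exp (lam m * s) * wt m z0)"
  proof -
    have "exp (lam m * (real j * h)) \<le> exp (lam m * s)" using lam(1)[of m] jh by (simp add: mult_left_mono)
    then have "exp (lam m * (real j * h)) * wt m z0 \<le> exp (lam m * s) * wt m z0"
      using wt_pos[of m z0] by (intro mult_right_mono) auto
    then show ?thesis using iter_wt[OF h, of j m z0] \<kappa> by (intro mult_left_mono) auto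
  qed
  moreover have "X = c1 - h * K * exp (lam k * s) - \<kappa> * (exp (lam m * s) * wt m z0)"
    by (simp add: X_def c1_def \<kappa>_def algebra_simps)
  ultimately have "(step h ^^ j) f z0 + X \<le> (step h ^^ Suc j) f z0" by linarith
  moreover have "f z0 + real j * X \<le> (step h ^^ j) f z0" using Suc.IH Suc.prems by (simp add: X_def)
  moreover have "real (Suc j) * X = real j * X + X" by (simp add: algebra_simps)
  ultimately show ?case unfolding X_def[symmetric] by linarith
qed simp

text \<open>Young's inequality trades |d| for \<epsilon> plus a multiple of |d|^2. The latter is
  controlled by the excess of the weight over 1, whose mean along a walk started at d = 0 tends to 0
  with the elapsed time.\<close>

lemma wt_norm_small:
  assumes "0 < \<epsilon>"
  shows "wt m d * norm d \<le> \<epsilon> + (\<epsilon> + 1 / \<epsilon>) * (wt (Suc m) d - 1)"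
proof -
  have w: "wt m d \<le> wt (Suc m) d" by (rule wt_mono) simp
  have "0 \<le> (norm d - \<epsilon>)\<^sup>2" by simp
  then have "2 * \<epsilon> * norm d \<le> (norm d)\<^sup>2 + \<epsilon>\<^sup>2" by (simp add: power2_diff algebra_simps)
  moreover have "0 \<le> \<epsilon> * norm d" using assms by simp
  ultimately have "\<epsilon> * norm d \<le> (norm d)\<^sup>2 + \<epsilon>\<^sup>2" by linarith
  then have "norm d \<le> \<epsilon> + (1 / \<epsilon>) * (norm d)\<^sup>2" using assms by (simp add: field_simps power2_eq_square)
  then have "wt m d * norm d \<le> wt m d * (\<epsilon> + (1 / \<epsilon>) * (norm d)\<^sup>2)"
    using wt_pos[of m d] by (intro mult_left_mono) auto
  also have "\<dots> = \<epsilon> * wt m d + (1 / \<epsilon>) * (wt (Suc m) d - wt m d)" by (simp add: wt_Suc algebra_simps)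
  also have "\<dots> \<le> \<epsilon> * wt (Suc m) d + (1 / \<epsilon>) * (wt (Suc m) d - 1)"
    using w wt_ge_1[of m d] assms by (intro add_mono mult_left_mono) auto
  also have "\<dots> = \<epsilon> + (\<epsilon> + 1 / \<epsilon>) * (wt (Suc m) d - 1)" by (simp add: algebra_simps)
  finally show ?thesis .
qed

text \<open>Brings the weighted Lipschitz bound at z0 into the form of the hypothesis on the
  generator in \<open>iter_lower\<close>.\<close>

lemma wl_lower:
  assumes g: "wl C m g" and "0 < \<epsilon>"
  shows "\<exists>K\<ge>0. \<forall>z. g z0 - \<epsilon> - K * (wt (Suc m) (z - z0) - 1) \<le> (g z :: real)"
proof -
  have C: "0 \<le> C" using wl_nonneg[OF g] .
  define B where "B = C * (2 ^ m * wt m z0 + wt m z0) + 1"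
  have B: "0 < B" using C wt_pos[of m z0] by (auto simp: B_def intro!: add_nonneg_pos)
  define e where "e = \<epsilon> / B"
  have e: "0 < e" using assms B by (simp add: e_def)
  have "g z0 - \<epsilon> - B * (e + 1 / e) * (wt (Suc m) (z - z0) - 1) \<le> g z" for z
  proof -
    define d where "d = z - z0"
    have "wt m z \<le> 2 ^ m * wt m z0 * wt m d" using wt_shift[of m z0 d] by (simp add: d_def)
    moreover have "wt m z0 \<le> wt m z0 * wt m d" using wt_ge_1[of m d] wt_pos[of m z0] by simp
    ultimately have "C * (wt m z + wt m z0) \<le> C * ((2 ^ m * wt m z0 + wt m z0) * wt m d)"
      using C by (intro mult_left_mono) (auto simp: algebra_simps)
    also have "\<dots> \<le> B * wt m d" using wt_pos[of m d] by (simp add: B_def algebra_simps)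
    finally have "C * (wt m z + wt m z0) * norm d \<le> B * wt m d * norm d" by (intro mult_right_mono) auto
    also have "\<dots> = B * (wt m d * norm d)" by simp
    also have "\<dots> \<le> B * (e + (e + 1 / e) * (wt (Suc m) d - 1))"
      using wt_norm_small[OF e, of m d] B by (intro mult_left_mono) auto
    also have "\<dots> = \<epsilon> + B * (e + 1 / e) * (wt (Suc m) d - 1)" using B by (simp add: e_def algebra_simps)
    finally have "C * (wt m z + wt m z0) * norm d \<le> \<epsilon> + B * (e + 1 / e) * (wt (Suc m) d - 1)" .
    then show ?thesis using wl_lip[OF g, of z z0] by (simp add: d_def abs_le_iff)
  qed
  moreover have "0 \<le> B * (e + 1 / e)" using B e by simp
  ultimately show ?thesis by blast
qed

text \<open>At fixed s, a large n removes the step error and the \<epsilon> of superharmonicity. The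
  remaining bound on W(t0 + s, z0) - W(t0, z0) is divided by s, and s tends to 0 from the
  right.\<close>

lemma superharmonic_generator:
  fixes W :: "real \<times> 'z \<Rightarrow> real"
  assumes f: "reg C m (\<lambda>z. W (t0, z)) Df Hf" and g: "wl C' m (\<lambda>z. gen (Df z) (Hf z))"
    and W: "((\<lambda>s. W (s, z0)) has_real_derivative D) (at t0)"
    and sh: "\<And>s \<epsilon>. 0 < s \<Longrightarrow> s < s0 \<Longrightarrow> 0 < \<epsilon> \<Longrightarrow>
      \<exists>n0>0. \<forall>n\<ge>n0. (step (s / real n) ^^ n) (\<lambda>z. W (t0, z)) z0 - \<epsilon> * wt m z0 \<le> W (t0 + s, z0)"
    and s0: "0 < s0"
  shows "gen (Df z0) (Hf z0) \<le> D"
proof (rule field_le_epsilon)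
  fix \<epsilon> :: real assume "0 < \<epsilon>"
  have C: "0 \<le> C" using wl_nonneg reg_wl(1)[OF f] by blast
  define c where "c = gen (Df z0) (Hf z0) - \<epsilon>"
  obtain K where K: "0 \<le> K" and lower: "\<And>z. c - K * (wt (Suc m) (z - z0) - 1) \<le> gen (Df z) (Hf z)"
    using wl_lower[OF g \<open>0 < \<epsilon>\<close>, of z0] by (auto simp: c_def)
  let ?k = "Suc m"
  have main: "s * (c - K * (exp (lam ?k * s) - 1)) \<le> W (t0 + s, z0) - W (t0, z0)" if s: "0 < s" "s < s0" for s
  proof (rule field_le_epsilon)
    fix e :: real assume e: "0 < e"
    define Q where "Q = KT m * C * (exp (lam m * s) * wt m z0)"
    have Q: "0 \<le> Q" using KT_nonneg[of m] C wt_pos[of m z0] by (simp add: Q_def)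
    define e1 where "e1 = e / (2 * wt m z0)"
    have e1: "0 < e1" using e wt_pos[of m z0] by (simp add: e1_def)
    obtain n0 where n0: "n0 > 0" "\<And>n. n \<ge> n0 \<Longrightarrow> (step (s / real n) ^^ n) (\<lambda>z. W (t0, z)) z0 - e1 * wt m z0 \<le> W (t0 + s, z0)"
      using sh[OF s e1] by blast
    define \<eta> where "\<eta> = e / (2 * (s * Q + 1))"
    have sQ: "0 \<le> s * Q" using s Q by simp
    have \<eta>: "0 < \<eta>" using e sQ by (simp add: \<eta>_def)
    obtain n1 :: nat where n1: "s + s / \<eta>\<^sup>2 < real n1" using reals_Archimedean2 by blast
    define n where "n = max n0 n1"
    have nn: "s + s / \<eta>\<^sup>2 < real n" "n0 \<le> n" using n1 by (auto simp: n_def)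
    have pos: "0 < s / \<eta>\<^sup>2" using s \<eta> by simp
    have npos: "0 < real n" using nn s pos by linarith
    define h where "h = s / real n"
    have h: "0 \<le> h" "h \<le> 1" "real n * h = s" using s npos nn pos by (auto simp: h_def divide_le_eq)
    have "s / \<eta>\<^sup>2 \<le> real n" using nn s by linarith
    then have "h \<le> \<eta>\<^sup>2" using npos \<eta> by (simp add: h_def field_simps)
    then have shh: "sqrt h \<le> \<eta>" using \<eta> by (simp add: real_le_lsqrt)
    have "real n * (h * (c - K * (exp (lam ?k * s) - 1)) - KT m * C * (h * sqrt h) * (exp (lam m * s) * wt m z0))
       = s * (c - K * (exp (lam ?k * s) - 1)) - sqrt h * (s * Q)"
    proof -
      have "real n * (h * a - p * (h * r) * q) = (real n * h) * a - r * ((real n * h) * (p * q))" for a p r q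
        by (simp add: algebra_simps)
      then show ?thesis unfolding h(3) Q_def .
    qed
    then have "W (t0, z0) + (s * (c - K * (exp (lam ?k * s) - 1)) - sqrt h * (s * Q)) \<le> (step h ^^ n) (\<lambda>z. W (t0, z)) z0"
      using iter_lower[OF f h(1,2) lower K h(3) order_refl] by simp
    moreover have "sqrt h * (s * Q) \<le> e / 2"
    proof -
      have "sqrt h * (s * Q) \<le> \<eta> * (s * Q + 1)" using shh sQ \<eta> h by (intro mult_mono) auto
      also have "\<dots> = e / 2" using sQ by (simp add: \<eta>_def field_simps)
      finally show ?thesis .
    qed
    moreover have "e1 * wt m z0 = e / 2" using wt_pos[of m z0] by (simp add: e1_def)
    ultimately show "s * (c - K * (exp (lam ?k * s) - 1)) \<le> W (t0 + s, z0) - W (t0, z0) + e"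
      using n0(2)[OF nn(2)] unfolding h_def[symmetric] by linarith
  qed
  have "((\<lambda>s. (W (t0 + s, z0) - W (t0, z0)) / s) \<longlongrightarrow> D) (at_right 0)"
    using W unfolding DERIV_def by (rule tendsto_within_subset) auto
  moreover have "((\<lambda>s. c - K * (exp (lam ?k * s) - 1)) \<longlongrightarrow> c - K * (exp (lam ?k * 0) - 1)) (at_right 0)"
    by (intro tendsto_intros)
  moreover have "\<forall>\<^sub>F s in at_right 0. c - K * (exp (lam ?k * s) - 1) \<le> (W (t0 + s, z0) - W (t0, z0)) / s"
    using eventually_at_right_real[OF s0]
    by (rule eventually_mono) (use main in \<open>auto simp: le_divide_eq mult.commute\<close>)
  ultimately have "c - K * (exp (lam ?k * 0) - 1) \<le> D"
    by (intro tendsto_le[of "at_right (0::real)"]) auto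
  then show "gen (Df z0) (Hf z0) \<le> D + \<epsilon>" by (simp add: c_def)
qed

end

definition vsuper :: "('z::euclidean_space \<Rightarrow> ('z \<Rightarrow>\<^sub>L 'z) \<Rightarrow> real) \<Rightarrow> (real \<Rightarrow> 'z \<Rightarrow> real) \<Rightarrow> bool" where
  "vsuper F V \<longleftrightarrow> (\<forall>\<psi> \<psi>t D\<psi> H\<psi> t z. C12_test \<psi> \<psi>t D\<psi> H\<psi> \<longrightarrow> t > 0 \<longrightarrow> V t z = \<psi> t z \<longrightarrow>
     (\<forall>\<^sub>F (s, z') in nhds (t, z). \<psi> s z' \<le> V s z') \<longrightarrow> F (D\<psi> t z) (H\<psi> t z) \<le> \<psi>t t z)"

text \<open>The negative of a test function above -V is one below V; the rest is linearity of
  \<open>gen\<close> together with \<open>gen\<close> \<le> F.\<close>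

lemma (in walk) vsuper_imp_vsub_gen:
  assumes V: "vsuper F V" and le: "\<And>D B. gen D B \<le> F D B"
  shows "vsub gen (\<lambda>t z. - V t z)"
  unfolding vsub_def
proof (intro allI impI)
  fix \<psi> \<psi>t D\<psi> H\<psi> t z
  assume C: "C12_test \<psi> \<psi>t D\<psi> H\<psi>" and t: "0 < t" and eq: "- V t z = \<psi> t z"
    and ev: "\<forall>\<^sub>F (s, z') in nhds (t, z). - V s z' \<le> \<psi> s z'"
  have "F (-1 *\<^sub>R D\<psi> t z) (-1 *\<^sub>R H\<psi> t z) \<le> -1 * \<psi>t t z"
  proof (rule V[unfolded vsuper_def, rule_format, OF C12_test_cmult[OF C, of "-1"] t])
    show "V t z = -1 * \<psi> t z" using eq by simp
    show "\<forall>\<^sub>F (s, z') in nhds (t, z). -1 * \<psi> s z' \<le> V s z'"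
      by (rule eventually_mono[OF ev]) auto
  qed
  moreover have "gen (-1 *\<^sub>R D\<psi> t z) (-1 *\<^sub>R H\<psi> t z) = -1 * gen (D\<psi> t z) (H\<psi> t z)" by (rule gen_scale)
  ultimately show "\<psi>t t z \<le> gen (D\<psi> t z) (H\<psi> t z)" using le[of "-1 *\<^sub>R D\<psi> t z" "-1 *\<^sub>R H\<psi> t z"] by linarith
qed

section \<open>The comparison principle\<close>

text \<open>The bounds (1) and (2) expressed with a single weight; on [0, T] the modulus s + sqrt s
  is equivalent to sqrt s.\<close>

definition tp_reg :: "(real \<Rightarrow> 'z::euclidean_space \<Rightarrow> real) \<Rightarrow> bool" where
  "tp_reg V \<longleftrightarrow> (\<forall>T>0. \<exists>C m. (\<forall>t\<in>{0..T}. wl C m (V t)) \<and>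
     (\<forall>t\<in>{0..T}. \<forall>t'\<in>{0..T}. \<forall>z. \<bar>V t z - V t' z\<bar> \<le> C * wt m z * sqrt \<bar>t - t'\<bar>))"

text \<open>Extends V to all times with the same constants, since clamping does not increase
  distances in time.\<close>

definition time_clamp :: "real \<Rightarrow> (real \<Rightarrow> 'z \<Rightarrow> real) \<Rightarrow> real \<times> 'z \<Rightarrow> real" where
  "time_clamp T V p = V (max 0 (min (fst p) T)) (snd p)"

lemma time_clamp_eq: "0 \<le> t \<Longrightarrow> t \<le> T \<Longrightarrow> V t z = time_clamp T V (t, z)"
  by (simp add: time_clamp_def)

lemma time_clamp_holder:
  assumes h: "\<And>t t' z. t \<in> {0..T} \<Longrightarrow> t' \<in> {0..T} \<Longrightarrow> \<bar>V t z - V t' z\<bar> \<le> C * wt m z * sqrt \<bar>t - t'\<bar>"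
    and C: "0 \<le> C" and T: "0 < T"
  shows "\<bar>time_clamp T V (t, z) - time_clamp T V (t', z)\<bar> \<le> C * wt m z * sqrt \<bar>t - t'\<bar>"
proof -
  define c where "c t = max 0 (min t T)" for t
  have c: "c t \<in> {0..T}" "\<bar>c t - c t'\<bar> \<le> \<bar>t - t'\<bar>" for t t' using T by (auto simp: c_def)
  have "\<bar>V (c t) z - V (c t') z\<bar> \<le> C * wt m z * sqrt \<bar>c t - c t'\<bar>" by (rule h[OF c(1) c(1)])
  also have "\<dots> \<le> C * wt m z * sqrt \<bar>t - t'\<bar>"
    using C wt_pos[of m z] c(2)[of t t'] by (intro mult_left_mono) auto
  finally show ?thesis by (simp add: time_clamp_def c_def)
qed

lemma time_clamp_fam:
  fixes V :: "real \<Rightarrow> 'z::euclidean_space \<Rightarrow> real"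
  assumes w: "\<And>t. t \<in> {0..T} \<Longrightarrow> wl C m (V t)"
    and h: "\<And>t t' z. t \<in> {0..T} \<Longrightarrow> t' \<in> {0..T} \<Longrightarrow> \<bar>V t z - V t' z\<bar> \<le> C * wt m z * sqrt \<bar>t - t'\<bar>"
    and T: "0 < T"
  shows "fam C m (time_clamp T V)"
proof -
  have C: "0 \<le> C" using w[of 0] T wl_nonneg by auto
  have wl: "wl C m (\<lambda>z. time_clamp T V (t, z))" for t using w[of "max 0 (min t T)"] T by (simp add: time_clamp_def)
  have "(time_clamp T V \<longlongrightarrow> time_clamp T V p) (at p)" for p
  proof -
    obtain t z where p: "p = (t, z)" by (cases p)
    have b: "norm (time_clamp T V p' - time_clamp T V p)
       \<le> C * (wt m (snd p') + wt m z) * norm (snd p' - z) + C * wt m z * sqrt \<bar>fst p' - t\<bar>" for p'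
    proof -
      have "\<bar>time_clamp T V (fst p', snd p') - time_clamp T V (fst p', z)\<bar> \<le> C * (wt m (snd p') + wt m z) * norm (snd p' - z)"
        using wl_lip[OF wl, of "fst p'" "snd p'" z] by simp
      moreover have "\<bar>time_clamp T V (fst p', z) - time_clamp T V (t, z)\<bar> \<le> C * wt m z * sqrt \<bar>fst p' - t\<bar>"
        by (rule time_clamp_holder[OF h C T])
      ultimately show ?thesis by (simp add: p)
    qed
    have "((\<lambda>p'. C * (wt m (snd p') + wt m z) * norm (snd p' - z) + C * wt m z * sqrt \<bar>fst p' - t\<bar>)
       \<longlongrightarrow> C * (wt m (snd p) + wt m z) * norm (snd p - z) + C * wt m z * sqrt \<bar>fst p - t\<bar>) (at p)"
      unfolding wt_def by (intro tendsto_intros)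
    then have "((\<lambda>p'. C * (wt m (snd p') + wt m z) * norm (snd p' - z) + C * wt m z * sqrt \<bar>fst p' - t\<bar>)
       \<longlongrightarrow> 0) (at p)" by (simp add: p)
    then have "((\<lambda>p'. time_clamp T V p' - time_clamp T V p) \<longlongrightarrow> 0) (at p)"
      by (rule Lim_null_comparison[rotated]) (intro always_eventually allI, rule b)
    then show ?thesis by (simp add: LIM_zero_iff)
  qed
  then have "continuous_on UNIV (time_clamp T V)" by (simp add: continuous_on_def)
  then show ?thesis using wl by (simp add: fam_def)
qed

text \<open>The supremum is attained at every (D, B). This yields subadditivity, and it reduces a
  differential inequality for F at a given point to the one generator that is active there.\<close>

definition sup_of_gens :: "('z::euclidean_space \<Rightarrow> ('z \<Rightarrow>\<^sub>L 'z) \<Rightarrow> real) \<Rightarrow> bool" where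
  "sup_of_gens F \<longleftrightarrow> (\<forall>D B. \<exists>N a q. walk N a \<and> walk.gen N a q D B = F D B \<and>
     (\<forall>D' B'. walk.gen N a q D' B' \<le> F D' B'))"

lemma sup_of_gens_subadditive:
  assumes "sup_of_gens F" shows "F (D + D') (B + B') \<le> F D B + F D' B'"
proof -
  obtain N a q where w: "walk N a" and eq: "walk.gen N a q (D + D') (B + B') = F (D + D') (B + B')"
    and le: "\<And>D' B'. walk.gen N a q D' B' \<le> F D' B'"
    using assms unfolding sup_of_gens_def by metis
  interpret walk N a q by (rule w)
  show ?thesis using eq le[of D B] le[of D' B'] gen_add[of D D' B B'] by linarith
qed

text \<open>The operator is convex, so averages of supersolutions are supersolutions.  Each generator below the
  operator turns a viscosity supersolution into a superharmonic function of a random walk, and this property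
  survives averaging, which is not visible for the viscosity notion itself.\<close>

lemma mollified_supersolution:
  fixes V :: "real \<Rightarrow> 'z::euclidean_space \<Rightarrow> real"
  assumes F: "sup_of_gens F" and V: "vsuper F V" and vb: "fam C m vb"
    and Vvb: "\<And>t z. 0 \<le> t \<Longrightarrow> t \<le> T \<Longrightarrow> V t z = vb (t, z)" and \<delta>: "0 < \<delta>" "\<delta> \<le> 1"
  defines "W \<equiv> moll 3 \<delta> (avg (\<delta>, 0) vb)"
  obtains Wt DW HW where "C12_test (\<lambda>t z. W (t, z)) Wt DW HW" "continuous_on UNIV W"
    "\<And>t z. 0 < t \<Longrightarrow> t < T - 2 \<Longrightarrow> F (DW t z) (HW t z) \<le> Wt t z"
proof -
  let ?e = "(\<delta>, 0) :: real \<times> 'z"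
  \<comment> \<open>Averaging forward in time produces a time derivative, again a difference
    quotient; spatial averaging afterwards preserves it.\<close>
  define A where "A = avg ?e vb"
  note cvb = fam_cont[OF vb]
  have A: "fam (shift_const m ?e * C) m A" unfolding A_def by (rule fam_avg[OF vb])
  define At where "At p = (1 / \<delta>) * (vb (p + ?e) - vb p)" for p
  have "pd (\<delta> *\<^sub>R (1, 0)) A (\<lambda>p. vb (p + ?e) - vb p)"
    using pd_avg_self[OF cvb, of ?e] by (simp add: A_def)
  then have pdA: "pd (1, 0) A At" using pd_rescale[of \<delta> "(1, 0)" A] \<delta> unfolding At_def[abs_def] by blast
  have cAt: "continuous_on UNIV At" unfolding At_def[abs_def] by (intro continuous_intros cont_shift cvb)
  have WA: "W = moll 3 \<delta> A" by (simp add: W_def A_def)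
  obtain K3 where "smooth 3 (K3 * (shift_const m ?e * C)) m W"
    using moll_smooth[OF \<delta>(1), of m 3] A unfolding WA by blast
  then obtain C3 where W3: "smooth (Suc (Suc 1)) C3 m W" by (auto simp: numeral_eq_Suc)
  obtain DW HW CW where rW: "\<And>t. reg CW m (\<lambda>z. W (t, z)) (\<lambda>z. DW (t, z)) (\<lambda>z. HW (t, z))"
    and cD: "continuous_on UNIV DW" "continuous_on UNIV HW"
    and sm: "\<And>l1 l2. linear l1 \<Longrightarrow> linear l2 \<Longrightarrow> \<exists>B. smooth 1 B m (\<lambda>p. l1 (DW p) + l2 (HW p))"
    by (rule smooth_regular[OF W3]) (rule that; assumption)
  have DW: "GDERIV (\<lambda>z. W (t, z)) z :> DW (t, z)"
    "((\<lambda>z. DW (t, z)) has_derivative blinfun_apply (HW (t, z))) (at z)" for t z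
    using reg_C2[OF rW[of t]] by (auto simp: C2_def)
  define Wt where "Wt = moll 3 \<delta> At"
  have pdW: "pd (1, 0) W Wt" unfolding WA Wt_def moll_def by (rule pd_avgs[OF pdA fam_cont[OF A] cAt])
  have cW: "continuous_on UNIV W" using fam_cont[OF fam_smooth[OF W3]] .
  have cWt: "continuous_on UNIV Wt" unfolding Wt_def moll_def by (rule avgs_continuous[OF cAt])
  have test: "C12_test (\<lambda>t z. W (t, z)) (\<lambda>t z. Wt (t, z)) (\<lambda>t z. DW (t, z)) (\<lambda>t z. HW (t, z))"
    by (rule C12_test_from_family[OF cW pdW cWt DW(1) cD(1) DW(2) cD(2)])
  have ineq: "F (DW (t, z)) (HW (t, z)) \<le> Wt (t, z)" if t: "0 < t" "t < T - 2" for t z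
  proof -
    \<comment> \<open>Only the generator that attains F at the derivatives of W in this very point
      is examined.\<close>
    obtain N a q where w: "walk N a" and eq: "walk.gen N a q (DW (t, z)) (HW (t, z)) = F (DW (t, z)) (HW (t, z))"
      and gle: "\<And>D' B'. walk.gen N a q D' B' \<le> F D' B'"
      using F unfolding sup_of_gens_def by metis
    interpret walk N a q by (rule w)
    have sub: "vsub gen (\<lambda>t z. - V t z)" by (rule vsuper_imp_vsub_gen[OF V gle])
    obtain Cg where "smooth 1 Cg m (\<lambda>p. gen (DW p) (HW p))"
      using sm[OF linear_inner_q linear_trace_part] unfolding gen_def by blast
    then have wg: "wl Cg m (\<lambda>z. gen (DW (t, z)) (HW (t, z)))" using fam_wl[OF fam_smooth] by blast
    have dW: "((\<lambda>s. W (s, z)) has_real_derivative Wt (t, z)) (at t)"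
      using pd_at[OF pdW, of "(0, z)" t] by (simp add: plus_prod_def)
    \<comment> \<open>One unit of time is reserved for the duration s < 1 of the walk and \<delta>
      for the average in time; t < T - 2 leaves room for both.\<close>
    let ?S = "T - 1 - \<delta>"
    obtain K where K: "0 < K" and sm: "\<And>\<epsilon> h n s f. 0 \<le> \<epsilon> \<Longrightarrow> superharm ?S m \<epsilon> h n s f \<Longrightarrow> continuous_on UNIV f \<Longrightarrow>
        superharm ?S m (K * \<epsilon>) h n s (moll 3 \<delta> f)"
      using superharm_moll[of ?S m 3 \<delta>] by blast
    have "gen (DW (t, z)) (HW (t, z)) \<le> Wt (t, z)"
    proof (rule superharmonic_generator[OF rW wg dW _ zero_less_one])
      fix s \<epsilon> :: real assume s: "0 < s" "s < 1" and \<epsilon>: "0 < \<epsilon>"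
      define sc where "sc = shift_const m ?e"
      have sc: "1 \<le> sc" by (simp add: sc_def shift_const_ge_1)
      \<comment> \<open>Averaging in time multiplies the error by sc and averaging in space by K,
        which turns \<epsilon>1 into \<epsilon>.\<close>
      define \<epsilon>1 where "\<epsilon>1 = \<epsilon> / (K * sc)"
      have \<epsilon>1: "0 < \<epsilon>1" "K * (sc * \<epsilon>1) = \<epsilon>" using \<epsilon> K sc by (auto simp: \<epsilon>1_def)
      have "\<exists>n0>0. \<forall>n\<ge>n0. \<forall>t0 z. 0 \<le> t0 \<longrightarrow> t0 + s < T \<longrightarrow>
          (step (s / real n) ^^ n) (\<lambda>z. vb (t0, z)) z - \<epsilon>1 * wt m z \<le> vb (t0 + s, z)"
        by (rule supersolution_superharmonic[OF sub vb Vvb s(1) \<epsilon>1(1)])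
      then obtain n0 where n0: "n0 > 0" and sup: "\<forall>n\<ge>n0. \<forall>t0 z. 0 \<le> t0 \<longrightarrow> t0 + s < T \<longrightarrow>
          (step (s / real n) ^^ n) (\<lambda>z. vb (t0, z)) z - \<epsilon>1 * wt m z \<le> vb (t0 + s, z)"
        by (elim exE conjE) (rule that)
      have "(step (s / real n) ^^ n) (\<lambda>z. W (t, z)) z - \<epsilon> * wt m z \<le> W (t + s, z)" if n: "n \<ge> n0" for n
      proof -
        have "superharm (T - 1) m \<epsilon>1 (s / real n) n s vb"
          unfolding superharm_def stepf_iter
        proof (intro allI impI)
          fix t' z' assume "0 \<le> t'" "t' < T - 1"
          then show "(step (s / real n) ^^ n) (\<lambda>z. vb (t', z)) z' - \<epsilon>1 * wt m z' \<le> vb (t' + s, z')"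
            using s by (intro sup[rule_format, OF n]) auto
        qed
        then have "superharm (T - 1 - fst ?e) m (sc * \<epsilon>1) (s / real n) n s A"
          unfolding A_def sc_def by (rule superharm_avg[OF _ cvb]) (use \<delta> \<epsilon>1 in simp_all)
        then have "superharm ?S m (K * (sc * \<epsilon>1)) (s / real n) n s W"
          unfolding WA by (intro sm) (use \<epsilon>1 sc fam_cont[OF A] in simp_all)
        then have "superharm ?S m \<epsilon> (s / real n) n s W" unfolding \<epsilon>1(2) .
        from this[unfolded superharm_def stepf_iter, rule_format, of t z] show ?thesis using t \<delta> by simp
      qed
      then show "\<exists>n0>0. \<forall>n\<ge>n0. (step (s / real n) ^^ n) (\<lambda>z. W (t, z)) z - \<epsilon> * wt m z \<le> W (t + s, z)"
        using n0 by blast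
    qed
    then show ?thesis using eq by simp
  qed
  show thesis by (rule that[OF test cW ineq])
qed

text \<open>U is compared with the smooth supersolution W plus a growing multiple of the weight. The
  multiple is of order sqrt \<delta>: it repairs the initial inequality, which mollification may
  violate, and disappears as \<delta> tends to 0.\<close>

theorem viscosity_comparison:
  fixes U V :: "real \<Rightarrow> 'z::euclidean_space \<Rightarrow> real"
  assumes F: "sup_of_gens F" and Fbd: "\<And>D B. F D B \<le> KF * (norm D + norm B)" and KF: "0 \<le> KF"
    and U: "vsub F U" "tp_reg U" and V: "vsuper F V" "tp_reg V"
    and init: "\<And>z. U 0 z \<le> V 0 z" and t: "0 \<le> t"
  shows "U t z \<le> V t z"
proof -
  \<comment> \<open>The comparison runs up to t + 1, and W is a supersolution before T - 2 = t +
    2.\<close>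
  define T where "T = t + 4"
  have T: "0 < T" using t by (simp add: T_def)
  obtain CU mU where U1: "\<And>t. t \<in> {0..T} \<Longrightarrow> wl CU mU (U t)"
    and U2: "\<And>t t' z. t \<in> {0..T} \<Longrightarrow> t' \<in> {0..T} \<Longrightarrow> \<bar>U t z - U t' z\<bar> \<le> CU * wt mU z * sqrt \<bar>t - t'\<bar>"
    using U(2) T unfolding tp_reg_def by metis
  obtain CV mV where V1: "\<And>t. t \<in> {0..T} \<Longrightarrow> wl CV mV (V t)"
    and V2: "\<And>t t' z. t \<in> {0..T} \<Longrightarrow> t' \<in> {0..T} \<Longrightarrow> \<bar>V t z - V t' z\<bar> \<le> CV * wt mV z * sqrt \<bar>t - t'\<bar>"
    using V(2) T unfolding tp_reg_def by metis
  have CU: "0 \<le> CU" and CV: "0 \<le> CV" using U1[of 0] V1[of 0] T wl_nonneg by auto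
  define m where "m = max mU mV"
  have wU: "wt mU z \<le> wt m z" and wV: "wt mV z \<le> wt m z" for z :: 'z by (auto simp: m_def intro: wt_mono)
  define ub where "ub = time_clamp T U"
  define vb where "vb = time_clamp T V"
  have ub: "fam CU mU ub" unfolding ub_def by (rule time_clamp_fam[OF U1 U2 T])
  have vb: "fam CV mV vb" unfolding vb_def by (rule time_clamp_fam[OF V1 V2 T])
  have Uub: "U t z = ub (t, z)" and Vvb: "V t z = vb (t, z)" if "0 \<le> t" "t \<le> T" for t z
    using that by (auto simp: ub_def vb_def time_clamp_eq)
  obtain D\<omega> H\<omega> K\<omega> where \<omega>: "C2 (wt m :: 'z \<Rightarrow> real) D\<omega> H\<omega>"
    and D\<omega>: "\<And>z. norm (D\<omega> z) \<le> K\<omega> * wt m z" and H\<omega>: "\<And>z. norm (H\<omega> z) \<le> K\<omega> * wt m z" and K\<omega>: "0 \<le> K\<omega>"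
    using C2_wt[where 'z='z and m=m] by metis
  \<comment> \<open>With this rate exp(\<mu> s) times the weight is a supersolution: KF bounds the
    operator and K\<omega> each of the two derivatives of the weight.\<close>
  define \<mu> where "\<mu> = 2 * KF * K\<omega>"
  have \<mu>: "0 \<le> \<mu>" using KF K\<omega> by (simp add: \<mu>_def)
  obtain Km where Km: "0 \<le> Km" and close: "\<And>\<delta> C (f :: real \<times> 'z \<Rightarrow> real) t z. 0 \<le> \<delta> \<Longrightarrow> \<delta> \<le> 1 \<Longrightarrow> fam C mV f \<Longrightarrow>
     \<bar>moll 3 \<delta> f (t, z) - f (t, z)\<bar> \<le> Km * \<delta> * C * wt mV z"
    using moll_close[where m=mV and n=3 and 'z='z] by blast
  \<comment> \<open>CV comes from the average in time, which costs sqrt \<delta>; the second term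
    from the spatial averages, which cost \<delta> \<le> sqrt \<delta>.\<close>
  define \<kappa>0 where "\<kappa>0 = CV + Km * (2 ^ mV * CV)"
  have \<kappa>0: "0 \<le> \<kappa>0" using CV Km by (simp add: \<kappa>0_def)
  have main: "U t z - V t z \<le> \<kappa>0 * (1 + exp (\<mu> * t)) * wt m z * sqrt \<delta>" if \<delta>: "0 < \<delta>" "\<delta> \<le> 1" for \<delta>
  proof -
    let ?e = "(\<delta>, 0) :: real \<times> 'z"
    define A where "A = avg ?e vb"
    define W where "W = moll 3 \<delta> A"
    have A: "fam (2 ^ mV * CV) mV A" using fam_avg[OF vb, of ?e] by (simp add: A_def shift_const_def)
    define \<kappa> where "\<kappa> = \<kappa>0 * sqrt \<delta>"
    have \<kappa>: "0 \<le> \<kappa>" using \<kappa>0 \<delta> by (simp add: \<kappa>_def)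
    have Wv: "\<bar>W (s, z) - vb (s, z)\<bar> \<le> \<kappa> * wt m z" for s z
    proof -
      have "A (s, z) - vb (s, z) = avg ?e (\<lambda>p. vb p - vb (s, z)) (s, z)"
        unfolding A_def using avg_diff[OF fam_cont[OF vb] continuous_on_const] by (simp add: avg_const)
      also have "\<bar>\<dots>\<bar> \<le> CV * wt mV z * sqrt \<delta>"
      proof (rule avg_bound)
        fix \<tau> :: real assume \<tau>: "0 \<le> \<tau>" "\<tau> \<le> 1"
        have "\<tau> * \<delta> \<le> 1 * \<delta>" using \<tau> \<delta> by (intro mult_right_mono) auto
        then have "CV * wt mV z * sqrt \<bar>\<tau> * \<delta>\<bar> \<le> CV * wt mV z * sqrt \<delta>"
          using CV wt_pos[of mV z] \<tau> \<delta> by (intro mult_left_mono) auto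
        then show "\<bar>vb ((s, z) + \<tau> *\<^sub>R ?e) - vb (s, z)\<bar> \<le> CV * wt mV z * sqrt \<delta>"
          using time_clamp_holder[OF V2 CV T, of "s + \<tau> * \<delta>" z s] by (simp add: vb_def)
      qed (intro continuous_intros fam_cont[OF vb])
      finally have 1: "\<bar>A (s, z) - vb (s, z)\<bar> \<le> CV * wt mV z * sqrt \<delta>" .
      have "\<bar>W (s, z) - A (s, z)\<bar> \<le> Km * \<delta> * (2 ^ mV * CV) * wt mV z"
        unfolding W_def using \<delta> by (intro close A) auto
      also have "\<dots> \<le> Km * sqrt \<delta> * (2 ^ mV * CV) * wt mV z"
      proof -
        have "\<delta> \<le> sqrt \<delta>" using \<delta> by (simp add: real_le_rsqrt power2_eq_square mult_left_le)
        then show ?thesis using Km CV wt_pos[of mV z] by (intro mult_right_mono mult_left_mono) auto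
      qed
      finally have "\<bar>W (s, z) - vb (s, z)\<bar> \<le> \<kappa> * wt mV z"
        using 1 by (simp add: \<kappa>_def \<kappa>0_def algebra_simps)
      also have "\<dots> \<le> \<kappa> * wt m z" using wV \<kappa> by (intro mult_left_mono) auto
      finally show ?thesis .
    qed
    obtain Wt DW HW where test: "C12_test (\<lambda>t z. W (t, z)) Wt DW HW" and cW: "continuous_on UNIV W"
      and Wineq: "\<And>t z. 0 < t \<Longrightarrow> t < T - 2 \<Longrightarrow> F (DW t z) (HW t z) \<le> Wt t z"
      using mollified_supersolution[OF F V(1) vb Vvb \<delta>] unfolding W_def A_def by metis
    define \<alpha> where "\<alpha> s = \<kappa> * exp (\<mu> * s)" for s
    have \<alpha>0: "0 \<le> \<alpha> s" for s using \<kappa> by (simp add: \<alpha>_def)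
    have \<alpha>': "(\<alpha> has_real_derivative \<mu> * \<alpha> s) (at s)" for s
      unfolding \<alpha>_def by (auto intro!: derivative_eq_intros)
    have c\<alpha>: "continuous_on UNIV (\<lambda>s. \<mu> * \<alpha> s)" unfolding \<alpha>_def by (intro continuous_intros)
    have "U t z \<le> W (t, z) + \<alpha> t * wt m z"
    proof (rule viscosity_comparison_smooth[OF sup_of_gens_subadditive[OF F] Fbd KF U(1)
          C12_test_add[OF test C12_test_prod[OF \<alpha>' c\<alpha> \<omega>]], where ?t0.0=0 and T="t + 1" and C="CU + (CV + \<kappa>)" and m=m])
      fix s z assume s: "0 < s" "s < t + 1"
      have "F (DW s z + \<alpha> s *\<^sub>R D\<omega> z) (HW s z + \<alpha> s *\<^sub>R H\<omega> z)
         \<le> F (DW s z) (HW s z) + F (\<alpha> s *\<^sub>R D\<omega> z) (\<alpha> s *\<^sub>R H\<omega> z)"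
        by (rule sup_of_gens_subadditive[OF F])
      moreover have "F (DW s z) (HW s z) \<le> Wt s z" using s by (intro Wineq) (auto simp: T_def)
      moreover have "F (\<alpha> s *\<^sub>R D\<omega> z) (\<alpha> s *\<^sub>R H\<omega> z) \<le> \<mu> * \<alpha> s * wt m z"
      proof -
        have "F (\<alpha> s *\<^sub>R D\<omega> z) (\<alpha> s *\<^sub>R H\<omega> z) \<le> KF * (\<alpha> s * norm (D\<omega> z) + \<alpha> s * norm (H\<omega> z))"
          using Fbd[of "\<alpha> s *\<^sub>R D\<omega> z" "\<alpha> s *\<^sub>R H\<omega> z"] \<alpha>0[of s] by simp
        also have "\<dots> \<le> KF * (\<alpha> s * (K\<omega> * wt m z) + \<alpha> s * (K\<omega> * wt m z))"
          using \<alpha>0[of s] D\<omega>[of z] H\<omega>[of z] KF by (intro mult_left_mono add_mono) auto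
        finally show ?thesis by (simp add: \<mu>_def algebra_simps)
      qed
      ultimately show "F (DW s z + \<alpha> s *\<^sub>R D\<omega> z) (HW s z + \<alpha> s *\<^sub>R H\<omega> z) \<le> Wt s z + \<mu> * \<alpha> s * wt m z"
        by linarith
    next
      have "continuous_on ({0..t + 1} \<times> UNIV) (\<lambda>p. ub p - (W p + \<alpha> (fst p) * wt m (snd p)))"
        unfolding \<alpha>_def wt_def
        by (intro continuous_intros continuous_on_subset[OF fam_cont[OF ub]] continuous_on_subset[OF cW]) auto
      then show "continuous_on ({0..t + 1} \<times> UNIV) (\<lambda>(s, z). U s z - (W (s, z) + \<alpha> s * wt m z))"
        by (rule continuous_on_eq) (auto simp: Uub T_def)
    next
      fix s z assume s: "0 \<le> s" "s \<le> t + 1"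
      have sT: "s \<in> {0..T}" using s by (simp add: T_def)
      have "\<bar>U s z\<bar> \<le> CU * wt mU z" "\<bar>V s z\<bar> \<le> CV * wt mV z"
        using wl_growth[OF U1[OF sT], of z] wl_growth[OF V1[OF sT], of z] by auto
      moreover have "CU * wt mU z \<le> CU * wt m z" "CV * wt mV z \<le> CV * wt m z"
        using CU CV wU wV by (auto intro: mult_left_mono)
      moreover have "\<bar>W (s, z) - V s z\<bar> \<le> \<kappa> * wt m z" using Wv[of s z] Vvb[of s z] sT by simp
      moreover have "0 \<le> \<alpha> s * wt m z" using \<alpha>0[of s] wt_pos[of m z] by simp
      ultimately show "U s z - (W (s, z) + \<alpha> s * wt m z) \<le> (CU + (CV + \<kappa>)) * wt m z"
        by (simp add: algebra_simps abs_le_iff)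
    next
      show "U 0 z \<le> W (0, z) + \<alpha> 0 * wt m z" for z
        using Wv[of 0 z] Vvb[of 0 z] T init[of z] by (simp add: \<alpha>_def abs_le_iff)
    qed (use t in auto)
    moreover have "W (t, z) \<le> V t z + \<kappa> * wt m z" using Wv[of t z] Vvb[of t z] t by (simp add: T_def abs_le_iff)
    ultimately show ?thesis by (simp add: \<alpha>_def \<kappa>_def algebra_simps)
  qed
  have "((\<lambda>\<delta>. \<kappa>0 * (1 + exp (\<mu> * t)) * wt m z * sqrt \<delta>) \<longlongrightarrow> \<kappa>0 * (1 + exp (\<mu> * t)) * wt m z * sqrt 0) (at_right 0)"
    by (intro tendsto_intros)
  moreover have "\<forall>\<^sub>F \<delta> in at_right 0. U t z - V t z \<le> \<kappa>0 * (1 + exp (\<mu> * t)) * wt m z * sqrt \<delta>"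
    using eventually_at_right_real[OF zero_less_one] by (rule eventually_mono) (use main in auto)
  ultimately have "U t z - V t z \<le> \<kappa>0 * (1 + exp (\<mu> * t)) * wt m z * sqrt 0"
    by (rule tendsto_lowerbound) simp
  then show ?thesis by simp
qed

section \<open>Sublinear elliptic operators as suprema of generators\<close>

text \<open>Hahn-Banach by separation: the strict epigraph of g is convex and misses (w0, g w0). The
  hyperplane cannot be vertical, so it is an affine minorant touching at w0; homogeneity, used at 2
  w0 and at 0, removes the constant term.\<close>

lemma sublinear_support:
  fixes g :: "'a::euclidean_space \<Rightarrow> real"
  assumes sub: "\<And>w w'. g (w + w') \<le> g w + g w'" and hom: "\<And>c w. 0 \<le> c \<Longrightarrow> g (c *\<^sub>R w) = c * g w"
  shows "\<exists>l. (\<forall>w. l \<bullet> w \<le> g w) \<and> l \<bullet> w0 = g w0"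
proof -
  define S where "S = {p :: 'a \<times> real. g (fst p) < snd p}"
  have "convex S"
  proof (rule convexI)
    fix p p' and u v :: real assume p: "p \<in> S" "p' \<in> S" and uv: "0 \<le> u" "0 \<le> v" "u + v = 1"
    have "g (u *\<^sub>R fst p + v *\<^sub>R fst p') \<le> u * g (fst p) + v * g (fst p')"
      using sub[of "u *\<^sub>R fst p" "v *\<^sub>R fst p'"] hom uv by simp
    also have "\<dots> < u * snd p + v * snd p'"
    proof (cases "u = 0")
      case True then show ?thesis using p uv by (simp add: S_def)
    next
      case False
      then have "u * g (fst p) < u * snd p" using p uv by (simp add: S_def)
      moreover have "v * g (fst p') \<le> v * snd p'" using p uv by (intro mult_left_mono) (auto simp: S_def)
      ultimately show ?thesis by linarith
    qed
    finally show "u *\<^sub>R p + v *\<^sub>R p' \<in> S" by (simp add: S_def)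
  qed
  moreover have "(0, g 0 + 1) \<in> S" by (simp add: S_def)
  moreover have "S \<inter> {(w0, g w0)} = {}" by (auto simp: S_def)
  ultimately obtain a b where a: "a \<noteq> 0" "\<And>p. p \<in> S \<Longrightarrow> a \<bullet> p \<le> b" "b \<le> a \<bullet> (w0, g w0)"
    using separating_hyperplane_sets[of S "{(w0, g w0)}"] by blast
  obtain y \<gamma> where y: "a = (y, \<gamma>)" by (cases a)
  have Sle: "y \<bullet> w + \<gamma> * r \<le> y \<bullet> w0 + \<gamma> * g w0" if "g w < r" for w r
    using a(2)[of "(w, r)"] a(3) that by (simp add: y S_def)
  have "\<gamma> \<noteq> 0"
  proof
    assume "\<gamma> = 0"
    then have "y \<bullet> (w0 + y) \<le> y \<bullet> w0" using Sle[of "w0 + y" "g (w0 + y) + 1"] by simp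
    then have "y \<bullet> y \<le> 0" by (simp add: inner_add_right)
    then have "y = 0" by (metis inner_ge_zero inner_eq_zero_iff order_antisym)
    then show False using a(1) y \<open>\<gamma> = 0\<close> by (simp add: zero_prod_def)
  qed
  moreover have "\<gamma> \<le> 0" using Sle[of w0 "g w0 + 1"] by (simp add: algebra_simps)
  ultimately have \<gamma>: "\<gamma> < 0" by simp
  define l where "l = (1 / - \<gamma>) *\<^sub>R y"
  define k where "k = l \<bullet> w0 - g w0"
  have le: "l \<bullet> w - g w \<le> k" for w
  proof (rule field_le_epsilon)
    fix e :: real assume "0 < e"
    then have "y \<bullet> w + \<gamma> * (g w + e) \<le> y \<bullet> w0 + \<gamma> * g w0" by (intro Sle) simp
    then have "(1 / - \<gamma>) * (y \<bullet> w + \<gamma> * (g w + e)) \<le> (1 / - \<gamma>) * (y \<bullet> w0 + \<gamma> * g w0)"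
      using \<gamma> by (intro mult_left_mono) auto
    then show "l \<bullet> w - g w \<le> k + e" using \<gamma> by (simp add: l_def k_def field_simps)
  qed
  have g0: "g 0 = 0" using hom[of 0 0] by simp
  have "l \<bullet> (2 *\<^sub>R w0) - g (2 *\<^sub>R w0) = 2 * k" using hom[of 2 w0] by (simp add: k_def)
  then have "k = 0" using le[of "2 *\<^sub>R w0"] le[of 0] g0 by simp
  then show ?thesis using le by (intro exI[of _ l]) (auto simp: k_def)
qed

lemma linear_inner_representation:
  fixes f :: "'a::euclidean_space \<Rightarrow> real"
  assumes "linear f" shows "f x = (\<Sum>b\<in>Basis. f b *\<^sub>R b) \<bullet> x"
proof -
  have "f x = f (\<Sum>b\<in>Basis. (x \<bullet> b) *\<^sub>R b)" by (simp add: euclidean_representation)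
  also have "\<dots> = (\<Sum>b\<in>Basis. (x \<bullet> b) * f b)" by (simp add: linear_sum[OF assms] linear_scale[OF assms])
  finally show ?thesis by (simp add: inner_sum_left inner_commute[of x] mult.commute)
qed

text \<open>The usual discriminant argument for the form at x + t e; if the form vanishes at e, the
  expression is affine in t and must have slope 0.\<close>

lemma psd_cauchy_schwarz:
  fixes \<beta> :: "'a::real_vector \<Rightarrow> 'a \<Rightarrow> real"
  assumes b: "bilinear \<beta>" and sym: "\<And>x y. \<beta> x y = \<beta> y x" and psd: "\<And>x. 0 \<le> \<beta> x x"
  shows "(\<beta> x e)\<^sup>2 \<le> \<beta> x x * \<beta> e e"
proof -
  have ex: "0 \<le> \<beta> x x + 2 * t * \<beta> x e + t\<^sup>2 * \<beta> e e" for t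
  proof -
    have "\<beta> (x + t *\<^sub>R e) (x + t *\<^sub>R e) = \<beta> x x + 2 * t * \<beta> x e + t\<^sup>2 * \<beta> e e"
      using sym[of e x]
      by (simp add: bilinear_ladd[OF b] bilinear_radd[OF b] bilinear_lmul[OF b] bilinear_rmul[OF b] power2_eq_square algebra_simps)
    then show ?thesis using psd[of "x + t *\<^sub>R e"] by simp
  qed
  show ?thesis
  proof (cases "\<beta> e e = 0")
    case True
    have "\<beta> x e = 0"
    proof (rule ccontr)
      assume "\<beta> x e \<noteq> 0"
      \<comment> \<open>At this t the affine expression would equal -1.\<close>
      then show False using ex[of "- (\<beta> x x + 1) / (2 * \<beta> x e)"] True by (simp add: field_simps)
    qed
    then show ?thesis using True by simp
  next
    case False
    then have "0 < \<beta> e e" using psd[of e] by simp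
    then show ?thesis using ex[of "- \<beta> x e / \<beta> e e"] by (simp add: field_simps power2_eq_square)
  qed
qed

text \<open>Gaussian elimination: subtracting the rank-one form \<open>\<beta> x e * \<beta> y e / \<beta> e e\<close> kills one diagonal entry.\<close>

lemma psd_sum_of_squares:
  fixes \<beta> :: "'a::euclidean_space \<Rightarrow> 'a \<Rightarrow> real"
  assumes "bilinear \<beta>" "\<And>x y. \<beta> x y = \<beta> y x" "\<And>x. 0 \<le> \<beta> x x"
  shows "\<exists>n c. \<forall>x y. \<beta> x y = (\<Sum>k<(n::nat). (c k \<bullet> x) * (c k \<bullet> y))"
  using assms
proof (induction "card {e \<in> Basis. \<beta> e e \<noteq> 0}" arbitrary: \<beta> rule: less_induct)
  case less
  note b = less.prems(1) and sym = less.prems(2) and psd = less.prems(3)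
  note cs = psd_cauchy_schwarz[OF b sym psd]
  show ?case
  proof (cases "\<exists>e\<in>Basis. \<beta> e e \<noteq> 0")
    case False
    have l: "linear (\<lambda>x. \<beta> x y)" for y using b by (simp add: bilinear_def)
    have z: "\<beta> x e = 0" if "e \<in> Basis" for x e using cs[of x e] False that by simp
    have "\<beta> x y = 0" for x y
    proof -
      have "\<beta> x y = (\<Sum>b\<in>Basis. \<beta> b y *\<^sub>R b) \<bullet> x" by (rule linear_inner_representation[OF l])
      then show ?thesis using z sym by simp
    qed
    then show ?thesis by (intro exI[of _ "0::nat"] exI[of _ "\<lambda>_. 0"]) simp
  next
    case True
    then obtain e where e: "e \<in> Basis" "\<beta> e e \<noteq> 0" by blast
    then have pos: "0 < \<beta> e e" using psd[of e] by simp
    define \<gamma> where "\<gamma> x y = \<beta> x y - \<beta> x e * \<beta> y e / \<beta> e e" for x y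
    have bil: "bilinear \<gamma>"
      unfolding bilinear_def \<gamma>_def
      by (auto intro!: linearI simp: bilinear_ladd[OF b] bilinear_radd[OF b] bilinear_lmul[OF b] bilinear_rmul[OF b]
          algebra_simps add_divide_distrib)
    have symg: "\<gamma> x y = \<gamma> y x" for x y using sym by (simp add: \<gamma>_def mult.commute)
    have psdg: "0 \<le> \<gamma> x x" for x
      using cs[of x e] pos by (simp add: \<gamma>_def field_simps power2_eq_square)
    \<comment> \<open>By the Cauchy-Schwarz inequality, diagonal entries that are already zero stay
      zero; the entry at e becomes zero, so the induction measure drops.\<close>
    have zero: "\<gamma> f f = 0" if "\<beta> f f = 0" for f
      using cs[of f e] that by (simp add: \<gamma>_def)
    have "{f \<in> Basis. \<gamma> f f \<noteq> 0} \<subset> {f \<in> Basis. \<beta> f f \<noteq> 0}"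
    proof -
      have "\<gamma> e e = 0" by (simp add: \<gamma>_def)
      then show ?thesis using zero e by auto
    qed
    then have "card {f \<in> Basis. \<gamma> f f \<noteq> 0} < card {f \<in> Basis. \<beta> f f \<noteq> 0}"
      by (intro psubset_card_mono) auto
    from less.hyps[OF this bil symg psdg] obtain n c where c: "\<And>x y. \<gamma> x y = (\<Sum>k<(n::nat). (c k \<bullet> x) * (c k \<bullet> y))" by blast
    define d where "d = (1 / sqrt (\<beta> e e)) *\<^sub>R (\<Sum>b\<in>Basis. \<beta> b e *\<^sub>R b)"
    have "linear (\<lambda>x. \<beta> x e)" using b by (simp add: bilinear_def)
    then have d: "d \<bullet> x = \<beta> x e / sqrt (\<beta> e e)" for x
      using linear_inner_representation[of "\<lambda>x. \<beta> x e" x] by (simp add: d_def)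
    have "\<beta> x y = (\<Sum>k<Suc n. ((c(n := d)) k \<bullet> x) * ((c(n := d)) k \<bullet> y))" for x y
    proof -
      have "\<beta> x y = \<gamma> x y + (d \<bullet> x) * (d \<bullet> y)" using pos by (simp add: \<gamma>_def d)
      then show ?thesis by (simp add: c)
    qed
    then show ?thesis by blast
  qed
qed

lemma sum_even_odd: "(\<Sum>i<2 * (n::nat). f i) = (\<Sum>k<n. f (2 * k) + f (2 * k + 1))"
  for f :: "nat \<Rightarrow> 'b::comm_monoid_add"
  by (induction n) (simp_all add: add.assoc)

text \<open>Each vector serves as a jump in both directions, which centers the walk. The factor s =
  sqrt (n + 1) cancels the probability 1/N of a single jump.\<close>

lemma walk_from_squares:
  fixes c :: "nat \<Rightarrow> 'z::euclidean_space" and q :: 'z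
  shows "\<exists>N a. walk N a \<and> (\<forall>D B. walk.gen N a q D B = q \<bullet> D + (\<Sum>k<n. 1/2 * (blinfun_apply B (c k) \<bullet> c k)))"
proof -
  \<comment> \<open>One zero vector is appended at index n, so that there are jumps even if n =
    0.\<close>
  define c' where "c' k = (if k < n then c k else 0)" for k
  define s where "s = sqrt (real (Suc n))"
  define a where "a i = (if even i then s else - s) *\<^sub>R c' (i div 2)" for i
  define N where "N = 2 * Suc n"
  have w: "walk N a"
    unfolding walk_def N_def sum_even_odd by (simp add: a_def)
  interpret walk N a q by (rule w)
  have "gen D B = q \<bullet> D + (\<Sum>k<n. 1/2 * (blinfun_apply B (c k) \<bullet> c k))" for D B
  proof -
    have sq: "s * s = real (Suc n)" by (simp add: s_def)
    have "(\<Sum>i<N. 1/2 * (blinfun_apply B (a i) \<bullet> a i)) = (\<Sum>k<Suc n. real (Suc n) * (blinfun_apply B (c' k) \<bullet> c' k))"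
      unfolding N_def sum_even_odd sq[symmetric] by (simp add: a_def blinfun.scaleR_right blinfun.minus_right mult_ac)
    also have "\<dots> = real (Suc n) * (\<Sum>k<Suc n. blinfun_apply B (c' k) \<bullet> c' k)" by (rule sum_distrib_left[symmetric])
    also have "(\<Sum>k<Suc n. blinfun_apply B (c' k) \<bullet> c' k) = (\<Sum>k<n. blinfun_apply B (c k) \<bullet> c k)"
      by (simp add: c'_def)
    finally have "trace_part B = (1 / real N) * (real (Suc n) * (\<Sum>k<n. blinfun_apply B (c k) \<bullet> c k))"
      by (simp add: trace_part_def)
    also have "\<dots> = 1/2 * (\<Sum>k<n. blinfun_apply B (c k) \<bullet> c k)" by (simp add: N_def field_simps)
    finally show ?thesis by (simp add: gen_def sum_distrib_left)
  qed
  then show ?thesis using w by blast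
qed

definition outer :: "real ^ 'd \<Rightarrow> real ^ 'd \<Rightarrow> real ^ 'd ^ 'd" where
  "outer x y = (\<chi> i j. x $ i * y $ j)"

lemma outer_mult: "outer x y *v z = (y \<bullet> z) *\<^sub>R x"
  by (simp add: outer_def matrix_vector_mult_def vec_eq_iff inner_vec_def sum_distrib_left mult_ac)

lemma bilinear_outer: "bilinear outer"
  unfolding bilinear_def by (auto intro!: linearI simp: outer_def vec_eq_iff algebra_simps)

lemma matrix_inner: "M \<bullet> A = (\<Sum>i\<in>UNIV. \<Sum>j\<in>UNIV. A $ i $ j * (M $ i $ j))" for M A :: "real ^ 'd ^ 'd"
  by (simp add: inner_vec_def mult.commute)

lemma inner_outer_axis: "M \<bullet> outer (axis i 1) (axis j 1) = M $ i $ j" for M :: "real ^ 'd ^ 'd"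
proof -
  have "M \<bullet> outer (axis i 1) (axis j 1) = (\<Sum>k\<in>UNIV. \<Sum>l\<in>UNIV. if k = i then if l = j then M $ k $ l else 0 else 0)"
    unfolding matrix_inner by (intro sum.cong refl) (auto simp: outer_def axis_def)
  also have "\<dots> = (\<Sum>k\<in>UNIV. if k = i then \<Sum>l\<in>UNIV. if l = j then M $ k $ l else 0 else 0)"
    by (intro sum.cong refl) auto
  finally show ?thesis by simp
qed

lemma quadratic_form_expand: "(A *v c) \<bullet> c = (\<Sum>i\<in>UNIV. \<Sum>j\<in>UNIV. A $ i $ j * (c $ i * c $ j))" for A :: "real ^ 'd ^ 'd"
  by (simp add: inner_vec_def matrix_vector_mult_def sum_distrib_left sum_distrib_right mult_ac)

text \<open>Let (q, M) be a supporting functional. Ellipticity makes M nonpositive on matrices with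
  nonpositive quadratic form. For \<open>outer x y - outer y x\<close>, whose form vanishes, this
  shows that M is symmetric, and for \<open>- outer x x\<close> that M is positive semidefinite;
  hence M is a sum of squares.\<close>

lemma elliptic_operator_support:
  fixes g :: "real ^ 'd \<Rightarrow> real ^ 'd ^ 'd \<Rightarrow> real"
  assumes sub: "\<And>p p' A A'. g (p + p') (A + A') \<le> g p A + g p' A'"
    and hom: "\<And>c p A. 0 \<le> c \<Longrightarrow> g (c *\<^sub>R p) (c *\<^sub>R A) = c * g p A"
    and ell: "\<And>A. (\<And>x. (A *v x) \<bullet> x \<le> 0) \<Longrightarrow> g 0 A \<le> 0"
  shows "\<exists>q n c. q \<bullet> p0 + (\<Sum>k<n. 1/2 * ((A0 *v c k) \<bullet> c k)) = g p0 A0 \<and>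
    (\<forall>p A. q \<bullet> p + (\<Sum>k<(n::nat). 1/2 * ((A *v c k) \<bullet> c k)) \<le> g p A)"
proof -
  have "\<exists>l. (\<forall>w. l \<bullet> w \<le> g (fst w) (snd w)) \<and> l \<bullet> (p0, A0) = g (fst (p0, A0)) (snd (p0, A0))"
    by (rule sublinear_support) (simp_all add: sub hom)
  then obtain l where l1: "\<forall>w. l \<bullet> w \<le> g (fst w) (snd w)" and l2: "l \<bullet> (p0, A0) = g (fst (p0, A0)) (snd (p0, A0))"
    by (elim exE conjE) (rule that)
  have l: "l \<bullet> w \<le> g (fst w) (snd w)" "l \<bullet> (p0, A0) = g p0 A0" for w
    using l1 l2 by (blast, simp)
  define q where "q = fst l"
  define M where "M = snd l"
  have lM: "l \<bullet> (p, A) = q \<bullet> p + M \<bullet> A" for p A by (simp add: q_def M_def inner_prod_def)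
  have neg: "M \<bullet> A \<le> 0" if "\<And>x. (A *v x) \<bullet> x \<le> 0" for A
    using l(1)[of "(0, A)"] ell[OF that] lM[of 0 A] by simp
  define \<beta> where "\<beta> x y = M \<bullet> outer x y" for x y
  have bil: "bilinear \<beta>"
    unfolding bilinear_def \<beta>_def
    by (auto intro!: linearI simp: bilinear_ladd[OF bilinear_outer] bilinear_radd[OF bilinear_outer]
        bilinear_lmul[OF bilinear_outer] bilinear_rmul[OF bilinear_outer] inner_add_right)
  have symle: "\<beta> x y \<le> \<beta> y x" for x y
    using neg[of "outer x y - outer y x"]
    by (simp add: \<beta>_def matrix_vector_mult_diff_rdistrib outer_mult inner_diff_left inner_diff_right inner_commute)
  have sym: "\<beta> x y = \<beta> y x" for x y using symle[of x y] symle[of y x] by simp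
  have psd: "0 \<le> \<beta> x x" for x
  proof -
    have "- outer x x *v z = - ((x \<bullet> z) *\<^sub>R x)" for z
      by (simp add: outer_mult[symmetric] matrix_vector_mult_def vec_eq_iff sum_negf)
    then show ?thesis using neg[of "- outer x x"] by (simp add: \<beta>_def)
  qed
  obtain n c where c: "\<And>x y. \<beta> x y = (\<Sum>k<(n::nat). (c k \<bullet> x) * (c k \<bullet> y))"
    using psd_sum_of_squares[OF bil sym psd] by blast
  \<comment> \<open>The factor sqrt 2 absorbs the 1/2 in the generator.\<close>
  have "M \<bullet> A = (\<Sum>k<n. 1/2 * ((A *v (sqrt 2 *\<^sub>R c k)) \<bullet> (sqrt 2 *\<^sub>R c k)))" for A
  proof -
    have "M $ i $ j = (\<Sum>k<n. c k $ i * c k $ j)" for i j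
      using c[of "axis i 1" "axis j 1"] by (simp add: \<beta>_def inner_outer_axis inner_axis)
    then have "M \<bullet> A = (\<Sum>i\<in>UNIV. \<Sum>j\<in>UNIV. \<Sum>k<n. A $ i $ j * (c k $ i * c k $ j))"
      by (simp add: matrix_inner sum_distrib_left)
    also have "\<dots> = (\<Sum>k<n. \<Sum>i\<in>UNIV. \<Sum>j\<in>UNIV. A $ i $ j * (c k $ i * c k $ j))"
    proof -
      have "(\<Sum>i\<in>UNIV. \<Sum>j\<in>UNIV. \<Sum>k<n. A $ i $ j * (c k $ i * c k $ j))
        = (\<Sum>i\<in>UNIV. \<Sum>k<n. \<Sum>j\<in>UNIV. A $ i $ j * (c k $ i * c k $ j))"
        by (intro sum.cong refl sum.swap)
      then show ?thesis by (simp only: sum.swap[of _ "{..<n}" UNIV])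
    qed
    also have "\<dots> = (\<Sum>k<n. (A *v c k) \<bullet> c k)" by (simp add: quadratic_form_expand)
    also have "\<dots> = (\<Sum>k<n. 1/2 * ((A *v (sqrt 2 *\<^sub>R c k)) \<bullet> (sqrt 2 *\<^sub>R c k)))"
      by (simp add: matrix_vector_mult_scaleR mult.assoc[symmetric])
    finally show ?thesis .
  qed
  then have "q \<bullet> p + (\<Sum>k<n. 1/2 * ((A *v (sqrt 2 *\<^sub>R c k)) \<bullet> (sqrt 2 *\<^sub>R c k))) = l \<bullet> (p, A)" for p A
    by (simp add: lM)
  then show ?thesis using l by (intro exI[of _ q] exI[of _ n] exI[of _ "\<lambda>k. sqrt 2 *\<^sub>R c k"]) auto
qed

lemma xx_block_mult: "xx_block B *v x = fst (blinfun_apply B (x, 0))"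
proof -
  have "linear (\<lambda>h. fst (blinfun_apply B (h, 0)))"
  proof (rule linearI)
    show "fst (blinfun_apply B (x + y, 0)) = fst (blinfun_apply B (x, 0)) + fst (blinfun_apply B (y, 0))" for x y
      using blinfun.add_right[of B "(x, 0)" "(y, 0)"] by (simp add: plus_prod_def)
    show "fst (blinfun_apply B (r *\<^sub>R x, 0)) = r *\<^sub>R fst (blinfun_apply B (x, 0))" for r x
      using blinfun.scaleR_right[of B r "(x, 0)"] by (simp add: scaleR_prod_def)
  qed
  then show ?thesis by (simp add: xx_block_def matrix_works)
qed

text \<open>The jumps (c k, 0) move x only and the drift (0, q) moves y only, so the generator sees
  exactly the y-gradient and the x-x block.\<close>

lemma elliptic_sup_of_gens:
  fixes g :: "real ^ 'd \<Rightarrow> real ^ 'd ^ 'd \<Rightarrow> real"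
  assumes sub: "\<And>p p' A A'. g (p + p') (A + A') \<le> g p A + g p' A'"
    and hom: "\<And>c p A. 0 \<le> c \<Longrightarrow> g (c *\<^sub>R p) (c *\<^sub>R A) = c * g p A"
    and ell: "\<And>A. (\<And>x. (A *v x) \<bullet> x \<le> 0) \<Longrightarrow> g 0 A \<le> 0"
  shows "sup_of_gens (\<lambda>D B. g (snd D) (xx_block B))"
  unfolding sup_of_gens_def
proof (intro allI)
  fix D :: "(real ^ 'd) \<times> (real ^ 'd)" and B :: "((real ^ 'd) \<times> (real ^ 'd)) \<Rightarrow>\<^sub>L ((real ^ 'd) \<times> (real ^ 'd))"
  obtain q n c where e: "q \<bullet> snd D + (\<Sum>k<n. 1/2 * ((xx_block B *v c k) \<bullet> c k)) = g (snd D) (xx_block B)"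
    and le: "\<And>p A. q \<bullet> p + (\<Sum>k<(n::nat). 1/2 * ((A *v c k) \<bullet> c k)) \<le> g p A"
    using elliptic_operator_support[OF sub hom ell, of "snd D" "xx_block B"] by blast
  obtain N a where w: "walk N a" and gen: "\<And>D B. walk.gen N a (0, q) D B = (0, q) \<bullet> D + (\<Sum>k<n. 1/2 * (blinfun_apply B (c k, 0) \<bullet> (c k, 0)))"
    using walk_from_squares[where n=n and c="\<lambda>k. (c k, 0)" and q="(0, q)"] by blast
  have gen': "walk.gen N a (0, q) D B = q \<bullet> snd D + (\<Sum>k<n. 1/2 * ((xx_block B *v c k) \<bullet> c k))"
    for D :: "(real ^ 'd) \<times> (real ^ 'd)" and B :: "((real ^ 'd) \<times> (real ^ 'd)) \<Rightarrow>\<^sub>L ((real ^ 'd) \<times> (real ^ 'd))"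
    unfolding gen by (simp add: inner_prod_def xx_block_mult)
  show "\<exists>N a q. walk N a \<and> walk.gen N a q D B = g (snd D) (xx_block B) \<and>
     (\<forall>D' B'. walk.gen N a q D' B' \<le> g (snd D') (xx_block B'))"
    using w gen' e le by (intro exI[of _ N] exI[of _ a] exI[of _ "(0, q)"]) simp
qed

text \<open>The expansion goes backward in time, and its error \<epsilon> (s + |w|^2) fits the
  parabolic scaling. Time is moved first, at fixed z0 + w, using continuity of the time derivative;
  then space at fixed t0, using differentiability of the gradient at z0.\<close>

lemma C12_test_taylor:
  fixes \<psi> :: "real \<Rightarrow> 'z::euclidean_space \<Rightarrow> real"
  assumes test: "C12_test \<psi> \<psi>t D\<psi> H\<psi>" and t0: "0 < t0" and \<epsilon>: "0 < \<epsilon>"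
  shows "\<exists>r>0. r < t0 \<and> r < 1 \<and> (\<forall>s w. 0 \<le> s \<longrightarrow> s < r \<longrightarrow> norm w < r \<longrightarrow>
    \<bar>\<psi> (t0 - s) (z0 + w) - (\<psi> t0 z0 - s * \<psi>t t0 z0 + D\<psi> t0 z0 \<bullet> w + 1/2 * (blinfun_apply (H\<psi> t0 z0) w \<bullet> w))\<bar>
      \<le> \<epsilon> * (s + (norm w)\<^sup>2))"
proof -
  have dt: "((\<lambda>s. \<psi> s z) has_real_derivative \<psi>t t z) (at t)"
    and dg: "GDERIV (\<psi> t) z :> D\<psi> t z" and dh: "(D\<psi> t has_derivative blinfun_apply (H\<psi> t z)) (at z)" if "t > 0" for t z
    using test that by (auto simp: C12_test_def)
  have ct: "continuous_on ({0<..} \<times> UNIV) (\<lambda>p. \<psi>t (fst p) (snd p))"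
    using test by (simp add: C12_test_def case_prod_unfold)
  have "open (({0<..} :: real set) \<times> (UNIV :: 'z set))" by (intro open_Times) auto
  then have "isCont (\<lambda>p. \<psi>t (fst p) (snd p)) (t0, z0)"
    using ct t0 by (auto simp: continuous_on_eq_continuous_at)
  then obtain r1 where r1: "r1 > 0" "\<And>p. dist p (t0, z0) < r1 \<Longrightarrow> dist (\<psi>t (fst p) (snd p)) (\<psi>t t0 z0) < \<epsilon>"
    using \<epsilon> unfolding continuous_at_eps_delta by (metis fst_conv snd_conv)
  obtain r2 where r2: "r2 > 0" "\<And>y. norm (y - z0) < r2 \<Longrightarrow>
      norm (D\<psi> t0 y - D\<psi> t0 z0 - blinfun_apply (H\<psi> t0 z0) (y - z0)) \<le> \<epsilon> * norm (y - z0)"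
    using dh[OF t0, of z0] \<epsilon> unfolding has_derivative_at_alt by blast
  define r where "r = Min {r1 / 2, r2, t0 / 2, 1 / 2}"
  have r: "0 < r" "r \<le> r1 / 2" "r \<le> r2" "r < t0" "r < 1" using r1 r2 t0 by (auto simp: r_def)
  show ?thesis
  proof (intro exI[of _ r] conjI r allI impI)
    fix s and w :: 'z assume s: "0 \<le> s" "s < r" and w: "norm w < r"
    define z where "z = z0 + w"
    let ?T = "{t0 - s..t0}"
    have 1: "norm ((\<psi> t0 z - t0 * \<psi>t t0 z0) - (\<psi> (t0 - s) z - (t0 - s) * \<psi>t t0 z0)) \<le> \<epsilon> * norm (t0 - (t0 - s))"
    proof (rule field_differentiable_bound[of ?T "\<lambda>\<tau>. \<psi> \<tau> z - \<tau> * \<psi>t t0 z0" "\<lambda>\<tau>. \<psi>t \<tau> z - \<psi>t t0 z0"])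
      fix \<tau> assume \<tau>: "\<tau> \<in> ?T"
      then have "0 < \<tau>" using s r by auto
      then show "((\<lambda>\<tau>. \<psi> \<tau> z - \<tau> * \<psi>t t0 z0) has_field_derivative \<psi>t \<tau> z - \<psi>t t0 z0) (at \<tau> within ?T)"
      proof -
        assume "0 < \<tau>"
        then have "((\<lambda>\<tau>. \<psi> \<tau> z - \<tau> * \<psi>t t0 z0) has_field_derivative \<psi>t \<tau> z - 1 * \<psi>t t0 z0) (at \<tau>)"
          by (intro DERIV_diff dt DERIV_cmult_right DERIV_ident)
        then show ?thesis using DERIV_subset by fastforce
      qed
      have "dist (\<tau>, z) (t0, z0) \<le> dist \<tau> t0 + dist z z0"
        using sqrt_sum_squares_le_sum[of "dist \<tau> t0" "dist z z0"] by (simp add: dist_Pair_Pair)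
      also have "dist \<tau> t0 \<le> s" using \<tau> by (auto simp: dist_real_def)
      also have "dist z z0 = norm w" by (simp add: z_def dist_norm)
      also have "s + norm w < r1" using s w r by linarith
      finally show "norm (\<psi>t \<tau> z - \<psi>t t0 z0) \<le> \<epsilon>" using r1(2)[of "(\<tau>, z)"] by (simp add: dist_norm)
    qed (use s in auto)
    have 2: "norm ((\<psi> t0 z - D\<psi> t0 z0 \<bullet> w - 1/2 * (blinfun_apply (H\<psi> t0 z0) w \<bullet> w)) - \<psi> t0 z0)
       \<le> \<epsilon> * (norm w)\<^sup>2 * norm (1 - 0 :: real)"
    proof -
      define \<phi> where "\<phi> \<tau> = \<psi> t0 (z0 + \<tau> *\<^sub>R w) - \<tau> * (D\<psi> t0 z0 \<bullet> w) - 1/2 * \<tau>\<^sup>2 * (blinfun_apply (H\<psi> t0 z0) w \<bullet> w)" for \<tau> :: real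
      define \<phi>' where "\<phi>' \<tau> = (D\<psi> t0 (z0 + \<tau> *\<^sub>R w) - D\<psi> t0 z0 - blinfun_apply (H\<psi> t0 z0) (\<tau> *\<^sub>R w)) \<bullet> w" for \<tau> :: real
      have "norm (\<phi> 1 - \<phi> 0) \<le> \<epsilon> * (norm w)\<^sup>2 * norm (1 - 0 :: real)"
      proof (rule field_differentiable_bound[of "{0..1}" \<phi> \<phi>'])
        fix \<tau> :: real assume \<tau>: "\<tau> \<in> {0..1}"
        have line: "((\<lambda>t. z0 + t *\<^sub>R w) has_derivative (\<lambda>s. s *\<^sub>R w)) (at \<tau>)"
          by (auto intro!: derivative_eq_intros)
        have "(\<psi> t0 has_derivative (\<lambda>h. h \<bullet> D\<psi> t0 (z0 + \<tau> *\<^sub>R w))) (at (z0 + \<tau> *\<^sub>R w))"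
          using dg[OF t0] by (simp add: gderiv_def)
        from has_derivative_compose[OF line this]
        have "((\<lambda>t. \<psi> t0 (z0 + t *\<^sub>R w)) has_real_derivative D\<psi> t0 (z0 + \<tau> *\<^sub>R w) \<bullet> w) (at \<tau>)"
          by (simp add: has_field_derivative_def inner_commute mult_commute_abs)
        moreover have "((\<lambda>t. t * (D\<psi> t0 z0 \<bullet> w)) has_real_derivative D\<psi> t0 z0 \<bullet> w) (at \<tau>)"
          "((\<lambda>t. 1/2 * t\<^sup>2 * (blinfun_apply (H\<psi> t0 z0) w \<bullet> w)) has_real_derivative \<tau> * (blinfun_apply (H\<psi> t0 z0) w \<bullet> w)) (at \<tau>)"
          by (auto intro!: derivative_eq_intros)
        ultimately have "(\<phi> has_real_derivative D\<psi> t0 (z0 + \<tau> *\<^sub>R w) \<bullet> w - D\<psi> t0 z0 \<bullet> w - \<tau> * (blinfun_apply (H\<psi> t0 z0) w \<bullet> w)) (at \<tau>)"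
          unfolding \<phi>_def by (intro DERIV_diff)
        then have "(\<phi> has_real_derivative \<phi>' \<tau>) (at \<tau>)"
          by (simp add: \<phi>'_def inner_diff_left blinfun.scaleR_right)
        then show "(\<phi> has_field_derivative \<phi>' \<tau>) (at \<tau> within {0..1})" by (rule DERIV_subset) simp
        have n: "norm (\<tau> *\<^sub>R w) \<le> norm w" using \<tau> by (intro norm_scale_le) auto
        have "\<bar>\<phi>' \<tau>\<bar> \<le> norm (D\<psi> t0 (z0 + \<tau> *\<^sub>R w) - D\<psi> t0 z0 - blinfun_apply (H\<psi> t0 z0) (\<tau> *\<^sub>R w)) * norm w"
          unfolding \<phi>'_def by (rule Cauchy_Schwarz_ineq2)
        also have "\<dots> \<le> (\<epsilon> * norm (\<tau> *\<^sub>R w)) * norm w"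
          using r2(2)[of "z0 + \<tau> *\<^sub>R w"] n w r by (intro mult_right_mono) auto
        also have "\<dots> \<le> (\<epsilon> * norm w) * norm w" using n \<epsilon> by (intro mult_right_mono mult_left_mono) auto
        finally show "norm (\<phi>' \<tau>) \<le> \<epsilon> * (norm w)\<^sup>2" by (simp add: power2_eq_square mult_ac)
      qed auto
      then show ?thesis by (simp add: \<phi>_def z_def)
    qed
    show "\<bar>\<psi> (t0 - s) (z0 + w) - (\<psi> t0 z0 - s * \<psi>t t0 z0 + D\<psi> t0 z0 \<bullet> w + 1/2 * (blinfun_apply (H\<psi> t0 z0) w \<bullet> w))\<bar>
      \<le> \<epsilon> * (s + (norm w)\<^sup>2)"
      using 1 2 s unfolding z_def[symmetric] by (simp add: algebra_simps abs_le_iff)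
  qed
qed

section \<open>Sublinear expectations of a pair of random vectors\<close>

lemma wl_mult:
  fixes f g :: "'z::real_normed_vector \<Rightarrow> real"
  assumes f: "wl C m f" and g: "wl C' m' g"
  shows "wl (3 * C * C') (m + m') (\<lambda>z. f z * g z)"
proof (rule wlI)
  note C = wl_nonneg[OF f] and C' = wl_nonneg[OF g]
  fix z z'
  have "\<bar>f z * g z\<bar> \<le> (C * wt m z) * (C' * wt m' z)"
    unfolding abs_mult using wl_growth[OF f, of z] wl_growth[OF g, of z] C wt_pos[of m z] by (intro mult_mono) auto
  also have "\<dots> = 1 * (C * C' * wt (m + m') z)" by (simp add: wt_add)
  also have "\<dots> \<le> 3 * (C * C' * wt (m + m') z)"
    using C C' wt_pos[of "m + m'" z] by (intro mult_right_mono) auto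
  finally show "norm (f z * g z) \<le> 3 * C * C' * wt (m + m') z" by simp
  \<comment> \<open>Mixed products of weights are dominated by the product at the point of larger
    norm.\<close>
  have cross: "wt m a * wt m' b \<le> wt (m + m') a + wt (m + m') b" for a b :: 'z
  proof (cases "norm a \<le> norm b")
    case True
    then have "wt m a * wt m' b \<le> wt m b * wt m' b"
      using wt_norm_mono[OF True, of m] wt_pos[of m' b] by (intro mult_right_mono) auto
    then show ?thesis using wt_pos[of "m + m'" a] by (simp add: wt_add)
  next
    case False
    then have "wt m a * wt m' b \<le> wt m a * wt m' a"
      using wt_norm_mono[of b a m'] wt_pos[of m a] by (intro mult_left_mono) auto
    then show ?thesis using wt_pos[of "m + m'" b] by (simp add: wt_add)
  qed
  have "f z * g z - f z' * g z' = f z * (g z - g z') + g z' * (f z - f z')" by (simp add: algebra_simps)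
  also have "\<bar>\<dots>\<bar> \<le> \<bar>f z\<bar> * \<bar>g z - g z'\<bar> + \<bar>g z'\<bar> * \<bar>f z - f z'\<bar>"
    by (metis abs_mult abs_triangle_ineq)
  also have "\<dots> \<le> (C * wt m z) * (C' * (wt m' z + wt m' z') * norm (z - z'))
      + (C' * wt m' z') * (C * (wt m z + wt m z') * norm (z - z'))"
    using wl_growth[OF f, of z] wl_growth[OF g, of z'] wl_lip[OF f, of z z'] wl_lip[OF g, of z z'] C C'
      wt_pos[of m z] wt_pos[of m' z'] by (intro add_mono mult_mono) auto
  also have "\<dots> = C * C' * (wt m z * wt m' z + 2 * (wt m z * wt m' z') + wt m z' * wt m' z') * norm (z - z')"
    by (simp add: algebra_simps)
  also have "\<dots> \<le> C * C' * (3 * (wt (m + m') z + wt (m + m') z')) * norm (z - z')"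
    using cross[of z z'] C C' by (intro mult_right_mono mult_left_mono) (auto simp: wt_add)
  finally show "norm (f z * g z - f z' * g z') \<le> 3 * C * C' * (wt (m + m') z + wt (m + m') z') * norm (z - z')"
    by (simp add: mult_ac)
qed

lemma wl_const: "wl \<bar>c\<bar> m (\<lambda>_. c :: real)"
proof (rule wlI)
  fix z z' :: 'a
  show "norm c \<le> \<bar>c\<bar> * wt m z" using mult_left_mono[OF wt_ge_1[of m z], of "\<bar>c\<bar>"] by simp
  show "norm (c - c) \<le> \<bar>c\<bar> * (wt m z + wt m z') * norm (z - z')" using wt_pos[of m z] wt_pos[of m z'] by simp
qed

lemma wl_wt: "\<exists>C. wl C m (wt m :: 'z::real_normed_vector \<Rightarrow> real)"
proof (induction m)
  case 0
  show ?case by (rule exI[of _ 1]) (simp add: wl_def wt_def)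
next
  case (Suc m)
  then obtain C where C: "wl C m (wt m :: 'z \<Rightarrow> real)" by blast
  have "wl 1 1 (\<lambda>z :: 'z. 1 + (norm z)\<^sup>2)"
  proof (rule wlI)
    fix z z' :: 'z
    show "norm (1 + (norm z)\<^sup>2) \<le> 1 * wt 1 z" by (simp add: wt_def)
    have "\<bar>(norm z)\<^sup>2 - (norm z')\<^sup>2\<bar> = (norm z + norm z') * \<bar>norm z - norm z'\<bar>"
      by (simp add: power2_eq_square square_diff_square_factored abs_mult)
    also have "\<dots> \<le> (wt 1 z + wt 1 z') * norm (z - z')"
      using norm_le_wt[of z] norm_le_wt[of z'] norm_triangle_ineq3[of z z'] wt_pos[of 1 z] wt_pos[of 1 z']
      by (intro mult_mono add_mono) auto
    finally show "norm (1 + (norm z)\<^sup>2 - (1 + (norm z')\<^sup>2)) \<le> 1 * (wt 1 z + wt 1 z') * norm (z - z')" by simp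
  qed
  from wl_mult[OF this C] have "wl (3 * 1 * C) (Suc m) (wt (Suc m) :: 'z \<Rightarrow> real)"
    by (simp add: wt_Suc[abs_def])
  then show ?case by blast
qed

lemma wt_linear_le:
  assumes "norm v \<le> K * norm w" "1 \<le> K" shows "wt m v \<le> K ^ (2 * m) * wt m w"
proof -
  have "(norm v)\<^sup>2 \<le> (K * norm w)\<^sup>2" using assms by (intro power_mono) auto
  moreover have "1 \<le> K\<^sup>2" using assms by simp
  ultimately have "1 + (norm v)\<^sup>2 \<le> K\<^sup>2 * (1 + (norm w)\<^sup>2)" by (simp add: power_mult_distrib algebra_simps)
  then have "wt m v \<le> (K\<^sup>2 * (1 + (norm w)\<^sup>2)) ^ m" unfolding wt_def by (intro power_mono) auto
  then show ?thesis by (simp add: wt_def power_mult_distrib power_mult)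
qed

lemma wt_affine_le:
  assumes "norm v \<le> K * norm w" "1 \<le> K" shows "wt m (z + v) \<le> (2 ^ m * K ^ (2 * m)) * wt m w * wt m z"
proof -
  have "2 ^ m * wt m z * wt m v \<le> 2 ^ m * wt m z * (K ^ (2 * m) * wt m w)"
    using wt_linear_le[OF assms, of m] wt_pos[of m z] by (intro mult_left_mono) auto
  then show ?thesis using wt_shift[of m z v] by (simp add: mult_ac)
qed

lemma wl_affine:
  fixes L :: "'w::real_normed_vector \<Rightarrow> 'z::real_normed_vector"
  assumes f: "wl C m f" and L: "\<And>w w'. L (w - w') = L w - L w'" "\<And>w. norm (L w) \<le> K * norm w" "1 \<le> K"
  shows "wl (C * (2 ^ m * K ^ (2 * m)) * wt m z * K) m (\<lambda>w. f (z + L w))"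
proof (rule wlI)
  note C = wl_nonneg[OF f]
  define A where "A = C * (2 ^ m * K ^ (2 * m)) * wt m z"
  have A: "0 \<le> A" using C L(3) wt_pos[of m z] by (simp add: A_def)
  have w: "C * wt m (z + L w) \<le> A * wt m w" for w :: 'w
    using mult_left_mono[OF wt_affine_le[OF L(2,3), of m z w] C] by (simp add: A_def mult_ac)
  fix w w' :: 'w
  have AK: "A * wt m w * 1 \<le> A * wt m w * K" using A wt_pos[of m w] L(3) by (intro mult_left_mono) auto
  then show "norm (f (z + L w)) \<le> C * (2 ^ m * K ^ (2 * m)) * wt m z * K * wt m w"
    using wl_growth[OF f, of "z + L w"] w[of w] unfolding A_def[symmetric] by (simp add: mult_ac)
  have "norm (f (z + L w) - f (z + L w')) \<le> (C * wt m (z + L w) + C * wt m (z + L w')) * norm (L (w - w'))"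
    using wl_lip[OF f, of "z + L w" "z + L w'"] by (simp add: L(1) algebra_simps)
  also have "\<dots> \<le> (A * wt m w + A * wt m w') * (K * norm (w - w'))"
    by (rule mult_mono[OF add_mono[OF w[of w] w[of w']] L(2)])
       (use A wt_pos[of m w] wt_pos[of m w'] in auto)
  also have "\<dots> = A * K * (wt m w + wt m w') * norm (w - w')" by (simp add: algebra_simps)
  finally show "norm (f (z + L w) - f (z + L w')) \<le> C * (2 ^ m * K ^ (2 * m)) * wt m z * K * (wt m w + wt m w') * norm (w - w')"
    by (simp add: A_def)
qed

section \<open>Closure properties of \<open>C_lLip\<close>\<close>

lemma C_lLip_wl: "wl C m f \<Longrightarrow> f \<in> C_lLip" for f :: "'z::real_normed_vector \<Rightarrow> real"
  using C_lLip_iff_wl by blast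

lemma C_lLip_add:
  fixes f g :: "'z::real_normed_vector \<Rightarrow> real"
  assumes "f \<in> C_lLip" "g \<in> C_lLip" shows "(\<lambda>z. f z + g z) \<in> C_lLip"
proof -
  obtain C m C' m' where f: "wl C m f" and g: "wl C' m' g" using assms C_lLip_iff_wl by blast
  have "wl C (max m m') f" "wl C' (max m m') g" using wl_weaken f g by (meson max.cobounded1 max.cobounded2 order_refl)+
  then show ?thesis using wl_add C_lLip_wl by blast
qed

lemma C_lLip_cmult: "f \<in> C_lLip \<Longrightarrow> (\<lambda>z. c * f z) \<in> C_lLip" for f :: "'z::real_normed_vector \<Rightarrow> real"
  using wl_scaleR C_lLip_iff_wl by (metis (no_types, lifting) ext real_scaleR_def)

lemma C_lLip_diff: "f \<in> C_lLip \<Longrightarrow> g \<in> C_lLip \<Longrightarrow> (\<lambda>z. f z - g z) \<in> C_lLip"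
  for f g :: "'z::real_normed_vector \<Rightarrow> real"
  using C_lLip_add[of f "\<lambda>z. (-1) * g z"] C_lLip_cmult[of g "-1"] by simp

lemma C_lLip_const: "(\<lambda>_. c) \<in> C_lLip"
  using wl_const C_lLip_wl by blast

lemma C_lLip_wt: "wt m \<in> C_lLip"
  using wl_wt C_lLip_wl by blast

lemma C_lLip_mult:
  "f \<in> C_lLip \<Longrightarrow> g \<in> C_lLip \<Longrightarrow> (\<lambda>z. f z * g z) \<in> C_lLip" for f g :: "'z::real_normed_vector \<Rightarrow> real"
  using wl_mult C_lLip_iff_wl by metis

lemma C_lLip_bounded_linear:
  assumes "bounded_linear f" shows "f \<in> C_lLip"
proof -
  interpret bounded_linear f by fact
  obtain K where K: "0 \<le> K" "\<And>x. norm (f x) \<le> norm x * K" using nonneg_bounded by blast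
  have "wl K 1 f"
  proof (rule wlI)
    fix z z'
    show "norm (f z) \<le> K * wt 1 z"
      using K(2)[of z] mult_left_mono[OF norm_le_wt[of z] K(1)] by (simp add: mult.commute)
    have "norm (z - z') * K \<le> norm (z - z') * K * (wt 1 z + wt 1 z')"
      using K(1) wt_ge_1[of 1 z] wt_ge_1[of 1 z'] mult_left_mono[of 1 "wt 1 z + wt 1 z'" "norm (z - z') * K"] by simp
    then show "norm (f z - f z') \<le> K * (wt 1 z + wt 1 z') * norm (z - z')"
      using K(2)[of "z - z'"] by (simp add: diff mult_ac)
  qed
  then show ?thesis by (rule C_lLip_wl)
qed

lemma C_lLip_inner: "bounded_linear f \<Longrightarrow> bounded_linear g \<Longrightarrow> (\<lambda>z. f z \<bullet> g z) \<in> C_lLip"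
  for f g :: "'z::euclidean_space \<Rightarrow> 'b::euclidean_space"
proof -
  assume fg: "bounded_linear f" "bounded_linear g"
  have s: "(\<lambda>z. \<Sum>b\<in>B. h b z) \<in> C_lLip" if "\<And>b. b \<in> B \<Longrightarrow> h b \<in> C_lLip" "finite B"
    for h :: "'b \<Rightarrow> 'z \<Rightarrow> real" and B
    using that(2,1) by (induction B) (auto intro: C_lLip_const C_lLip_add)
  have "(\<lambda>z. \<Sum>b\<in>Basis. (f z \<bullet> b) * (g z \<bullet> b)) \<in> C_lLip"
    by (intro s C_lLip_mult C_lLip_bounded_linear bounded_linear_compose[OF bounded_linear_inner_left] fg) auto
  then show ?thesis by (simp add: euclidean_inner[symmetric])
qed

section \<open>Parabolic dilations: sqrt t in x, t in y\<close>

definition dil :: "real \<Rightarrow> 'a::real_normed_vector \<times> 'a \<Rightarrow> 'a \<times> 'a" where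
  "dil t w = (sqrt t *\<^sub>R fst w, t *\<^sub>R snd w)"

lemma dil_diff: "dil t (w - w') = dil t w - dil t w'"
  by (simp add: dil_def scaleR_diff_right)

lemma dil_split: "dil t w = sqrt t *\<^sub>R (fst w, 0) + t *\<^sub>R (0, snd w)"
  by (simp add: dil_def)

lemma norm_dil_le: assumes "0 \<le> t" shows "norm (dil t w) \<le> (sqrt t + t) * norm w"
proof -
  have "norm (dil t w) \<le> sqrt t * norm (fst w) + t * norm (snd w)"
    unfolding dil_def using sqrt_sum_squares_le_sum[of "norm (sqrt t *\<^sub>R fst w)" "norm (t *\<^sub>R snd w)"] assms
    by (simp add: norm_Pair)
  also have "\<dots> \<le> sqrt t * norm w + t * norm w"
    using assms norm_fst_le[of "fst w" "snd w"] norm_snd_le[of "snd w" "fst w"] by (intro add_mono mult_left_mono) auto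
  finally show ?thesis by (simp add: algebra_simps)
qed

lemma norm_dil_le2: assumes "0 \<le> t" "t \<le> T" shows "norm (dil t w) \<le> (1 + T) * 2 * norm w"
proof -
  have "0 \<le> (sqrt t - 1)\<^sup>2" by simp
  then have "2 * sqrt t \<le> 1 + t" using assms by (simp add: power2_diff)
  moreover have "0 \<le> sqrt t" using assms by simp
  ultimately have "sqrt t + t \<le> (1 + T) * 2" using assms by (simp add: algebra_simps)
  then have "(sqrt t + t) * norm w \<le> (1 + T) * 2 * norm w" by (intro mult_right_mono) auto
  then show ?thesis using norm_dil_le[OF assms(1), of w] by linarith
qed

lemma norm_dil_small: assumes "0 \<le> s" "s \<le> 1" shows "norm (dil s w) \<le> sqrt s * norm w"
proof -
  have "s\<^sup>2 \<le> s" using assms by (simp add: power2_eq_square mult_left_le)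
  then have "s\<^sup>2 * (norm (snd w))\<^sup>2 \<le> s * (norm (snd w))\<^sup>2" by (intro mult_right_mono) auto
  then have "(norm (dil s w))\<^sup>2 \<le> s * (norm w)\<^sup>2"
    using assms by (simp add: dil_def norm_Pair norm_prod_def power_mult_distrib algebra_simps)
  then show ?thesis
    using assms real_sqrt_le_mono[of "(norm (dil s w))\<^sup>2" "s * (norm w)\<^sup>2"] by (simp add: real_sqrt_mult)
qed

text \<open>Touching is local, but an expectation sees all w. Where |w| \<ge> \<rho>, the
  polynomially growing difference may be multiplied by (|w| / \<rho>)^3; after dilation the cube
  carries s^(3/2), negligible against s. The weight m + 4 has one power for Q and three for the
  cube.\<close>

lemma far_bound:
  fixes V :: "real \<Rightarrow> 'a::euclidean_space \<times> 'a \<Rightarrow> real" and c p :: real and D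
    and B :: "('a \<times> 'a) \<Rightarrow>\<^sub>L ('a \<times> 'a)"
  defines "Q \<equiv> \<lambda>s w. c - s * p + D \<bullet> w + 1/2 * (blinfun_apply B w \<bullet> w)"
  assumes \<rho>: "0 < \<rho>" "\<rho> \<le> 1" and \<epsilon>: "0 \<le> \<epsilon>" and C: "0 \<le> C"
    and V: "\<And>s w. 0 \<le> s \<Longrightarrow> s < \<rho> \<Longrightarrow> \<bar>V s w\<bar> \<le> C * wt m w"
    and near: "\<And>s w. 0 \<le> s \<Longrightarrow> s < \<rho> \<Longrightarrow> norm w < \<rho> \<Longrightarrow> V s w \<le> Q s w + \<epsilon> * (s + (norm w)\<^sup>2)"
  shows "\<exists>K\<ge>0. \<forall>s w. 0 \<le> s \<longrightarrow> s < \<rho> \<longrightarrow>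
     V s (dil s w) - Q s (dil s w) \<le> \<epsilon> * s * wt 1 w + K * (s * sqrt s) * wt (m + 4) w"
proof -
  define C3 where "C3 = C + (\<bar>c\<bar> + \<bar>p\<bar> + norm D + norm B)"
  have C3: "0 \<le> C3" using C by (simp add: C3_def)
  define K where "K = C3 / \<rho> ^ 3"
  have K: "0 \<le> K" using C3 \<rho> by (simp add: K_def)
  have far: "V s w - Q s w \<le> \<epsilon> * (s + (norm w)\<^sup>2) + K * (norm w ^ 3 * wt (m + 1) w)" if s: "0 \<le> s" "s < \<rho>" for s w
  proof (cases "norm w < \<rho>")
    case True
    have "0 \<le> K * (norm w ^ 3 * wt (m + 1) w)" using K wt_pos[of "m + 1" w] by simp
    then show ?thesis using near[OF s True] by linarith
  next
    case False
    have nw: "norm w \<le> 1 + (norm w)\<^sup>2" using norm_le_wt[of w] by (simp add: wt_def)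
    have "- Q s w \<le> \<bar>c\<bar> + s * \<bar>p\<bar> + norm D * norm w + norm B * (norm w)\<^sup>2"
    proof -
      have "\<bar>D \<bullet> w\<bar> \<le> norm D * norm w" by (rule Cauchy_Schwarz_ineq2)
      moreover have "\<bar>blinfun_apply B w \<bullet> w\<bar> \<le> norm B * norm w * norm w"
        using Cauchy_Schwarz_ineq2[of "blinfun_apply B w" w] mult_right_mono[OF norm_blinfun[of B w] norm_ge_zero[of w]] by linarith
      moreover have "s * p \<le> s * \<bar>p\<bar>" using s by (intro mult_left_mono) auto
      moreover have "0 \<le> norm B * (norm w)\<^sup>2" by simp
      ultimately show ?thesis unfolding Q_def by (simp add: power2_eq_square)
    qed
    also have "\<dots> \<le> \<bar>c\<bar> * wt 1 w + \<bar>p\<bar> * wt 1 w + norm D * wt 1 w + norm B * wt 1 w"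
    proof (intro add_mono mult_left_mono)
      show "\<bar>c\<bar> \<le> \<bar>c\<bar> * wt 1 w" using mult_left_mono[OF wt_ge_1[of 1 w], of "\<bar>c\<bar>"] by simp
      have "s * \<bar>p\<bar> \<le> 1 * \<bar>p\<bar>" using s \<rho> by (intro mult_right_mono) auto
      then show "s * \<bar>p\<bar> \<le> \<bar>p\<bar> * wt 1 w" using mult_left_mono[OF wt_ge_1[of 1 w], of "\<bar>p\<bar>"] by simp
    qed (use nw in \<open>auto simp: wt_def\<close>)
    also have "\<dots> \<le> (\<bar>c\<bar> + \<bar>p\<bar> + norm D + norm B) * wt (m + 1) w"
      using wt_mono[of 1 "m + 1" w] by (simp add: distrib_right[symmetric] mult_left_mono)
    finally have q: "- Q s w \<le> (\<bar>c\<bar> + \<bar>p\<bar> + norm D + norm B) * wt (m + 1) w" .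
    have "V s w \<le> C * wt (m + 1) w"
      using V[OF s, of w] mult_left_mono[OF wt_mono[of m "m + 1" w] C] by simp
    then have 1: "V s w - Q s w \<le> C3 * wt (m + 1) w" using q by (simp add: C3_def algebra_simps)
    have "\<rho> ^ 3 \<le> norm w ^ 3" using False \<rho> by (intro power_mono) auto
    then have "C3 * wt (m + 1) w * \<rho> ^ 3 \<le> C3 * wt (m + 1) w * norm w ^ 3"
      using C3 wt_pos[of "m + 1" w] by (intro mult_left_mono) auto
    then have "C3 * wt (m + 1) w \<le> K * (norm w ^ 3 * wt (m + 1) w)"
      using \<rho> by (simp add: K_def field_simps)
    moreover have "0 \<le> \<epsilon> * (s + (norm w)\<^sup>2)" using \<epsilon> s by simp
    ultimately show ?thesis using 1 by linarith
  qed
  have "V s (dil s w) - Q s (dil s w) \<le> \<epsilon> * s * wt 1 w + K * (s * sqrt s) * wt (m + 4) w"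
    if s: "0 \<le> s" "s < \<rho>" for s w
  proof -
    have s1: "s \<le> 1" using s \<rho> by simp
    have n: "norm (dil s w) \<le> sqrt s * norm w" by (rule norm_dil_small[OF s(1) s1])
    also have "\<dots> \<le> 1 * norm w" using s1 s by (intro mult_right_mono) auto
    finally have n1: "norm (dil s w) \<le> norm w" by simp
    have "(norm (dil s w))\<^sup>2 \<le> (sqrt s * norm w)\<^sup>2" using n by (intro power_mono) auto
    then have "s + (norm (dil s w))\<^sup>2 \<le> s * wt 1 w" using s by (simp add: power_mult_distrib wt_def algebra_simps)
    then have 1: "\<epsilon> * (s + (norm (dil s w))\<^sup>2) \<le> \<epsilon> * s * wt 1 w" using \<epsilon> by (simp add: mult_left_mono mult.assoc)
    have "norm (dil s w) ^ 3 \<le> (sqrt s * norm w) ^ 3" using n by (intro power_mono) auto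
    also have "\<dots> = s * sqrt s * norm w ^ 3" using s by (simp add: power3_eq_cube mult_ac)
    also have "\<dots> \<le> s * sqrt s * wt 3 w" using s norm_power_le_wt[of w 3] by (intro mult_left_mono) auto
    finally have "norm (dil s w) ^ 3 * wt (m + 1) (dil s w) \<le> (s * sqrt s * wt 3 w) * wt (m + 1) w"
      using wt_norm_mono[OF n1, of "m + 1"] s wt_pos[of 3 w] wt_pos[of "m + 1" "dil s w"] by (intro mult_mono) auto
    also have "\<dots> = (s * sqrt s) * wt (m + 4) w"
    proof -
      have "wt (m + 4) w = wt 3 w * wt (m + 1) w" by (simp add: wt_add[symmetric] add.commute)
      then show ?thesis by simp
    qed
    finally have "K * (norm (dil s w) ^ 3 * wt (m + 1) (dil s w)) \<le> K * ((s * sqrt s) * wt (m + 4) w)"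
      using K by (intro mult_left_mono)
    then show ?thesis using far[OF s, of "dil s w"] 1 by (simp add: mult.assoc)
  qed
  then show ?thesis using K by blast
qed

lemma sum_lessThan_add: "(\<Sum>i<m + n. f i) = (\<Sum>i<m. f i) + (\<Sum>i<n. f (m + i))"
  for f :: "nat \<Rightarrow> 'b::comm_monoid_add"
  by (induction n) (simp_all add: add.assoc)

locale vector_pair = sublinear_expectation H E
  for H :: "('w \<Rightarrow> real) set" and E +
  fixes X \<eta> :: "'w \<Rightarrow> real ^ 'd"
  assumes X: "random_vector H X" and \<eta>: "random_vector H \<eta>"
begin

text \<open>The expectation as a functional of functions of the pair. The axioms are conditional on
  membership in H, so its rules ask for arguments in \<open>C_lLip\<close>.\<close>

definition EE :: "((real ^ 'd) \<times> (real ^ 'd) \<Rightarrow> real) \<Rightarrow> real" where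
  "EE f = E (\<lambda>\<omega>. f (X \<omega>, \<eta> \<omega>))"

text \<open>The closure axiom speaks of sequences, so with d = CARD('d) the coordinates of X are
  listed below index d and those of \<eta> from d to 2 d - 1. The listing preserves norms, hence the
  Lipschitz bound carries over unchanged.\<close>

lemma C_lLip_in_H:
  fixes f :: "(real ^ 'd) \<times> (real ^ 'd) \<Rightarrow> real"
  assumes "f \<in> C_lLip" shows "(\<lambda>\<omega>. f (X \<omega>, \<eta> \<omega>)) \<in> H"
proof -
  let ?d = "CARD('d)"
  obtain h where h: "bij_betw h {0..<?d} (UNIV :: 'd set)" using ex_bij_betw_nat_finite[of "UNIV :: 'd set"] by auto
  define g where "g = inv_into {0..<?d} h"
  have g: "bij_betw g UNIV {0..<?d}" unfolding g_def by (rule bij_betw_inv_into[OF h])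
  have hg: "h (g j) = j" for j using bij_betw_inv_into_right[OF h, of j] by (simp add: g_def)
  have glt: "g j < ?d" for j using bij_betwE[OF g] by auto
  define vec where "vec x = ((\<chi> j. x (g j)), (\<chi> j. x (?d + g j)))" for x :: "nat \<Rightarrow> real"
  have vec_diff: "vec x - vec y = vec (\<lambda>i. x i - y i)" for x y by (simp add: vec_def vec_eq_iff)
  have norm_vec: "norm (vec x) = L2_set x {..<2 * ?d}" for x
  proof -
    have s: "(\<Sum>j\<in>UNIV. F (g j)) = (\<Sum>i<?d. F i)" for F :: "nat \<Rightarrow> real"
      using sum.reindex_bij_betw[OF g, of F] by (simp add: atLeast0LessThan)
    have "(norm (fst (vec x)))\<^sup>2 = (\<Sum>i<?d. (x i)\<^sup>2)" "(norm (snd (vec x)))\<^sup>2 = (\<Sum>i<?d. (x (?d + i))\<^sup>2)"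
      using s[of "\<lambda>i. (x i)\<^sup>2"] s[of "\<lambda>i. (x (?d + i))\<^sup>2"]
      by (simp_all add: vec_def norm_vec_def L2_set_def sum_nonneg)
    then show ?thesis
      by (simp add: norm_prod_def L2_set_def mult_2 sum_lessThan_add)
  qed
  obtain C m where C: "C > 0"
    and f: "\<And>x y. \<bar>f x - f y\<bar> \<le> C * (1 + norm x ^ m + norm y ^ m) * norm (x - y)"
    using assms unfolding C_lLip_def by blast
  have fn: "(\<lambda>x. f (vec x)) \<in> C_lLip_nat (2 * ?d)"
    unfolding C_lLip_nat_def using C f[of "vec _" "vec _"] by (auto simp: vec_diff norm_vec)
  define Xs where "Xs i = (if i < ?d then (\<lambda>\<omega>. X \<omega> $ h i) else (\<lambda>\<omega>. \<eta> \<omega> $ h (i - ?d)))" for i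
  have XsH: "Xs i \<in> H" for i using X \<eta> by (simp add: Xs_def random_vector_def)
  have "(\<lambda>\<omega>. f (vec (\<lambda>i. Xs i \<omega>))) \<in> H" by (rule lLip_in[OF fn XsH])
  moreover have "vec (\<lambda>i. Xs i \<omega>) = (X \<omega>, \<eta> \<omega>)" for \<omega>
    by (simp add: vec_def Xs_def hg glt vec_eq_iff)
  ultimately show ?thesis by simp
qed

lemma EE_mono: "f \<in> C_lLip \<Longrightarrow> g \<in> C_lLip \<Longrightarrow> (\<And>w. f w \<le> g w) \<Longrightarrow> EE f \<le> EE g"
  unfolding EE_def by (intro mono C_lLip_in_H) auto

lemma EE_add: "f \<in> C_lLip \<Longrightarrow> g \<in> C_lLip \<Longrightarrow> EE (\<lambda>w. f w + g w) \<le> EE f + EE g"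
  unfolding EE_def by (intro subadditive C_lLip_in_H) auto

lemma EE_cmult: "f \<in> C_lLip \<Longrightarrow> 0 \<le> c \<Longrightarrow> EE (\<lambda>w. c * f w) = c * EE f"
  unfolding EE_def by (intro pos_homogeneous C_lLip_in_H) auto

lemma EE_const: "EE (\<lambda>_. c) = c"
  unfolding EE_def by (rule const)

lemma EE_sub: assumes "f \<in> C_lLip" "g \<in> C_lLip" shows "EE f - EE g \<le> EE (\<lambda>w. f w - g w)"
  using EE_add[OF C_lLip_diff[OF assms] assms(2)] by simp

lemma EE_close:
  assumes "f \<in> C_lLip" "g \<in> C_lLip" "h \<in> C_lLip" "\<And>w. \<bar>f w - g w\<bar> \<le> h w"
  shows "\<bar>EE f - EE g\<bar> \<le> EE h"
proof -
  have le: "f w - g w \<le> h w" "g w - f w \<le> h w" for w using assms(4)[of w] by auto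
  have "EE (\<lambda>w. f w - g w) \<le> EE h" "EE (\<lambda>w. g w - f w) \<le> EE h"
    by (rule EE_mono[OF C_lLip_diff[OF assms(1,2)] assms(3) le(1)], rule EE_mono[OF C_lLip_diff[OF assms(2,1)] assms(3) le(2)])
  then show ?thesis using EE_sub[OF assms(1,2)] EE_sub[OF assms(2,1)] by linarith
qed

lemma EE_const_add: assumes "f \<in> C_lLip" shows "EE (\<lambda>w. c + f w) = c + EE f"
proof (rule antisym)
  show "EE (\<lambda>w. c + f w) \<le> c + EE f" using EE_add[OF C_lLip_const assms, of c] by (simp add: EE_const)
  have "EE (\<lambda>w. (- c) + (c + f w)) \<le> EE (\<lambda>w. - c) + EE (\<lambda>w. c + f w)"
    by (intro EE_add C_lLip_const C_lLip_add assms)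
  then show "c + EE f \<le> EE (\<lambda>w. c + f w)" by (simp add: EE_const)
qed

definition mom :: "nat \<Rightarrow> real" where "mom m = EE (wt m)"

lemma mom_ge_1: "1 \<le> mom m"
proof -
  have "EE (\<lambda>_. 1) \<le> EE (wt m)" by (intro EE_mono C_lLip_const C_lLip_wt wt_ge_1)
  then show ?thesis by (simp add: EE_const mom_def)
qed

text \<open>At f = \<phi> this is the function u of the theorem, with (x, y) as one variable
  z.\<close>

definition S :: "real \<Rightarrow> ((real ^ 'd) \<times> (real ^ 'd) \<Rightarrow> real) \<Rightarrow> (real ^ 'd) \<times> (real ^ 'd) \<Rightarrow> real" where
  "S t f z = EE (\<lambda>w. f (z + dil t w))"

lemma C_lLip_dil: assumes "f \<in> C_lLip" "0 \<le> t" shows "(\<lambda>w. f (z + dil t w)) \<in> C_lLip"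
proof -
  obtain C m where f: "wl C m f" using assms C_lLip_iff_wl by blast
  have "1 \<le> (1 + t) * 2" using assms by simp
  then show ?thesis by (rule C_lLip_wl[OF wl_affine[OF f dil_diff norm_dil_le2[OF assms(2) order_refl]]])
qed

text \<open>The constant of \<open>wt_affine_le\<close> for the operator bound (1 + T) * 2 of
  \<open>dil t\<close> with t \<le> T.\<close>

definition KS :: "nat \<Rightarrow> real \<Rightarrow> real" where "KS m T = 2 ^ m * ((1 + T) * 2) ^ (2 * m)"

lemma KS_nonneg: "0 \<le> T \<Longrightarrow> 0 \<le> KS m T" by (simp add: KS_def)

lemma wt_dil: assumes "0 \<le> t" "t \<le> T" shows "wt m (z + dil t w) \<le> KS m T * wt m w * wt m z"
  unfolding KS_def by (rule wt_affine_le[OF norm_dil_le2[OF assms]]) (use assms in simp)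

lemma S_wl:
  assumes f: "wl C m f" and t: "0 \<le> t" "t \<le> T"
  shows "wl (C * KS m T * mom m) m (S t f)"
proof (rule wlI)
  have C: "0 \<le> C" by (rule wl_nonneg[OF f])
  have af: "f \<in> C_lLip" by (rule C_lLip_wl[OF f])
  have T: "0 \<le> T" using t by simp
  fix z z' :: "(real ^ 'd) \<times> (real ^ 'd)"
  have mw: "EE (\<lambda>w. c * wt m w) = c * mom m" if "0 \<le> c" for c
    unfolding mom_def by (rule EE_cmult[OF C_lLip_wt that])
  have nn: "0 \<le> C * KS m T * wt m z" using C KS_nonneg[OF T, of m] wt_pos[of m z] by simp
  have "\<bar>EE (\<lambda>w. f (z + dil t w)) - EE (\<lambda>_. 0)\<bar> \<le> EE (\<lambda>w. (C * KS m T * wt m z) * wt m w)"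
  proof (rule EE_close[OF C_lLip_dil[OF af t(1)] C_lLip_const C_lLip_cmult[OF C_lLip_wt]])
    fix w
    show "\<bar>f (z + dil t w) - 0\<bar> \<le> (C * KS m T * wt m z) * wt m w"
      using wl_growth[OF f, of "z + dil t w"] mult_left_mono[OF wt_dil[OF t, of m z w] C] by (simp add: mult_ac)
  qed
  then show "norm (S t f z) \<le> C * KS m T * mom m * wt m z"
    unfolding mw[OF nn] by (simp add: S_def EE_const mult_ac)
  define B where "B = C * KS m T * (wt m z + wt m z') * norm (z - z')"
  have B: "0 \<le> B" using C KS_nonneg[OF T, of m] wt_pos[of m z] wt_pos[of m z'] by (simp add: B_def)
  have "\<bar>EE (\<lambda>w. f (z + dil t w)) - EE (\<lambda>w. f (z' + dil t w))\<bar> \<le> EE (\<lambda>w. B * wt m w)"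
  proof (rule EE_close[OF C_lLip_dil[OF af t(1)] C_lLip_dil[OF af t(1)] C_lLip_cmult[OF C_lLip_wt]])
    fix w
    have "\<bar>f (z + dil t w) - f (z' + dil t w)\<bar> \<le> C * (wt m (z + dil t w) + wt m (z' + dil t w)) * norm (z - z')"
      using wl_lip[OF f, of "z + dil t w" "z' + dil t w"] by simp
    also have "\<dots> \<le> C * (KS m T * wt m w * wt m z + KS m T * wt m w * wt m z') * norm (z - z')"
      by (intro mult_right_mono mult_left_mono add_mono wt_dil t C) auto
    also have "\<dots> = B * wt m w" by (simp add: B_def algebra_simps)
    finally show "\<bar>f (z + dil t w) - f (z' + dil t w)\<bar> \<le> B * wt m w" .
  qed
  then show "norm (S t f z - S t f z') \<le> C * KS m T * mom m * (wt m z + wt m z') * norm (z - z')"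
    unfolding mw[OF B] by (simp add: S_def B_def mult_ac)
qed

text \<open>The Lipschitz bound in space, integrated: the displacement \<open>dil s w\<close> is at
  most (sqrt s + s) |w|, and the factor |w| costs one more moment.\<close>

lemma S_time:
  assumes f: "wl C m f" and s: "0 \<le> s" "s \<le> T"
  shows "\<bar>S s f z - f z\<bar> \<le> C * (KS m T + 1) * mom (m + 1) * wt m z * (sqrt s + s)"
proof -
  have C: "0 \<le> C" by (rule wl_nonneg[OF f])
  have af: "f \<in> C_lLip" by (rule C_lLip_wl[OF f])
  have T: "0 \<le> T" using s by simp
  define B where "B = C * (KS m T + 1) * wt m z * (sqrt s + s)"
  have B: "0 \<le> B" using C KS_nonneg[OF T, of m] wt_pos[of m z] s by (simp add: B_def)
  have "\<bar>EE (\<lambda>w. f (z + dil s w)) - EE (\<lambda>_. f z)\<bar> \<le> EE (\<lambda>w. B * wt (m + 1) w)"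
  proof (rule EE_close[OF C_lLip_dil[OF af s(1)] C_lLip_const C_lLip_cmult[OF C_lLip_wt]])
    fix w
    have "\<bar>f (z + dil s w) - f z\<bar> \<le> C * (wt m (z + dil s w) + wt m z) * norm (dil s w)"
      using wl_lip[OF f, of "z + dil s w" z] by simp
    also have "\<dots> \<le> C * (KS m T * wt m w * wt m z + wt m w * wt m z) * ((sqrt s + s) * wt 1 w)"
    proof (intro mult_mono mult_left_mono add_mono wt_dil s C)
      show "wt m z \<le> wt m w * wt m z" using wt_ge_1[of m w] wt_pos[of m z] by simp
      have "(sqrt s + s) * norm w \<le> (sqrt s + s) * wt 1 w" using s norm_le_wt[of w] by (intro mult_left_mono) auto
      then show "norm (dil s w) \<le> (sqrt s + s) * wt 1 w" using norm_dil_le[OF s(1), of w] by linarith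
    qed (use C KS_nonneg[OF T, of m] wt_pos[of m w] wt_pos[of m z] wt_pos[of m "z + dil s w"] in auto)
    also have "\<dots> = B * wt (m + 1) w" unfolding wt_add[of m 1 w] by (simp add: B_def algebra_simps)
    finally show "\<bar>f (z + dil s w) - f z\<bar> \<le> B * wt (m + 1) w" .
  qed
  also have "EE (\<lambda>w. B * wt (m + 1) w) = B * mom (m + 1)"
    unfolding mom_def by (rule EE_cmult[OF C_lLip_wt B])
  finally show ?thesis by (simp add: S_def EE_const B_def mult_ac)
qed

section \<open>The operator G as a supremum of generators\<close>

definition GG :: "real ^ 'd \<Rightarrow> real ^ 'd ^ 'd \<Rightarrow> real" where
  "GG p A = EE (\<lambda>w. 1/2 * ((A *v fst w) \<bullet> fst w) + p \<bullet> snd w)"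

lemma bounded_linear_mult_fst: "bounded_linear (\<lambda>w. A *v fst w)" for A :: "real ^ 'd ^ 'd"
  using bounded_linear_compose[OF matrix_vector_mul_bounded_linear[of A] bounded_linear_fst] .

lemma GG_adm: "(\<lambda>w. 1/2 * ((A *v fst w) \<bullet> fst w) + p \<bullet> snd w) \<in> C_lLip" for A :: "real ^ 'd ^ 'd" and p :: "real ^ 'd"
  by (intro C_lLip_add C_lLip_cmult C_lLip_inner bounded_linear_mult_fst bounded_linear_fst
      C_lLip_bounded_linear bounded_linear_compose[OF bounded_linear_inner_right bounded_linear_snd])

lemma GG_eq: "G_fun E X \<eta> = GG"
  by (simp add: fun_eq_iff G_fun_def GG_def EE_def)

lemma GG_subadditive: "GG (p + p') (A + A') \<le> GG p A + GG p' A'"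
  unfolding GG_def using EE_add[OF GG_adm[of A p] GG_adm[of A' p']]
  by (simp add: matrix_vector_mult_add_rdistrib inner_add_left algebra_simps)

lemma GG_homogeneous: "0 \<le> c \<Longrightarrow> GG (c *\<^sub>R p) (c *\<^sub>R A) = c * GG p A"
  unfolding GG_def using EE_cmult[OF GG_adm[of A p], of c]
  by (simp add: scaleR_matrix_vector_assoc[symmetric] algebra_simps)

lemma GG_elliptic: "(\<And>x. (A *v x) \<bullet> x \<le> 0) \<Longrightarrow> GG 0 A \<le> 0"
  unfolding GG_def using EE_mono[OF GG_adm[of A 0] C_lLip_const, of 0] by (simp add: EE_const)

lemma GG_sup_of_gens: "sup_of_gens (\<lambda>D B. GG (snd D) (xx_block B))"
  by (rule elliptic_sup_of_gens[OF GG_subadditive GG_homogeneous GG_elliptic])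

lemma GG_bound: "GG (snd D) (xx_block B) \<le> mom 1 * (norm D + norm B)"
proof -
  have "GG (snd D) (xx_block B) \<le> EE (\<lambda>w. (norm D + norm B) * wt 1 w)"
    unfolding GG_def
  proof (intro EE_mono GG_adm C_lLip_cmult C_lLip_wt)
    fix w :: "(real ^ 'd) \<times> (real ^ 'd)"
    have nf: "norm (fst w) \<le> norm w" "norm (snd w) \<le> norm w" "norm (snd D) \<le> norm D"
      using norm_fst_le[of "fst w" "snd w"] norm_snd_le[of "snd w" "fst w"] norm_snd_le[of "snd D" "fst D"] by simp_all
    have "(xx_block B *v fst w) \<bullet> fst w \<le> norm (fst (blinfun_apply B (fst w, 0))) * norm (fst w)"
      unfolding xx_block_mult by (rule norm_cauchy_schwarz)
    also have "\<dots> \<le> (norm B * norm w) * norm w"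
    proof (intro mult_mono nf)
      have "norm (fst (blinfun_apply B (fst w, 0))) \<le> norm (blinfun_apply B (fst w, 0))"
        using norm_fst_le[of "fst (blinfun_apply B (fst w, 0))" "snd (blinfun_apply B (fst w, 0))"] by simp
      also have "\<dots> \<le> norm B * norm (fst w, 0 :: real ^ 'd)" by (rule norm_blinfun)
      also have "\<dots> \<le> norm B * norm w" using nf by (intro mult_left_mono) (auto simp: norm_Pair)
      finally show "norm (fst (blinfun_apply B (fst w, 0))) \<le> norm B * norm w" .
    qed auto
    also have "\<dots> \<le> norm B * wt 1 w" by (simp add: wt_def power2_eq_square mult.assoc mult_left_mono)
    finally have 1: "(xx_block B *v fst w) \<bullet> fst w \<le> norm B * wt 1 w" .
    have "snd D \<bullet> snd w \<le> norm (snd D) * norm (snd w)" by (rule norm_cauchy_schwarz)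
    also have "\<dots> \<le> norm D * wt 1 w" using nf norm_le_wt[of w] by (intro mult_mono) auto
    finally have "snd D \<bullet> snd w \<le> norm D * wt 1 w" .
    moreover have "0 \<le> norm B * wt 1 w" using wt_pos[of 1 w] by simp
    ultimately show "1/2 * ((xx_block B *v fst w) \<bullet> fst w) + snd D \<bullet> snd w \<le> (norm D + norm B) * wt 1 w"
      using 1 by (simp add: algebra_simps)
  qed
  also have "\<dots> = (norm D + norm B) * mom 1" unfolding mom_def by (rule EE_cmult[OF C_lLip_wt]) simp
  finally show ?thesis by (simp add: mult.commute)
qed

end

locale G_distributed = vector_pair H E X \<eta> for H :: "('w \<Rightarrow> real) set" and E and X \<eta> :: "'w \<Rightarrow> real ^ 'd" +
  assumes law: "\<And>a b. 0 \<le> a \<Longrightarrow> 0 \<le> b \<Longrightarrow>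
      ident_distributed
        (prod_expectation E E)
        (\<lambda>(\<omega>, \<omega>'). (a *\<^sub>R X \<omega> + b *\<^sub>R X \<omega>', a\<^sup>2 *\<^sub>R \<eta> \<omega> + b\<^sup>2 *\<^sub>R \<eta> \<omega>'))
        E
        (\<lambda>\<omega>. (sqrt (a\<^sup>2 + b\<^sup>2) *\<^sub>R X \<omega>, (a\<^sup>2 + b\<^sup>2) *\<^sub>R \<eta> \<omega>))"
begin

lemma law_EE:
  assumes "f \<in> C_lLip" "0 \<le> s" "0 \<le> t"
  shows "EE (\<lambda>w. EE (\<lambda>w'. f (dil s w + dil t w'))) = EE (\<lambda>w. f (dil (t + s) w))"
proof -
  have "prod_expectation E E (\<lambda>\<omega>. f ((\<lambda>(\<omega>, \<omega>'). (sqrt s *\<^sub>R X \<omega> + sqrt t *\<^sub>R X \<omega>', (sqrt s)\<^sup>2 *\<^sub>R \<eta> \<omega> + (sqrt t)\<^sup>2 *\<^sub>R \<eta> \<omega>')) \<omega>))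
     = E (\<lambda>\<omega>. f (sqrt ((sqrt s)\<^sup>2 + (sqrt t)\<^sup>2) *\<^sub>R X \<omega>, ((sqrt s)\<^sup>2 + (sqrt t)\<^sup>2) *\<^sub>R \<eta> \<omega>))"
    using law[of "sqrt s" "sqrt t"] assms unfolding ident_distributed_def by simp
  then show ?thesis
    using assms by (simp add: prod_expectation_def EE_def dil_def add.commute)
qed

lemma S_semigroup:
  assumes "f \<in> C_lLip" "0 \<le> s" "0 \<le> t"
  shows "S (t + s) f z = S s (S t f) z"
proof -
  have "(\<lambda>w. f (z + w)) \<in> C_lLip"
  proof -
    obtain C m where "wl C m f" using assms(1) C_lLip_iff_wl by blast
    from wl_affine[OF this, of "\<lambda>w. w" 1 z] show ?thesis by (intro C_lLip_wl) auto
  qed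
  from law_EE[OF this assms(2,3)] show ?thesis by (simp add: S_def add.assoc)
qed

text \<open>With a = b = 1 and a linear function the law reads 2 m = sqrt 2 m, where m is the
  expectation of the inner product of p and X.\<close>

lemma mean_zero: "EE (\<lambda>w. p \<bullet> fst w) = 0"
proof -
  have a: "(\<lambda>w :: (real ^ 'd) \<times> (real ^ 'd). p \<bullet> fst w) \<in> C_lLip"
    by (intro C_lLip_bounded_linear bounded_linear_compose[OF bounded_linear_inner_right bounded_linear_fst])
  let ?m = "EE (\<lambda>w. p \<bullet> fst w)"
  have "EE (\<lambda>w. EE (\<lambda>w'. p \<bullet> fst w + p \<bullet> fst w')) = EE (\<lambda>w. sqrt 2 * (p \<bullet> fst w))"
    using law_EE[OF a, of 1 1] by (simp add: dil_def inner_add_right)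
  then have "EE (\<lambda>w. ?m + p \<bullet> fst w) = sqrt 2 * ?m"
    by (simp add: EE_const_add[OF a] EE_cmult[OF a] add.commute)
  then have "2 * ?m = sqrt 2 * ?m" by (simp add: EE_const_add[OF a])
  then show ?thesis using sqrt2_less_2 by simp
qed

text \<open>The means for p and for -p both vanish, so subadditivity gives both inequalities: linear
  terms in X carry no uncertainty.\<close>

lemma EE_add_mean_zero:
  assumes "f \<in> C_lLip" shows "EE (\<lambda>w. p \<bullet> fst w + f w) = EE f"
proof (rule antisym)
  have a: "(\<lambda>w :: (real ^ 'd) \<times> (real ^ 'd). p \<bullet> fst w) \<in> C_lLip" for p
    by (intro C_lLip_bounded_linear bounded_linear_compose[OF bounded_linear_inner_right bounded_linear_fst])
  show "EE (\<lambda>w. p \<bullet> fst w + f w) \<le> EE f" using EE_add[OF a assms, of p] mean_zero[of p] by simp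
  show "EE f \<le> EE (\<lambda>w. p \<bullet> fst w + f w)"
    using EE_add[OF a C_lLip_add[OF a assms], of "- p" p] mean_zero[of "- p"] by simp
qed

text \<open>After dilation the x-gradient has order sqrt s but mean zero. The y-gradient and the x-x
  block have order s and form G; the mixed blocks of the Hessian have order s^(3/2) and the y-y
  block s^2.\<close>

lemma EE_quadratic:
  fixes c :: real and D :: "(real ^ 'd) \<times> (real ^ 'd)" and B :: "((real ^ 'd) \<times> (real ^ 'd)) \<Rightarrow>\<^sub>L ((real ^ 'd) \<times> (real ^ 'd))"
  assumes s: "0 \<le> s" "s \<le> 1"
  defines "q \<equiv> \<lambda>w. c + D \<bullet> dil s w + 1/2 * (blinfun_apply B (dil s w) \<bullet> dil s w)"
  shows "q \<in> C_lLip" "\<bar>EE q - (c + s * GG (snd D) (xx_block B))\<bar> \<le> 2 * norm B * mom 1 * (s * sqrt s)"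
proof -
  let ?g = "\<lambda>w. 1/2 * ((xx_block B *v fst w) \<bullet> fst w) + snd D \<bullet> snd w"
  have bd: "bounded_linear (dil s :: (real ^ 'd) \<times> (real ^ 'd) \<Rightarrow> _)"
    unfolding dil_def[abs_def]
    by (intro bounded_linear_Pair bounded_linear_compose[OF bounded_linear_scaleR_right] bounded_linear_fst bounded_linear_snd)
  show q: "q \<in> C_lLip" unfolding q_def
    by (intro C_lLip_add C_lLip_const C_lLip_cmult C_lLip_inner bd
      bounded_linear_compose[OF blinfun.bounded_linear_right bd]
      C_lLip_bounded_linear bounded_linear_compose[OF bounded_linear_inner_right bd])
  define p where "p w = c + ((sqrt s *\<^sub>R fst D) \<bullet> fst w + s * ?g w)" for w
  have sg: "(\<lambda>w. s * ?g w) \<in> C_lLip" by (rule C_lLip_cmult[OF GG_adm])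
  have a: "(\<lambda>w :: (real ^ 'd) \<times> (real ^ 'd). p \<bullet> fst w) \<in> C_lLip" for p
    by (intro C_lLip_bounded_linear bounded_linear_compose[OF bounded_linear_inner_right bounded_linear_fst])
  have p: "p \<in> C_lLip" unfolding p_def[abs_def] by (intro C_lLip_add C_lLip_const a sg)
  have Ep: "EE p = c + s * GG (snd D) (xx_block B)"
    unfolding p_def[abs_def] EE_const_add[OF C_lLip_add[OF a sg]] EE_add_mean_zero[OF sg] GG_def
      EE_cmult[OF GG_adm s(1)] ..
  have "\<bar>EE q - EE p\<bar> \<le> EE (\<lambda>w. (2 * norm B * (s * sqrt s)) * wt 1 w)"
  proof (rule EE_close[OF q p C_lLip_cmult[OF C_lLip_wt]])
    fix w :: "(real ^ 'd) \<times> (real ^ 'd)"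
    define x where "x = (fst w, 0 :: real ^ 'd)"
    define y where "y = (0 :: real ^ 'd, snd w)"
    have nx: "norm x \<le> norm w" "norm y \<le> norm w"
      using norm_fst_le[of "fst w" "snd w"] norm_snd_le[of "snd w" "fst w"] by (simp_all add: x_def y_def norm_Pair)
    have bb: "\<bar>blinfun_apply B v \<bullet> v'\<bar> \<le> norm B * (norm w)\<^sup>2" if "norm v \<le> norm w" "norm v' \<le> norm w" for v v'
    proof -
      have "\<bar>blinfun_apply B v \<bullet> v'\<bar> \<le> norm (blinfun_apply B v) * norm v'" by (rule Cauchy_Schwarz_ineq2)
      also have "\<dots> \<le> (norm B * norm w) * norm w"
        using that norm_blinfun[of B v] mult_left_mono[OF that(1) norm_ge_zero[of B]] by (intro mult_mono) auto
      finally show ?thesis by (simp add: power2_eq_square mult.assoc)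
    qed
    have Bx: "blinfun_apply B x \<bullet> x = (xx_block B *v fst w) \<bullet> fst w"
      by (simp add: x_def xx_block_mult inner_prod_def)
    have Dd: "D \<bullet> dil s w = (sqrt s *\<^sub>R fst D) \<bullet> fst w + s * (snd D \<bullet> snd w)"
      by (simp add: dil_def inner_prod_def)
    have "blinfun_apply B (r *\<^sub>R x + s *\<^sub>R y) \<bullet> (r *\<^sub>R x + s *\<^sub>R y)
      = (r * r) * (blinfun_apply B x \<bullet> x) + s * r * (blinfun_apply B x \<bullet> y + blinfun_apply B y \<bullet> x) + s * s * (blinfun_apply B y \<bullet> y)" for r
      by (simp add: blinfun.add_right blinfun.scaleR_right inner_add_left inner_add_right algebra_simps)
    from this[of "sqrt s"] have BB: "blinfun_apply B (dil s w) \<bullet> dil s w = s * ((xx_block B *v fst w) \<bullet> fst w)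
       + s * sqrt s * (blinfun_apply B x \<bullet> y + blinfun_apply B y \<bullet> x) + s * s * (blinfun_apply B y \<bullet> y)"
      unfolding dil_split x_def[symmetric] y_def[symmetric] Bx using s by simp
    have eq: "q w - p w = 1/2 * (s * sqrt s * (blinfun_apply B x \<bullet> y + blinfun_apply B y \<bullet> x) + s * s * (blinfun_apply B y \<bullet> y))"
      unfolding q_def p_def BB Dd by (simp add: algebra_simps)
    have ss: "s \<le> sqrt s" using s by (intro real_le_rsqrt) (auto simp: power2_eq_square mult_left_le)
    have "\<bar>s * sqrt s * (blinfun_apply B x \<bullet> y + blinfun_apply B y \<bullet> x)\<bar> \<le> s * sqrt s * (2 * (norm B * (norm w)\<^sup>2))"
      unfolding abs_mult using bb[of x y] bb[of y x] nx s by (intro mult_mono) auto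
    moreover have "\<bar>s * s * (blinfun_apply B y \<bullet> y)\<bar> \<le> s * sqrt s * (norm B * (norm w)\<^sup>2)"
      unfolding abs_mult using bb[of y y] nx s ss by (intro mult_mono) auto
    moreover have "s * sqrt s * (norm B * (norm w)\<^sup>2) \<le> s * sqrt s * (norm B * wt 1 w)"
      using s by (intro mult_left_mono) (auto simp: wt_def)
    ultimately show "\<bar>q w - p w\<bar> \<le> (2 * norm B * (s * sqrt s)) * wt 1 w"
      unfolding eq by (simp add: abs_le_iff algebra_simps)
  qed
  also have "\<dots> = (2 * norm B * (s * sqrt s)) * mom 1"
    unfolding mom_def using s by (intro EE_cmult C_lLip_wt) auto
  finally show "\<bar>EE q - (c + s * GG (snd D) (xx_block B))\<bar> \<le> 2 * norm B * mom 1 * (s * sqrt s)"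
    unfolding Ep by (simp add: mult_ac)
qed

end

section \<open>The viscosity property and uniqueness\<close>

context G_distributed begin

text \<open>The sign \<sigma> treats touching from above and from below at once. The Taylor
  polynomial q replaces the test function near the point, \<open>far_bound\<close> extends the
  inequality to all w, and the moments of the weights turn it into a bound on expectations.\<close>

lemma S_touching:
  fixes \<sigma> :: real
  assumes f: "wl C m f" and test: "C12_test \<psi> \<psi>t D\<psi> H\<psi>" and t: "0 < t" and \<sigma>: "\<bar>\<sigma>\<bar> = 1"
    and ev: "\<forall>\<^sub>F (s, z') in nhds (t, z). \<sigma> * S s f z' \<le> \<sigma> * \<psi> s z'" and \<epsilon>: "0 < \<epsilon>"
  defines "q \<equiv> \<lambda>s w. (\<psi> t z - s * \<psi>t t z) + D\<psi> t z \<bullet> dil s w + 1/2 * (blinfun_apply (H\<psi> t z) (dil s w) \<bullet> dil s w)"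
  shows "\<exists>K\<ge>0. \<exists>\<rho>>0. \<forall>s. 0 < s \<longrightarrow> s < \<rho> \<longrightarrow> s \<le> 1 \<and> s \<le> t \<and>
    EE (\<lambda>w. \<sigma> * (S (t - s) f (z + dil s w) - q s w)) \<le> s * (\<epsilon> * mom 1) + K * (s * sqrt s)"
proof -
  obtain r where r: "0 < r" "r < t" "r < 1" and taylor: "\<And>s w. 0 \<le> s \<Longrightarrow> s < r \<Longrightarrow> norm w < r \<Longrightarrow>
    \<bar>\<psi> (t - s) (z + w) - (\<psi> t z - s * \<psi>t t z + D\<psi> t z \<bullet> w + 1/2 * (blinfun_apply (H\<psi> t z) w \<bullet> w))\<bar> \<le> \<epsilon> * (s + (norm w)\<^sup>2)"
    using C12_test_taylor[OF test t \<epsilon>, of z] by blast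
  obtain d where d: "0 < d" "\<And>p. dist p (t, z) < d \<Longrightarrow> \<sigma> * S (fst p) f (snd p) \<le> \<sigma> * \<psi> (fst p) (snd p)"
    using ev unfolding eventually_nhds_metric case_prod_unfold by blast
  define \<rho> where "\<rho> = min r (d / 2)"
  have \<rho>: "0 < \<rho>" "\<rho> \<le> 1" "\<rho> \<le> r" "\<rho> \<le> d / 2" using r d by (auto simp: \<rho>_def)
  define C' where "C' = C * KS m t * mom m"
  have wS: "wl C' m (S (t - s) f)" if "0 \<le> s" "s < \<rho>" for s
    unfolding C'_def by (rule S_wl[OF f]) (use that \<rho> r in auto)
  have C': "0 \<le> C'" using wl_nonneg[OF wS[of 0]] \<rho> by simp
  define V where "V s w = \<sigma> * S (t - s) f (z + w)" for s w
  have Vb: "\<bar>V s w\<bar> \<le> C' * (2 ^ m * wt m z) * wt m w" if "0 \<le> s" "s < \<rho>" for s w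
  proof -
    have "\<bar>S (t - s) f (z + w)\<bar> \<le> C' * wt m (z + w)" using wl_growth[OF wS[OF that], of "z + w"] by simp
    also have "\<dots> \<le> C' * (2 ^ m * wt m z * wt m w)" using wt_shift[of m z w] C' by (intro mult_left_mono)
    finally show ?thesis by (simp add: V_def abs_mult \<sigma> mult_ac)
  qed
  have near: "V s w \<le> \<sigma> * \<psi> t z - s * (\<sigma> * \<psi>t t z) + (\<sigma> *\<^sub>R D\<psi> t z) \<bullet> w
      + 1/2 * (blinfun_apply (\<sigma> *\<^sub>R H\<psi> t z) w \<bullet> w) + \<epsilon> * (s + (norm w)\<^sup>2)"
    if "0 \<le> s" "s < \<rho>" "norm w < \<rho>" for s w
  proof -
    have "dist (t - s, z + w) (t, z) \<le> s + norm w"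
      using sqrt_sum_squares_le_sum[of "dist (t - s) t" "dist (z + w) z"] that(1) by (simp add: dist_Pair_Pair dist_norm norm_Pair)
    then have "dist (t - s, z + w) (t, z) < d" using that \<rho> by linarith
    then have "V s w \<le> \<sigma> * \<psi> (t - s) (z + w)" using d(2) unfolding V_def by fastforce
    moreover have "\<sigma> * \<psi> (t - s) (z + w) - \<sigma> * (\<psi> t z - s * \<psi>t t z + D\<psi> t z \<bullet> w + 1/2 * (blinfun_apply (H\<psi> t z) w \<bullet> w))
       \<le> \<epsilon> * (s + (norm w)\<^sup>2)"
    proof -
      have "\<sigma> * x \<le> \<bar>x\<bar>" for x using abs_mult[of \<sigma> x] \<sigma> by (metis abs_ge_self mult_1)
      then show ?thesis using taylor[of s w] that \<rho> by (simp add: right_diff_distrib[symmetric]) (meson order_trans less_le_trans)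
    qed
    moreover have "\<sigma> * (\<psi> t z - s * \<psi>t t z + D\<psi> t z \<bullet> w + 1/2 * (blinfun_apply (H\<psi> t z) w \<bullet> w))
      = \<sigma> * \<psi> t z - s * (\<sigma> * \<psi>t t z) + (\<sigma> *\<^sub>R D\<psi> t z) \<bullet> w + 1/2 * (blinfun_apply (\<sigma> *\<^sub>R H\<psi> t z) w \<bullet> w)"
      by (simp add: blinfun.scaleR_left algebra_simps)
    ultimately show ?thesis by linarith
  qed
  have nn: "0 \<le> C' * (2 ^ m * wt m z)" using C' wt_pos[of m z] by simp
  obtain K where K: "0 \<le> K" and bound: "\<And>s w. 0 \<le> s \<Longrightarrow> s < \<rho> \<Longrightarrow>
     V s (dil s w) - (\<sigma> * \<psi> t z - s * (\<sigma> * \<psi>t t z) + (\<sigma> *\<^sub>R D\<psi> t z) \<bullet> dil s w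
      + 1/2 * (blinfun_apply (\<sigma> *\<^sub>R H\<psi> t z) (dil s w) \<bullet> dil s w)) \<le> \<epsilon> * s * wt 1 w + K * (s * sqrt s) * wt (m + 4) w"
    using far_bound[OF \<rho>(1,2) less_imp_le[OF \<epsilon>] nn Vb near] by blast
  show ?thesis
  proof (rule exI[of _ "K * mom (m + 4)"], intro exI[of _ \<rho>] conjI allI impI)
    show "0 \<le> K * mom (m + 4)" using K mom_ge_1[of "m + 4"] by simp
    fix s assume s: "0 < s" "s < \<rho>"
    show s1: "s \<le> 1" and st: "s \<le> t" using s \<rho> r by auto
    have aS: "(\<lambda>w. S (t - s) f (z + dil s w)) \<in> C_lLip"
      using C_lLip_dil[OF C_lLip_wl[OF wS]] s by simp
    have aq: "q s \<in> C_lLip" unfolding q_def using EE_quadratic(1)[of s] s s1 by simp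
    have "EE (\<lambda>w. \<sigma> * (S (t - s) f (z + dil s w) - q s w)) \<le> EE (\<lambda>w. \<epsilon> * s * wt 1 w + K * (s * sqrt s) * wt (m + 4) w)"
    proof (rule EE_mono[OF C_lLip_cmult[OF C_lLip_diff[OF aS aq]]
          C_lLip_add[OF C_lLip_cmult[OF C_lLip_wt] C_lLip_cmult[OF C_lLip_wt]]])
      fix w
      have "\<sigma> * (S (t - s) f (z + dil s w) - q s w) = V s (dil s w) - (\<sigma> * \<psi> t z - s * (\<sigma> * \<psi>t t z) + (\<sigma> *\<^sub>R D\<psi> t z) \<bullet> dil s w
      + 1/2 * (blinfun_apply (\<sigma> *\<^sub>R H\<psi> t z) (dil s w) \<bullet> dil s w))"
        by (simp add: V_def q_def blinfun.scaleR_left algebra_simps)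
      then show "\<sigma> * (S (t - s) f (z + dil s w) - q s w) \<le> \<epsilon> * s * wt 1 w + K * (s * sqrt s) * wt (m + 4) w"
        using bound[of s w] s by simp
    qed
    also have "\<dots> \<le> EE (\<lambda>w. \<epsilon> * s * wt 1 w) + EE (\<lambda>w. K * (s * sqrt s) * wt (m + 4) w)"
      by (rule EE_add[OF C_lLip_cmult[OF C_lLip_wt] C_lLip_cmult[OF C_lLip_wt]])
    also have "EE (\<lambda>w. \<epsilon> * s * wt 1 w) = \<epsilon> * s * mom 1"
      unfolding mom_def using \<epsilon> s by (intro EE_cmult C_lLip_wt) auto
    also have "EE (\<lambda>w. K * (s * sqrt s) * wt (m + 4) w) = K * (s * sqrt s) * mom (m + 4)"
      unfolding mom_def using K s by (intro EE_cmult C_lLip_wt) auto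
    finally show "EE (\<lambda>w. \<sigma> * (S (t - s) f (z + dil s w) - q s w)) \<le> s * (\<epsilon> * mom 1) + K * mom (m + 4) * (s * sqrt s)"
      by (simp add: mult_ac)
  qed (use \<rho> in auto)
qed

lemma S_touching_inequality:
  assumes f: "f \<in> C_lLip" and test: "C12_test \<psi> \<psi>t D\<psi> H\<psi>" and t: "0 < t" and eq: "S t f z = \<psi> t z" and \<sigma>: "\<sigma> = 1 \<or> \<sigma> = (-1 :: real)"
    and ev: "\<forall>\<^sub>F (s, z') in nhds (t, z). \<sigma> * S s f z' \<le> \<sigma> * \<psi> s z'"
  shows "\<sigma> * \<psi>t t z \<le> \<sigma> * GG (snd (D\<psi> t z)) (xx_block (H\<psi> t z))"
proof (rule field_le_epsilon)
  fix e :: real assume e: "0 < e"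
  obtain C m where w: "wl C m f" using f C_lLip_iff_wl by blast
  \<comment> \<open>Scaled by the moment with which the Taylor error is integrated, so that the
    error per unit of time is e.\<close>
  define \<epsilon> where "\<epsilon> = e / mom 1"
  have m1: "0 < mom 1" using mom_ge_1[of 1] by linarith
  have \<epsilon>: "0 < \<epsilon>" "\<epsilon> * mom 1 = e" using e m1 by (auto simp: \<epsilon>_def)
  define q where "q s w = (\<psi> t z - s * \<psi>t t z) + D\<psi> t z \<bullet> dil s w + 1/2 * (blinfun_apply (H\<psi> t z) (dil s w) \<bullet> dil s w)" for s w
  have \<sigma>1: "\<bar>\<sigma>\<bar> = 1" using \<sigma> by auto
  obtain K \<rho> where K: "0 \<le> K" and \<rho>: "0 < \<rho>" and bd: "\<And>s. 0 < s \<Longrightarrow> s < \<rho> \<Longrightarrow> s \<le> 1 \<and> s \<le> t \<and>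
    EE (\<lambda>w. \<sigma> * (S (t - s) f (z + dil s w) - q s w)) \<le> s * e + K * (s * sqrt s)"
    using S_touching[OF w test t \<sigma>1 ev \<epsilon>(1)] unfolding q_def \<epsilon>(2) by blast
  let ?G = "GG (snd (D\<psi> t z)) (xx_block (H\<psi> t z))"
  \<comment> \<open>Collects the two errors of order s^(3/2), from \<open>S_touching\<close> and
    from \<open>EE_quadratic\<close>.\<close>
  define K' where "K' = K + 2 * norm (H\<psi> t z) * mom 1"
  have main: "\<sigma> * \<psi>t t z \<le> \<sigma> * ?G + e + K' * sqrt s" if s: "0 < s" "s < \<rho>" for s
  proof -
    have s1: "s \<le> 1" "s \<le> t" using bd[OF s] by auto
    have aS: "(\<lambda>w. S (t - s) f (z + dil s w)) \<in> C_lLip"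
      by (rule C_lLip_dil[OF C_lLip_wl[OF S_wl[OF w _ order_refl]]]) (use s s1 in auto)
    have aq: "q s \<in> C_lLip" and Eq: "\<bar>EE (q s) - ((\<psi> t z - s * \<psi>t t z) + s * ?G)\<bar> \<le> 2 * norm (H\<psi> t z) * mom 1 * (s * sqrt s)"
      unfolding q_def using EE_quadratic[of s] s s1 by simp_all
    have "S t f z = EE (\<lambda>w. S (t - s) f (z + dil s w))"
      using S_semigroup[OF f, of s "t - s" z] s s1 by (simp add: S_def)
    then have E0: "\<psi> t z = EE (\<lambda>w. S (t - s) f (z + dil s w))" using eq by simp
    \<comment> \<open>For both signs this is E f - E g \<le> E (f - g), with the roles of f and g
      exchanged.\<close>
    have "\<sigma> * (\<psi> t z - EE (q s)) \<le> EE (\<lambda>w. \<sigma> * (S (t - s) f (z + dil s w) - q s w))"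
      using \<sigma>
    proof
      assume "\<sigma> = 1" then show ?thesis using EE_sub[OF aS aq] E0 by simp
    next
      assume "\<sigma> = -1" then show ?thesis using EE_sub[OF aq aS] E0 by simp
    qed
    then have "\<sigma> * (\<psi> t z - EE (q s)) \<le> s * e + K * (s * sqrt s)" using bd[OF s] by linarith
    then have "\<sigma> * (s * \<psi>t t z - s * ?G) \<le> s * e + K * (s * sqrt s) + 2 * norm (H\<psi> t z) * mom 1 * (s * sqrt s)"
      using Eq \<sigma> by (auto simp: abs_le_iff algebra_simps)
    then have "s * (\<sigma> * \<psi>t t z) \<le> s * (\<sigma> * ?G + e + K' * sqrt s)" by (simp add: K'_def algebra_simps)
    then show ?thesis using s by simp
  qed
  have "((\<lambda>s. \<sigma> * ?G + e + K' * sqrt s) \<longlongrightarrow> \<sigma> * ?G + e + K' * sqrt 0) (at_right 0)" by (intro tendsto_intros)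
  moreover have "\<forall>\<^sub>F s in at_right 0. \<sigma> * \<psi>t t z \<le> \<sigma> * ?G + e + K' * sqrt s"
    using eventually_at_right_real[OF \<rho>] by (rule eventually_mono) (use main in auto)
  ultimately have "\<sigma> * \<psi>t t z \<le> \<sigma> * ?G + e + K' * sqrt 0" by (rule tendsto_lowerbound) simp
  then show "\<sigma> * \<psi>t t z \<le> \<sigma> * ?G + e" by simp
qed

lemma S_vsub: "f \<in> C_lLip \<Longrightarrow> vsub (\<lambda>D B. GG (snd D) (xx_block B)) (\<lambda>t. S t f)"
  unfolding vsub_def using S_touching_inequality[of f _ _ _ _ _ _ 1] by simp

lemma S_vsuper: "f \<in> C_lLip \<Longrightarrow> vsuper (\<lambda>D B. GG (snd D) (xx_block B)) (\<lambda>t. S t f)"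
  unfolding vsuper_def using S_touching_inequality[of f _ _ _ _ _ _ "-1"] by simp

lemma wt_Pair_le:
  fixes x y :: "'a::real_normed_vector"
  assumes "0 < m"
  shows "wt m (x, y) \<le> 3 ^ m * (1 + norm x powr real (2 * m) + norm y powr real (2 * m))"
proof -
  have pw: "norm v powr real (2 * m) = norm v ^ (2 * m)" for v :: 'a
    using assms by (cases "v = 0") (auto simp: powr_realpow simp del: of_nat_mult)
  define M where "M = max 1 (max (norm x) (norm y))"
  have "1 \<le> M\<^sup>2" "(norm x)\<^sup>2 \<le> M\<^sup>2" "(norm y)\<^sup>2 \<le> M\<^sup>2"
    by (auto simp: M_def intro!: power_mono one_le_power)
  then have "1 + (norm (x, y))\<^sup>2 \<le> 3 * M\<^sup>2" by (simp add: norm_Pair)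
  then have "wt m (x, y) \<le> (3 * M\<^sup>2) ^ m" unfolding wt_def by (intro power_mono) auto
  also have "\<dots> = 3 ^ m * M ^ (2 * m)" by (simp add: power_mult_distrib power_mult)
  also have "M ^ (2 * m) \<le> 1 + norm x ^ (2 * m) + norm y ^ (2 * m)"
    unfolding M_def max_def by auto
  finally show ?thesis unfolding pw by simp
qed

lemma S_poly_lip_holder:
  assumes f: "f \<in> C_lLip" shows "poly_lip_holder (\<lambda>t x y. S t f (x, y))"
  unfolding poly_lip_holder_def
proof (intro allI impI)
  fix T :: real assume T: "0 < T"
  obtain C0 m0 where "wl C0 m0 f" using f C_lLip_iff_wl by blast
  \<comment> \<open>m > 0 is arranged because 0 \<open>powr\<close> 0 is 0 while the power 0 ^ 0 is
    1, and because the exponent in \<open>poly_lip_holder\<close> must be positive.\<close>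
  then obtain C m where w: "wl C m f" and m: "0 < m" using wl_weaken[of C0 m0 f C0 "Suc m0"] by auto
  define C1 where "C1 = C * KS m T * mom m"
  have wS: "wl C1 m (S t f)" if "t \<in> {0..T}" for t
    unfolding C1_def using that by (intro S_wl[OF w]) auto
  have C1: "0 \<le> C1" using wl_nonneg[OF wS[of 0]] T by simp
  define C2 where "C2 = C1 * (KS m T + 1) * mom (m + 1)"
  have C2: "0 \<le> C2" using C1 KS_nonneg[of T m] T mom_ge_1[of "m + 1"] by (simp add: C2_def)
  define C3 where "C3 = 2 * 3 ^ m * (C1 + C2) + 1"
  define P where "P x y = 1 + norm x powr real (2 * m) + norm y powr real (2 * m)" for x y :: "real ^ 'd"
  have P: "wt m (x, y) \<le> 3 ^ m * P x y" "1 \<le> P x y" for x y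
    using wt_Pair_le[OF m, of x y] by (auto simp: P_def)
  have C3: "0 < C3" using C1 C2 by (simp add: C3_def add_nonneg_pos)
  show "\<exists>C>0. \<exists>k::real. k > 0 \<and>
     (\<forall>t\<in>{0..T}. \<forall>s\<in>{0..T}. \<forall>x x' y y'.
        \<bar>S t f (x, y) - S t f (x', y')\<bar>
          \<le> C * (1 + norm x powr k + norm y powr k + norm x' powr k + norm y' powr k)
              * (norm (x - x') + norm (y - y'))
      \<and> \<bar>S t f (x, y) - S (t + s) f (x, y)\<bar>
          \<le> C * (1 + norm x powr k + norm y powr k) * (s + sqrt \<bar>s\<bar>))"
  proof (rule exI[of _ C3], intro exI[of _ "real (2 * m)"] conjI ballI allI C3)
    show "0 < real (2 * m)" using m by simp
    fix t s and x x' y y' :: "real ^ 'd" assume t: "t \<in> {0..T}" and s: "s \<in> {0..T}"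
    have "\<bar>S t f (x, y) - S t f (x', y')\<bar> \<le> C1 * (wt m (x, y) + wt m (x', y')) * norm ((x, y) - (x', y'))"
      using wl_lip[OF wS[OF t], of "(x, y)" "(x', y')"] by simp
    also have "\<dots> \<le> C1 * (3 ^ m * P x y + 3 ^ m * P x' y') * (norm (x - x') + norm (y - y'))"
    proof (intro mult_mono mult_left_mono add_mono P C1)
      show "norm ((x, y) - (x', y')) \<le> norm (x - x') + norm (y - y')"
        using sqrt_sum_squares_le_sum[of "norm (x - x')" "norm (y - y')"] by (simp add: norm_Pair)
    qed (use C1 P(2)[of x y] P(2)[of x' y'] wt_pos[of m "(x, y)"] wt_pos[of m "(x', y')"] in auto)
    also have "\<dots> = (3 ^ m * C1) * (P x y + P x' y') * (norm (x - x') + norm (y - y'))" by (simp add: algebra_simps)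
    also have "\<dots> \<le> C3 * (1 + norm x powr real (2 * m) + norm y powr real (2 * m) + norm x' powr real (2 * m) + norm y' powr real (2 * m))
              * (norm (x - x') + norm (y - y'))"
    proof (rule mult_right_mono)
      let ?W = "1 + norm x powr real (2 * m) + norm y powr real (2 * m) + norm x' powr real (2 * m) + norm y' powr real (2 * m)"
      have "P x y + P x' y' \<le> 2 * ?W" by (simp add: P_def)
      then have "(3 ^ m * C1) * (P x y + P x' y') \<le> (3 ^ m * C1) * (2 * ?W)" using C1 by (intro mult_left_mono) auto
      also have "\<dots> = (2 * 3 ^ m * C1) * ?W" by simp
      also have "\<dots> \<le> C3 * ?W"
        using C2 by (intro mult_right_mono) (auto simp: C3_def algebra_simps add_nonneg_nonneg)
      finally show "(3 ^ m * C1) * (P x y + P x' y') \<le> C3 * ?W" .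
    qed auto
    finally show "\<bar>S t f (x, y) - S t f (x', y')\<bar>
          \<le> C3 * (1 + norm x powr real (2 * m) + norm y powr real (2 * m) + norm x' powr real (2 * m) + norm y' powr real (2 * m))
              * (norm (x - x') + norm (y - y'))" .
    \<comment> \<open>The semigroup property makes the increment in time an action of
      \<open>S s\<close> on the Lipschitz function \<open>S t f\<close>, which \<open>S_time\<close>
      estimates.\<close>
    have "\<bar>S t f (x, y) - S (t + s) f (x, y)\<bar> = \<bar>S s (S t f) (x, y) - S t f (x, y)\<bar>"
      using S_semigroup[OF f, of s t "(x, y)"] s t by (simp add: abs_minus_commute)
    also have "\<dots> \<le> C2 * wt m (x, y) * (sqrt s + s)"
      unfolding C2_def by (rule S_time[OF wS[OF t]]) (use s in auto)
    also have "\<dots> \<le> C2 * (3 ^ m * P x y) * (sqrt s + s)"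
      using P(1)[of x y] C2 s by (intro mult_right_mono mult_left_mono) auto
    also have "\<dots> = (3 ^ m * C2) * P x y * (sqrt s + s)" by simp
    also have "\<dots> \<le> C3 * P x y * (sqrt s + s)"
    proof (intro mult_right_mono)
      have "0 \<le> 3 ^ m * C1" "0 \<le> 3 ^ m * C2" using C1 C2 by auto
      then show "3 ^ m * C2 \<le> C3" by (simp add: C3_def algebra_simps)
    qed (use s P(2)[of x y] in auto)
    finally show "\<bar>S t f (x, y) - S (t + s) f (x, y)\<bar>
          \<le> C3 * (1 + norm x powr real (2 * m) + norm y powr real (2 * m)) * (s + sqrt \<bar>s\<bar>)"
      using s by (simp add: P_def add.commute)
  qed
qed

end

text \<open>Growth is not among the hypotheses. It follows from the value at time 0 and point 0, the
  modulus in time at that point and the Lipschitz bound in space, at the cost of one power of the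
  weight.\<close>

lemma poly_lip_holder_tp_reg:
  fixes v :: "real \<Rightarrow> 'a::euclidean_space \<Rightarrow> 'a \<Rightarrow> real"
  assumes "poly_lip_holder v" shows "tp_reg (\<lambda>t z. v t (fst z) (snd z))"
  unfolding tp_reg_def
proof (intro allI impI)
  fix T :: real assume T: "0 < T"
  obtain C k where C: "0 < C" and k: "0 < k"
    and lip: "\<And>t x x' y y'. t \<in> {0..T} \<Longrightarrow> \<bar>v t x y - v t x' y'\<bar>
          \<le> C * (1 + norm x powr k + norm y powr k + norm x' powr k + norm y' powr k) * (norm (x - x') + norm (y - y'))"
    and hol: "\<And>t s x y. t \<in> {0..T} \<Longrightarrow> s \<in> {0..T} \<Longrightarrow> \<bar>v t x y - v (t + s) x y\<bar>
          \<le> C * (1 + norm x powr k + norm y powr k) * (s + sqrt \<bar>s\<bar>)"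
    using assms[unfolded poly_lip_holder_def, rule_format, OF T] T by (metis atLeastAtMost_iff order_refl less_imp_le)
  obtain n :: nat where n: "k \<le> real n" using real_arch_simple by blast
  have pw: "norm x powr k \<le> wt n z" if "norm x \<le> norm z" for x :: 'a and z :: "'a \<times> 'a"
  proof -
    have z1: "norm z \<le> 1 + (norm z)\<^sup>2" using norm_le_wt[of z] by (simp add: wt_def)
    have "norm x powr k \<le> (1 + (norm z)\<^sup>2) powr k" using k that z1 by (intro powr_mono2) auto
    also have "\<dots> \<le> (1 + (norm z)\<^sup>2) powr real n" using n by (intro powr_mono) auto
    also have "\<dots> = wt n z" unfolding wt_def by (rule powr_realpow) (simp add: add_pos_nonneg)
    finally show ?thesis .
  qed
  have nf: "norm (fst z) \<le> norm z" "norm (snd z) \<le> norm z" for z :: "'a \<times> 'a"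
    using norm_fst_le[of "fst z" "snd z"] norm_snd_le[of "snd z" "fst z"] by simp_all
  define V where "V t z = v t (fst z) (snd z)" for t z
  have L: "\<bar>V t z - V t z'\<bar> \<le> 6 * C * (wt n z + wt n z') * norm (z - z')" if t: "t \<in> {0..T}" for t z z'
  proof -
    have "\<bar>V t z - V t z'\<bar> \<le> C * (1 + norm (fst z) powr k + norm (snd z) powr k + norm (fst z') powr k + norm (snd z') powr k)
        * (norm (fst (z - z')) + norm (snd (z - z')))"
      using lip[OF t] by (simp add: V_def)
    also have "\<dots> \<le> C * (3 * (wt n z + wt n z')) * (2 * norm (z - z'))"
    proof (intro mult_mono mult_left_mono)
      show "1 + norm (fst z) powr k + norm (snd z) powr k + norm (fst z') powr k + norm (snd z') powr k \<le> 3 * (wt n z + wt n z')"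
        using pw[OF nf(1), of z] pw[OF nf(2), of z] pw[OF nf(1), of z'] pw[OF nf(2), of z'] wt_ge_1[of n z] wt_ge_1[of n z'] by (smt (verit))
      show "norm (fst (z - z')) + norm (snd (z - z')) \<le> 2 * norm (z - z')" using nf[of "z - z'"] by linarith
    qed (use C wt_pos[of n z] wt_pos[of n z'] in auto)
    finally show ?thesis by (simp add: algebra_simps)
  qed
  define Ch where "Ch = 3 * C * (sqrt T + 1)"
  have Ch: "0 \<le> Ch" using C T by (simp add: Ch_def)
  have H1: "\<bar>V t z - V t' z\<bar> \<le> Ch * wt n z * sqrt \<bar>t - t'\<bar>" if t: "t \<in> {0..T}" "t' \<in> {0..T}" "t \<le> t'" for t t' z
  proof -
    define s where "s = t' - t"
    have s: "s \<in> {0..T}" using t by (auto simp: s_def)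
    have "\<bar>V t z - V t' z\<bar> \<le> C * (1 + norm (fst z) powr k + norm (snd z) powr k) * (s + sqrt \<bar>s\<bar>)"
      using hol[OF t(1) s, of "fst z" "snd z"] by (simp add: V_def s_def)
    also have "\<dots> \<le> C * (3 * wt n z) * ((sqrt T + 1) * sqrt s)"
    proof (intro mult_mono mult_left_mono)
      show "1 + norm (fst z) powr k + norm (snd z) powr k \<le> 3 * wt n z"
        using pw[OF nf(1), of z] pw[OF nf(2), of z] wt_ge_1[of n z] by linarith
      \<comment> \<open>On [0, T] the linear part of the modulus is absorbed: s \<le> sqrt T * sqrt
        s.\<close>
      have "s = sqrt s * sqrt s" using s by simp
      also have "\<dots> \<le> sqrt T * sqrt s" using s by (intro mult_right_mono) auto
      finally show "s + sqrt \<bar>s\<bar> \<le> (sqrt T + 1) * sqrt s" using s by (simp add: algebra_simps)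
    qed (use C s wt_pos[of n z] in auto)
    finally show ?thesis using t by (simp add: Ch_def s_def algebra_simps abs_minus_commute)
  qed
  have H: "\<bar>V t z - V t' z\<bar> \<le> Ch * wt n z * sqrt \<bar>t - t'\<bar>" if "t \<in> {0..T}" "t' \<in> {0..T}" for t t' z
    using H1[of t t' z] H1[of t' t z] that by (cases "t \<le> t'") (auto simp: abs_minus_commute)
  define C4 where "C4 = \<bar>V 0 0\<bar> + Ch * sqrt T + 12 * C + Ch"
  have C4: "6 * C \<le> C4" "Ch \<le> C4" using C Ch T by (auto simp: C4_def add_nonneg_nonneg)
  show "\<exists>C m. (\<forall>t\<in>{0..T}. wl C m (\<lambda>z. v t (fst z) (snd z))) \<and>
     (\<forall>t\<in>{0..T}. \<forall>t'\<in>{0..T}. \<forall>z. \<bar>v t (fst z) (snd z) - v t' (fst z) (snd z)\<bar> \<le> C * wt m z * sqrt \<bar>t - t'\<bar>)"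
    unfolding V_def[symmetric]
  proof (intro exI[of _ C4] exI[of _ "Suc n"] conjI ballI allI)
    fix t assume t: "t \<in> {0..T}"
    show "wl C4 (Suc n) (V t)"
    proof (rule wlI)
      fix z z' :: "'a \<times> 'a"
      have "\<bar>V t 0\<bar> \<le> \<bar>V 0 0\<bar> + Ch * sqrt T"
      proof -
        have "\<bar>V t 0 - V 0 0\<bar> \<le> Ch * sqrt t" using H[OF t, of 0 0] t T by simp
        also have "\<dots> \<le> Ch * sqrt T" using t Ch by (intro mult_left_mono) auto
        finally show ?thesis by linarith
      qed
      moreover have "\<bar>V t z - V t 0\<bar> \<le> 12 * C * wt (Suc n) z"
      proof -
        have "\<bar>V t z - V t 0\<bar> \<le> 6 * C * (wt n z + 1) * norm z" using L[OF t, of z 0] by simp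
        also have "\<dots> \<le> 6 * C * (2 * wt n z) * (1 + (norm z)\<^sup>2)"
          using C wt_ge_1[of n z] norm_le_wt[of z] by (intro mult_mono mult_left_mono) (auto simp: wt_def)
        finally show ?thesis by (simp add: wt_Suc mult_ac)
      qed
      moreover have "(\<bar>V 0 0\<bar> + Ch * sqrt T) * 1 \<le> (\<bar>V 0 0\<bar> + Ch * sqrt T) * wt (Suc n) z"
        using Ch T by (intro mult_left_mono wt_ge_1) auto
      moreover have "0 \<le> Ch * wt (Suc n) z" using Ch wt_pos[of "Suc n" z] by simp
      ultimately show "norm (V t z) \<le> C4 * wt (Suc n) z" by (simp add: C4_def algebra_simps)
      have "6 * C * (wt n z + wt n z') * norm (z - z') \<le> C4 * (wt (Suc n) z + wt (Suc n) z') * norm (z - z')"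
        using C4 C wt_pos[of n z] wt_pos[of n z']
        by (intro mult_right_mono mult_mono add_mono wt_mono) auto
      then show "norm (V t z - V t z') \<le> C4 * (wt (Suc n) z + wt (Suc n) z') * norm (z - z')"
        using L[OF t, of z z'] by simp
    qed
    fix t' and z :: "'a \<times> 'a" assume t': "t' \<in> {0..T}"
    have "Ch * wt n z * sqrt \<bar>t - t'\<bar> \<le> C4 * wt (Suc n) z * sqrt \<bar>t - t'\<bar>"
      using C4 Ch wt_pos[of n z] by (intro mult_right_mono mult_mono wt_mono) auto
    then show "\<bar>V t z - V t' z\<bar> \<le> C4 * wt (Suc n) z * sqrt \<bar>t - t'\<bar>" using H[OF t t', of z] by linarith
  qed
qed

section \<open>The stated viscosity notions and the abstract ones\<close>

lemma viscosity_subsolution_iff_vsub: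
  "viscosity_subsolution G u \<longleftrightarrow> vsub (\<lambda>D B. G (snd D) (xx_block B)) (\<lambda>t z. u t (fst z) (snd z))"
  unfolding viscosity_subsolution_def vsub_def by (simp add: case_prod_unfold)

lemma viscosity_supersolution_iff_vsuper:
  "viscosity_supersolution G u \<longleftrightarrow> vsuper (\<lambda>D B. G (snd D) (xx_block B)) (\<lambda>t z. u t (fst z) (snd z))"
  unfolding viscosity_supersolution_def vsuper_def by (simp add: case_prod_unfold)

lemma eventually_positive_time:
  assumes "0 < (t::real)" shows "\<forall>\<^sub>F p in nhds (t, z). 0 < fst p"
proof -
  have "open ({0<..} \<times> UNIV :: (real \<times> 'a::topological_space) set)" by (intro open_Times open_greaterThan open_UNIV)
  from eventually_nhds_in_open[OF this, of "(t, z)"] assms show ?thesis by (auto elim: eventually_mono)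
qed

text \<open>Touching at a positive time is decided at nearby positive times. This matters because u
  is prescribed only for nonnegative times.\<close>

lemma vsub_cong:
  assumes "vsub F U" "\<And>t z. 0 < t \<Longrightarrow> U t z = U' t z" shows "vsub F U'"
  unfolding vsub_def
proof (intro allI impI)
  fix \<psi> \<psi>t D\<psi> H\<psi> t z
  assume *: "C12_test \<psi> \<psi>t D\<psi> H\<psi>" "0 < t" "U' t z = \<psi> t z" "\<forall>\<^sub>F (s, z') in nhds (t, z). U' s z' \<le> \<psi> s z'"
  have "\<forall>\<^sub>F (s, z') in nhds (t, z). U s z' \<le> \<psi> s z'"
    using eventually_conj[OF *(4) eventually_positive_time[OF *(2)]] by (rule eventually_mono) (auto simp: assms(2))
  then show "\<psi>t t z \<le> F (D\<psi> t z) (H\<psi> t z)"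
    using assms(1)[unfolded vsub_def, rule_format, OF *(1,2)] assms(2) * by simp
qed

lemma vsuper_cong:
  assumes "vsuper F U" "\<And>t z. 0 < t \<Longrightarrow> U t z = U' t z" shows "vsuper F U'"
  unfolding vsuper_def
proof (intro allI impI)
  fix \<psi> \<psi>t D\<psi> H\<psi> t z
  assume *: "C12_test \<psi> \<psi>t D\<psi> H\<psi>" "0 < t" "U' t z = \<psi> t z" "\<forall>\<^sub>F (s, z') in nhds (t, z). \<psi> s z' \<le> U' s z'"
  have "\<forall>\<^sub>F (s, z') in nhds (t, z). \<psi> s z' \<le> U s z'"
    using eventually_conj[OF *(4) eventually_positive_time[OF *(2)]] by (rule eventually_mono) (auto simp: assms(2))
  then show "F (D\<psi> t z) (H\<psi> t z) \<le> \<psi>t t z"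
    using assms(1)[unfolded vsuper_def, rule_format, OF *(1,2)] assms(2) * by simp
qed

lemma tp_reg_continuous:
  assumes "tp_reg V" shows "continuous_on ({0<..} \<times> UNIV) (\<lambda>(t, z). V t z)"
proof -
  have "isCont (\<lambda>(t, z). V t z) (t, z)" if t: "0 < t" for t z
  proof -
    have T: "0 < t + 1" using t by simp
    obtain C m where w: "\<And>s. s \<in> {0..t + 1} \<Longrightarrow> wl C m (V s)"
      and h: "\<And>s s' z. s \<in> {0..t + 1} \<Longrightarrow> s' \<in> {0..t + 1} \<Longrightarrow> \<bar>V s z - V s' z\<bar> \<le> C * wt m z * sqrt \<bar>s - s'\<bar>"
      using assms T unfolding tp_reg_def by metis
    have "continuous_on ({0<..<t + 1} \<times> UNIV) (\<lambda>(t, z). V t z)"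
      by (rule continuous_on_eq[OF continuous_on_subset[OF fam_cont[OF time_clamp_fam[OF w h T]]]])
         (auto simp: time_clamp_eq[symmetric])
    moreover have "open ({0<..<t + 1} \<times> (UNIV :: 'a set))" by (intro open_Times) auto
    ultimately show ?thesis using t by (auto simp: continuous_on_eq_continuous_at)
  qed
  then show ?thesis by (auto intro: continuous_at_imp_continuous_on)
qed

theorem proposition1p10:
  fixes H :: "('w \<Rightarrow> real) set" and E :: "('w \<Rightarrow> real) \<Rightarrow> real"
    and X \<eta> :: "'w \<Rightarrow> real ^ 'd"
    and \<phi> :: "(real ^ 'd) \<times> (real ^ 'd) \<Rightarrow> real"
    and u :: "real \<Rightarrow> real ^ 'd \<Rightarrow> real ^ 'd \<Rightarrow> real"
  assumes space: "sublinear_expectation H E"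
    and X: "random_vector H X" and \<eta>: "random_vector H \<eta>"
    and law: "\<And>a b. 0 \<le> a \<Longrightarrow> 0 \<le> b \<Longrightarrow>
      ident_distributed
        (prod_expectation E E)
        (\<lambda>(\<omega>, \<omega>'). (a *\<^sub>R X \<omega> + b *\<^sub>R X \<omega>', a\<^sup>2 *\<^sub>R \<eta> \<omega> + b\<^sup>2 *\<^sub>R \<eta> \<omega>'))
        E
        (\<lambda>\<omega>. (sqrt (a\<^sup>2 + b\<^sup>2) *\<^sub>R X \<omega>, (a\<^sup>2 + b\<^sup>2) *\<^sub>R \<eta> \<omega>))"
    and \<phi>: "\<phi> \<in> C_lLip"
    and u: "\<And>t x y. 0 \<le> t \<Longrightarrow> u t x y = E (\<lambda>\<omega>. \<phi> (x + sqrt t *\<^sub>R X \<omega>, y + t *\<^sub>R \<eta> \<omega>))"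
  shows "(\<forall>t\<ge>0. \<forall>s\<ge>0. \<forall>x y. u (t + s) x y = E (\<lambda>\<omega>. u t (x + sqrt s *\<^sub>R X \<omega>) (y + s *\<^sub>R \<eta> \<omega>)))
    \<and> poly_lip_holder u
    \<and> viscosity_solution (G_fun E X \<eta>) u \<and> (\<forall>x y. u 0 x y = \<phi> (x, y))
    \<and> (\<forall>v. poly_lip_holder v \<and> viscosity_solution (G_fun E X \<eta>) v \<and> (\<forall>x y. v 0 x y = \<phi> (x, y))
          \<longrightarrow> (\<forall>t\<ge>0. \<forall>x y. v t x y = u t x y))"
proof -
  interpret sublinear_expectation H E by (rule space)
  interpret G_distributed H E X \<eta> by unfold_locales (fact X \<eta> law)+
  let ?F = "\<lambda>D B. GG (snd D) (xx_block B)"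
  have uS: "u t x y = S t \<phi> (x, y)" if "0 \<le> t" for t x y
    using u[OF that] by (simp add: S_def EE_def dil_def)
  have semigroup: "u (t + s) x y = E (\<lambda>\<omega>. u t (x + sqrt s *\<^sub>R X \<omega>) (y + s *\<^sub>R \<eta> \<omega>))" if "0 \<le> t" "0 \<le> s" for t s x y
    using S_semigroup[OF \<phi> that(2,1), of "(x, y)"] that by (simp add: uS S_def[of s] EE_def dil_def[of s])
  have plh: "poly_lip_holder u"
    using S_poly_lip_holder[OF \<phi>] unfolding poly_lip_holder_def by (simp add: uS)
  have sub: "vsub ?F (\<lambda>t z. u t (fst z) (snd z))" by (rule vsub_cong[OF S_vsub[OF \<phi>]]) (simp add: uS)
  have super: "vsuper ?F (\<lambda>t z. u t (fst z) (snd z))" by (rule vsuper_cong[OF S_vsuper[OF \<phi>]]) (simp add: uS)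
  have init: "u 0 x y = \<phi> (x, y)" for x y by (simp add: u const)
  have visc: "viscosity_solution (G_fun E X \<eta>) u"
    unfolding viscosity_solution_def GG_eq viscosity_subsolution_iff_vsub viscosity_supersolution_iff_vsuper
    using sub super tp_reg_continuous[OF poly_lip_holder_tp_reg[OF plh]] by (simp add: case_prod_unfold)
  have "v t x y = u t x y"
    if v: "poly_lip_holder v" "viscosity_solution (G_fun E X \<eta>) v" "\<And>x y. v 0 x y = \<phi> (x, y)" and t: "0 \<le> t" for v t x y
  proof -
    have v': "vsub ?F (\<lambda>t z. v t (fst z) (snd z))" "vsuper ?F (\<lambda>t z. v t (fst z) (snd z))"
      using v(2) unfolding viscosity_solution_def GG_eq viscosity_subsolution_iff_vsub viscosity_supersolution_iff_vsuper by auto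
    have m1: "0 \<le> mom 1" using mom_ge_1[of 1] by linarith
    \<comment> \<open>Comparison is used twice, with u and v exchanged, since each is both a sub-
      and a supersolution with the same initial value.\<close>
    note cmp = viscosity_comparison[OF GG_sup_of_gens GG_bound m1]
    have "v t (fst (x, y)) (snd (x, y)) \<le> u t (fst (x, y)) (snd (x, y))"
      by (rule cmp[OF v'(1) poly_lip_holder_tp_reg[OF v(1)] super poly_lip_holder_tp_reg[OF plh] _ t]) (simp add: init v(3))
    moreover have "u t (fst (x, y)) (snd (x, y)) \<le> v t (fst (x, y)) (snd (x, y))"
      by (rule cmp[OF sub poly_lip_holder_tp_reg[OF plh] v'(2) poly_lip_holder_tp_reg[OF v(1)] _ t]) (simp add: init v(3))
    ultimately show ?thesis by simp
  qed
  then show ?thesis using semigroup plh visc init by blast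
qed

end
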